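(* Assume (H1), (H2), (H3), that $a(\lambda)\ne0$ for all real $\lambda$, and that $1/a$ has finitely many poles $ia_1,\dots,ia_N$ in $\mathbb C^+$, all simple, with norming constants $N_s$. Let $\mathbf H,\mathbf K$ be as in the triangular representation $\Psi(z,\lambda)=\mathbf H(z)e^{i\lambda z\sigma_3}+\int_z^\infty\mathbf K(z,\hat z)e^{i\lambda\hat z\sigma_3}d\hat z$. Then for all $y>z$, $$\mathbf K(z,y)+\mathbf H(z)\boldsymbol\Omega(z+y)+\int_z^\infty\mathbf K(z,u)\boldsymbol\Omega(u+y)\,du=0_{2\times2},$$ where $\boldsymbol\Omega(w)=\begin{pmatrix}0&\omega(w)\\-\omega(w)^*&0\end{pmatrix}$ and $\omega(w)=\rho(w)+\sum_{s=1}^N e^{-a_sw}N_s$.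
   Context: Pauli matrices: $\sigma_1=\begin{pmatrix}0&1\\1&0\end{pmatrix}$, $\sigma_2=\begin{pmatrix}0&-i\\ i&0\end{pmatrix}$, $\sigma_3=\begin{pmatrix}1&0\\0&-1\end{pmatrix}$. Let $\mathbf m=(m_1,m_2,m_3)^T:\mathbb R\to\mathbb R^3$ with $\|\mathbf m(z)\|=1$ for all $z$ and $\mathbf m(z)\to\mathbf e_3=(0,0,1)^T$ as $z\to\pm\infty$. Write $\mathbf m\cdot\boldsymbol\sigma=m_1\sigma_1+m_2\sigma_2+m_3\sigma_3$, and $\mathbf m^0=\mathbf m-\mathbf e_3$. Standing hypotheses: (H1) every entry of $\mathbf m^0$ is in $L^1(\mathbb R)$; (H2) $\mathbf m$ is absolutely continuous and its almost everywhere existing derivative $\mathbf m'$ has entries in $L^1(\mathbb R)$; (H3) $m_3(z)>-1$ for every $z\in\mathbb R$. Jost matrices $\Psi=(\psi\ \ \overline\psi)$ and $\Phi=(\overline\phi\ \ \phi)$ solve $V_z=i\lambda(\mathbf m\cdot\boldsymbol\sigma)V$ with $\Psi=e^{i\lambda z\sigma_3}(I_2+o(1))$ as $z\to+\infty$, $\Phi=e^{i\lambda z\sigma_3}(I_2+o(1))$ as $z\to-\infty$ (columns $\psi,\phi$ continue analytically to $\mathbb C^+$). Transition matrix: $\Psi=\Phi T$, $T(\lambda)=\begin{pmatrix}a&-b\\ b^*&a^*\end{pmatrix}$, $a$ analytic in $\mathbb C^+$. The triangular representation: there are $\mathbf H(z)$ with $\mathbf H\to I_2$ as $z\to+\infty$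 and $\mathbf K(z,y)$ with $\int_z^\infty\|\mathbf K(z,\hat z)\|d\hat z$ uniformly convergent such that the displayed representation of $\Psi$ holds for real $\lambda$. Norming constants: with $\tau_s=1/\dot a(ia_s)$, $N_s$ is defined by $\tau_s\phi(z,ia_s)=iN_s\psi(z,ia_s)$. The function $\rho\in L^1(\mathbb R)$ is defined by $b(\lambda)/a(\lambda)=\int_{-\infty}^\infty e^{-i\lambda w}\rho(w)\,dw$ for real $\lambda$.
   Formalization: The equation is stated for almost every y>z (for each z) instead of all y>z, since ρ and K(z,·) are only determined up to null sets and changing K(z,·) at one point would break the pointwise claim. *)

theory Defs
  imports "HOL-Analysis.Analysis"
begin

definition mat2 :: "complex \<Rightarrow> complex \<Rightarrow> complex \<Rightarrow> complex \<Rightarrow> complex^2^2" where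
  "mat2 p q r s = (\<chi> i j. if i = 1 then (if j = 1 then p else q) else (if j = 1 then r else s))"

definition sigma1 :: "complex^2^2" where "sigma1 = mat2 0 1 1 0"
definition sigma2 :: "complex^2^2" where "sigma2 = mat2 0 (-\<i>) \<i> 0"
definition sigma3 :: "complex^2^2" where "sigma3 = mat2 1 0 0 (-1)"

definition msig :: "real^3 \<Rightarrow> complex^2^2" where
  "msig v = (v $ 1) *\<^sub>R sigma1 + (v $ 2) *\<^sub>R sigma2 + (v $ 3) *\<^sub>R sigma3"

definition e3 :: "real^3" where "e3 = (\<chi> k. if k = 3 then 1 else 0)"

text \<open>ediag t = exp(i t sigma3)\<close>
definition ediag :: "real \<Rightarrow> complex^2^2" where
  "ediag t = mat2 (exp (\<i> * of_real t)) 0 0 (exp (- \<i> * of_real t))"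

definition Tmat :: "complex \<Rightarrow> complex \<Rightarrow> complex^2^2" where
  "Tmat a b = mat2 a (- b) (cnj b) (cnj a)"

definition abs_continuous_on :: "real set \<Rightarrow> (real \<Rightarrow> 'a::real_normed_vector) \<Rightarrow> bool" where
  "abs_continuous_on S f \<longleftrightarrow>
     (\<forall>e>0. \<exists>d>0. \<forall>(n::nat) (l::nat \<Rightarrow> real) (u::nat \<Rightarrow> real).
        (\<forall>k<n. l k \<le> u k \<and> {l k..u k} \<subseteq> S) \<and>
        (\<forall>j<n. \<forall>k<n. j \<noteq> k \<longrightarrow> {l j<..<u j} \<inter> {l k<..<u k} = {}) \<and>
        (\<Sum>k<n. u k - l k) < d
        \<longrightarrow> (\<Sum>k<n. norm (f (u k) - f (l k))) < e)"

definition Omega_of :: "complex \<Rightarrow> complex^2^2" where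
  "Omega_of c = mat2 0 c (- cnj c) 0"

definition cscale :: "complex \<Rightarrow> complex^2^2 \<Rightarrow> complex^2^2" where
  "cscale c A = (\<chi> i j. c * A $ i $ j)"

end

theory Submission
  imports Defs "HOL-Complex_Analysis.Complex_Analysis" "HOL-Probability.Probability" "HOL-Real_Asymp.Real_Asymp"
begin

text \<open>
  On the real line \<open>\<phi>/a = \<psi>' + (b/a) \<psi>\<close>, where \<open>\<psi>'\<close> is the second column of \<open>\<Psi>\<close>. Inserting the
  triangular representation, \<open>e^(i\<lambda>z) \<phi>/a\<close> minus its pole parts and a constant is the Fourier
  transform of an integrable function \<open>h\<close>, and on \<open>t > 0\<close> the function \<open>h\<close> is the second column of the left-hand
  side of the Marchenko equation. Both halves of the transform of \<open>h\<close> continue analytically to one side of the real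
  line; once \<open>e^(i\<lambda>z) \<phi>/a\<close> is known to be bounded near infinity in the upper half-plane, they glue to a
  bounded entire function, which vanishes by Liouville and Riemann--Lebesgue. The first column follows from the
  quaternionic symmetry that unitarity gives to \<open>\<Psi>\<close>, hence to \<open>H\<close> and \<open>K\<close>.

  The analytic input is the boundedness. Replace \<open>m\<close> by a piecewise constant function: the flow becomes
  a finite product of explicit matrices that is entire in \<open>\<lambda>\<close>, and \<open>e^(i\<lambda>x) \<phi>(x,\<lambda>)\<close> is the limit of such
  products, first on the real line and then, by the maximum principle, in the closed upper half-plane. Each factor
  contracts along \<open>+m\<close> and is the identity along \<open>-m\<close>, so that up to the total variation of \<open>m\<close> on
  \<open>(-\<infinity>, x]\<close>, which is small for \<open>x\<close> near \<open>-\<infinity>\<close>, the vector \<open>e^(i\<lambda>x) \<phi>(x,\<lambda>)\<close> is \<open>(0, 1)\<close> up to a phase,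
  uniformly in \<open>\<lambda>\<close>. Since \<open>|a| \<rightarrow> 1\<close> on the real line, this bounds \<open>a = det(\<psi>, \<phi>)\<close> from below near infinity.
\<close>

text \<open>The hypotheses give neither a differential equation nor a growth bound for
  \<open>phi\<close> off the real line, only a holomorphic continuation that is continuous up to the
  boundary. This is the obstacle: unimodular boundary values do not bound such a continuation
  (\<open>exp (- \<i> * l)\<close> is an example), so no maximum principle applies to
  \<open>phi\<close> directly. The approximating products satisfy the bound 1 in the whole
  half-plane, so the principle applies to their differences, and \<open>phi\<close> is recognised as
  their limit by its real boundary values. The weight exp(i \<lambda> x) turns the generator m
  \<cdot> \<sigma> into 1 + m \<cdot> \<sigma>, whose eigenvalues are 2 and 0, so that no mode grows
  in the upper half-plane. Since \<open>a\<close> does not depend on x, the determinant may be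
  evaluated at a point where the remaining variation of m is small. The kernel and
  \<open>rho\<close> enter only as integrable functions, and Fourier uniqueness determines
  \<open>h\<close> up to null sets; the equation is therefore obtained for almost every y.\<close>

no_notation fps_nth (infixl "$" 75)

section \<open>Half-line Fourier transforms\<close>

text \<open>The rule \<open>integrable_induct\<close> starts from all sets of finite measure, but
  half-line transforms are explicit only for intervals. A Dynkin-system argument reduces the sets to
  compact intervals; cutting everything down to \<open>{-n..n}\<close> keeps complements at finite
  measure.\<close>

lemma integrable_interval_induct [consumes 1, case_names interval add scale lim]:
  fixes P :: "(real \<Rightarrow> complex) \<Rightarrow> bool"
  assumes f: "integrable lborel f"
    and interval: "\<And>a b. P (indicator {a..b})"
    and add: "\<And>f g. integrable lborel f \<Longrightarrow> integrable lborel g \<Longrightarrow> P f \<Longrightarrow> P g \<Longrightarrow> P (\<lambda>x. f x + g x)"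
    and scale: "\<And>f c. integrable lborel f \<Longrightarrow> P f \<Longrightarrow> P (\<lambda>x. c * f x)"
    and lim: "\<And>s f. (\<And>i::nat. integrable lborel (s i)) \<Longrightarrow> (\<And>i. P (s i)) \<Longrightarrow> integrable lborel f \<Longrightarrow>
               (\<lambda>i. \<integral>x. norm (s i x - f x) \<partial>lborel) \<longlonglongrightarrow> 0 \<Longrightarrow> P f"
  shows "P f"
proof -
  \<comment> \<open>Dominated pointwise limits are limits in mean, so the closure hypothesis
    \<open>lim\<close> covers them.\<close>
  have dom: "P g" if s: "\<And>i::nat. integrable lborel (s i)" "\<And>i. P (s i)"
      and w: "integrable lborel (w :: real \<Rightarrow> real)" "\<And>i x. norm (s i x) \<le> w x"
      and c: "\<And>x. (\<lambda>i. s i x) \<longlonglongrightarrow> g x" for s g w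
  proof -
    have gm: "g \<in> borel_measurable lborel"
      by (rule borel_measurable_LIMSEQ_metric[OF borel_measurable_integrable[OF s(1)] c])
    have gw: "norm (g x) \<le> w x" for x
      using c[of x] w(2)[of _ x] by (intro LIMSEQ_le_const2[OF tendsto_norm]) auto
    have g: "integrable lborel g"
      by (rule Bochner_Integration.integrable_bound[OF w(1) gm]) (auto intro!: AE_I2 order_trans[OF gw])
    have "(\<lambda>i. \<integral>x. norm (s i x - g x) \<partial>lborel) \<longlonglongrightarrow> (\<integral>x. 0 \<partial>(lborel::real measure))"
    proof (rule integral_dominated_convergence[where w = "\<lambda>x. 2 * w x"])
      show "AE x in lborel. (\<lambda>i. norm (s i x - g x)) \<longlonglongrightarrow> 0"
        using c by (auto intro!: tendsto_norm_zero LIM_zero)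
      show "AE x in lborel. norm (norm (s i x - g x)) \<le> 2 * w x" for i
      proof (rule AE_I2)
        fix x
        have "norm (s i x - g x) \<le> norm (s i x) + norm (g x)" by (rule norm_triangle_ineq4)
        also have "\<dots> \<le> 2 * w x" using w(2)[of i x] gw[of x] by simp
        finally show "norm (norm (s i x - g x)) \<le> 2 * w x" by simp
      qed
    qed (use s(1) gm w(1) in auto)
    then show ?thesis using lim[OF s g] by simp
  qed
  have zero: "P (\<lambda>x. 0)" using interval[of 1 0] by (simp add: indicator_def[abs_def])
  have intind: "integrable lborel (indicator (A \<inter> {-n..n}) :: real \<Rightarrow> complex)"
    if "A \<in> sets borel" for A :: "real set" and n
  proof -
    have "emeasure lborel (A \<inter> {-n..n}) \<le> emeasure lborel {-n..n}"
      using that by (intro emeasure_mono) auto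
    also have "\<dots> < \<infinity>" by (simp add: emeasure_lborel_Icc_eq)
    finally have "integrable lborel (\<lambda>x. complex_of_real (indicator (A \<inter> {-n..n}) x))"
      using that by (intro integrable_of_real integrable_real_indicator) auto
    then show ?thesis by (simp add: of_real_indicator)
  qed
  have box: "P (indicator (A \<inter> {-n..n}))" if A: "A \<in> sets borel" for A :: "real set" and n :: real
  proof -
    have AA: "A \<in> sigma_sets UNIV (range (\<lambda>(a, b). {a..b::real}))"
      using A unfolding borel_eq_atLeastAtMost by simp
    have stable: "Int_stable (range (\<lambda>(a, b). {a..b::real}))"
      unfolding Int_stable_def
    proof (intro ballI)
      fix A B :: "real set"
      assume "A \<in> range (\<lambda>(a, b). {a..b})" "B \<in> range (\<lambda>(a, b). {a..b})"
      then obtain a b c d where "A = {a..b}" "B = {c..d}" by auto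
      then have "A \<inter> B = (\<lambda>(a, b). {a..b}) (max a c, min b d)" by simp
      then show "A \<inter> B \<in> range (\<lambda>(a, b). {a..b})" by (rule range_eqI)
    qed
    show ?thesis using stable subset_UNIV[of "range (\<lambda>(a, b). {a..b::real})", folded Pow_UNIV] AA
    proof (induction rule: sigma_sets_induct_disjoint)
      case (basic A)
      then show ?case by (auto intro: interval)
    next
      case empty
      then show ?case using zero by (simp add: indicator_def[abs_def])
    next
      case (compl A)
      have A': "A \<in> sets borel" using compl(1) unfolding borel_eq_atLeastAtMost by simp
      have "P (\<lambda>x. indicator {-n..n} x + (-1) * indicator (A \<inter> {-n..n}) x)"
        using compl intind[OF A', of n] interval[of "-n" n] intind[of UNIV n]
        by (intro add scale integrable_mult_right) auto
      moreover have "(\<lambda>x. indicator {-n..n} x + (-1) * indicator (A \<inter> {-n..n}) x) = (indicator ((UNIV - A) \<inter> {-n..n}) :: real \<Rightarrow> complex)"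
        by (auto simp: indicator_def fun_eq_iff)
      ultimately show ?case by simp
    next
      case (union A)
      have A': "A i \<in> sets borel" for i using union(2) unfolding borel_eq_atLeastAtMost by auto
      define s :: "nat \<Rightarrow> real \<Rightarrow> complex" where "s N x = (\<Sum>i<N. indicator (A i \<inter> {-n..n}) x)" for N x
      have si: "integrable lborel (s N)" for N unfolding s_def using intind[OF A'] by auto
      have sP: "P (s N)" for N
      proof (induction N)
        case 0 then show ?case using zero by (simp add: s_def[abs_def])
      next
        case (Suc N)
        have "s (Suc N) = (\<lambda>x. s N x + indicator (A N \<inter> {-n..n}) x)" by (simp add: s_def[abs_def])
        then show ?case using add[OF si intind[OF A'] Suc union(3)] by simp
      qed
      have ss: "s N x = indicator ((\<Union>i<N. A i) \<inter> {-n..n}) x" for N x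
      proof (induction N)
        case (Suc N)
        have "(\<Union>i<N. A i) \<inter> A N = {}"
          using disjoint_family_onD[OF union(1)] by (auto, metis IntI UNIV_I empty_iff less_irrefl)
        then have "indicator ((\<Union>i<N. A i) \<inter> {-n..n}) x + indicator (A N \<inter> {-n..n}) x = (indicator ((\<Union>i<Suc N. A i) \<inter> {-n..n}) x :: complex)"
          unfolding lessThan_Suc by (auto simp: indicator_def)
        then show ?case using Suc by (simp add: s_def)
      qed (simp add: s_def)
      show ?case
      proof (rule dom[where s = s and w = "indicator {-n..n}"])
        show "integrable lborel (indicator {-n..n} :: real \<Rightarrow> real)"
          by (rule integrable_real_indicator) (auto simp: emeasure_lborel_Icc_eq)
        show "norm (s i x) \<le> indicator {-n..n} x" for i x
          by (auto simp: ss indicator_def)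
        show "(\<lambda>i. s i x) \<longlonglongrightarrow> indicator (\<Union> (range A) \<inter> {-n..n}) x" for x
        proof (cases "x \<in> \<Union> (range A)")
          case True
          then obtain j where "x \<in> A j" by blast
          then have "\<forall>\<^sub>F i in sequentially. s i x = indicator (\<Union> (range A) \<inter> {-n..n}) x"
            unfolding ss eventually_sequentially by (intro exI[of _ "Suc j"]) (auto simp: indicator_def)
          then show ?thesis by (rule tendsto_eventually)
        qed (simp add: ss indicator_def)
      qed (use si sP in auto)
    qed
  qed
  have ind: "P (indicator A)" if A: "A \<in> sets lborel" "emeasure lborel A < \<infinity>" for A :: "real set"
  proof (rule dom[where s = "\<lambda>i. indicator (A \<inter> {-real i..real i})" and w = "indicator A"])
    show "(\<lambda>i. indicator (A \<inter> {-real i..real i}) x) \<longlonglongrightarrow> (indicator A x :: complex)" for x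
    proof (rule tendsto_eventually)
      obtain N :: nat where "\<bar>x\<bar> \<le> real N" using real_arch_simple by blast
      then show "\<forall>\<^sub>F i in sequentially. indicator (A \<inter> {-real i..real i}) x = (indicator A x :: complex)"
        unfolding eventually_sequentially by (intro exI[of _ N]) (auto simp: indicator_def)
    qed
  qed (use A box intind in \<open>auto simp: indicator_def\<close>)
  show ?thesis using f
  proof (induction rule: integrable_induct)
    case (base A c)
    have "integrable lborel (\<lambda>x. complex_of_real (indicator A x))"
      using base by (intro integrable_of_real integrable_real_indicator) auto
    then have "P (\<lambda>x. c * indicator A x)"
      using ind[OF base] by (intro scale) (auto simp: of_real_indicator)
    moreover have "(\<lambda>x. c * indicator A x) = (\<lambda>x. indicator A x *\<^sub>R c)" by (auto simp: indicator_def)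
    ultimately show ?case by simp
  next
    case (add f g) then show ?case using assms(3) by blast
  next
    case (lim f s)
    show ?case
      by (rule dom[where s = s and w = "\<lambda>x. 2 * norm (f x)"]) (use lim in auto)
  qed
qed

text \<open>The integral converges absolutely for integrable \<open>k\<close> when
  \<open>Im l \<ge> 0\<close>. Transforms with the opposite kernel exp(-i l t) are written as values
  at \<open>- l\<close>, which are available for \<open>Im l \<le> 0\<close>.\<close>

definition half_fourier :: "(real \<Rightarrow> complex) \<Rightarrow> complex \<Rightarrow> complex" where
  "half_fourier k l = (LINT t:{0..}|lborel. exp (\<i> * l * of_real t) * k t)"

lemma norm_exp_half_plane_le_1:
  assumes "Im l \<ge> 0" "t \<ge> 0" shows "norm (exp (\<i> * l * of_real t)) \<le> 1"
  using assms by (simp add: norm_exp_eq_Re)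

lemma norm_half_fourier_integrand_le:
  assumes "Im l \<ge> 0"
  shows "norm (indicator {0..} t *\<^sub>R (exp (\<i> * l * of_real t) * c)) \<le> norm c"
proof (cases "t \<ge> 0")
  case True
  have "norm (exp (\<i> * l * of_real t)) * norm c \<le> 1 * norm c"
    by (rule mult_right_mono[OF norm_exp_half_plane_le_1[OF assms True]]) simp
  then show ?thesis using True by (simp add: norm_mult)
qed simp

lemma half_fourier_integrable:
  assumes "integrable lborel k" "Im l \<ge> 0"
  shows "set_integrable lborel {0..} (\<lambda>t. exp (\<i> * l * of_real t) * k t)"
  unfolding set_integrable_def
proof (rule Bochner_Integration.integrable_bound[OF assms(1)])
  show "(\<lambda>x. indicator {0..} x *\<^sub>R (exp (\<i> * l * of_real x) * k x)) \<in> borel_measurable lborel"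
    using assms by measurable
  show "AE x in lborel. norm (indicator {0..} x *\<^sub>R (exp (\<i> * l * of_real x) * k x)) \<le> norm (k x)"
    by (intro AE_I2 norm_half_fourier_integrand_le assms)
qed

lemma half_fourier_bound:
  assumes "integrable lborel k" "Im l \<ge> 0"
  shows "norm (half_fourier k l) \<le> (\<integral>x. norm (k x) \<partial>lborel)"
proof -
  have "norm (half_fourier k l) \<le> (\<integral>t. norm (indicator {0..} t *\<^sub>R (exp (\<i> * l * of_real t) * k t)) \<partial>lborel)"
    unfolding half_fourier_def set_lebesgue_integral_def by (rule integral_norm_bound)
  also have "\<dots> \<le> (\<integral>x. norm (k x) \<partial>lborel)"
  proof (rule integral_mono)
    show "integrable lborel (\<lambda>t. norm (indicator {0..} t *\<^sub>R (exp (\<i> * l * of_real t) * k t)))"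
      using half_fourier_integrable[OF assms] by (simp only: set_integrable_def integrable_norm)
    show "norm (indicator {0..} t *\<^sub>R (exp (\<i> * l * of_real t) * k t)) \<le> norm (k t)" for t
      by (intro norm_half_fourier_integrand_le assms)
  qed (use assms in auto)
  finally show ?thesis .
qed

lemma half_fourier_add:
  assumes "integrable lborel f" "integrable lborel g" "Im l \<ge> 0"
  shows "half_fourier (\<lambda>x. f x + g x) l = half_fourier f l + half_fourier g l"
  using set_integral_add(2)[OF half_fourier_integrable[OF assms(1,3)] half_fourier_integrable[OF assms(2,3)]]
  by (simp add: half_fourier_def algebra_simps)

lemma half_fourier_scale: "half_fourier (\<lambda>x. c * f x) l = c * half_fourier f l"
  unfolding half_fourier_def set_integral_mult_right[symmetric] by (simp add: algebra_simps)

lemma half_fourier_diff: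
  assumes "integrable lborel f" "integrable lborel g" "Im l \<ge> 0"
  shows "half_fourier (\<lambda>x. f x - g x) l = half_fourier f l - half_fourier g l"
  using half_fourier_add[OF assms(1) integrable_mult_right[OF assms(2), of "-1"] assms(3)]
  by (simp add: half_fourier_scale[of "-1", simplified])

lemma half_fourier_interval:
  assumes "l \<noteq> 0"
  shows "half_fourier (indicator {a..b}) l =
    (if max a 0 \<le> b then (exp (\<i> * l * of_real b) - exp (\<i> * l * of_real (max a 0))) / (\<i> * l) else 0)"
proof -
  have "half_fourier (indicator {a..b}) l = (LINT t:{max a 0..b}|lborel. exp (\<i> * l * of_real t))"
    unfolding half_fourier_def set_lebesgue_integral_def
    by (rule Bochner_Integration.integral_cong) (auto simp: indicator_def)
  moreover have "(LINT t:{max a 0..b}|lborel. exp (\<i> * l * of_real t)) =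
      exp (\<i> * l * of_real b) / (\<i> * l) - exp (\<i> * l * of_real (max a 0)) / (\<i> * l)" if "max a 0 \<le> b"
    unfolding set_lebesgue_integral_def
  proof (rule integral_FTC_atLeastAtMost[OF that])
    show "((\<lambda>x. exp (\<i> * l * complex_of_real x) / (\<i> * l)) has_vector_derivative exp (\<i> * l * complex_of_real x)) (at x within {max a 0..b})" for x
    proof (rule has_vector_derivative_real_field)
      show "((\<lambda>w. exp (\<i> * l * w) / (\<i> * l)) has_field_derivative exp (\<i> * l * of_real x)) (at (complex_of_real x))"
        by (rule derivative_eq_intros refl | use assms in simp)+
    qed
  qed (auto intro!: continuous_intros)
  moreover have "(LINT t:{max a 0..b}|lborel. exp (\<i> * l * of_real t)) = 0" if "\<not> max a 0 \<le> b"
    using that by (subst atLeastatMost_empty) (auto simp: set_lebesgue_integral_def not_le max_def)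
  ultimately show ?thesis by (simp only: diff_divide_distrib split: if_split) blast
qed

text \<open>The kernel has modulus at most 1 on the half-line, so convergence in mean becomes
  uniform convergence on the closed half-plane. This carries holomorphy and decay from intervals to
  all integrable functions.\<close>

lemma half_fourier_uniform_limit:
  assumes s: "\<And>i::nat. integrable lborel (s i)" and f: "integrable lborel f"
    and lim: "(\<lambda>i. \<integral>x. norm (s i x - f x) \<partial>lborel) \<longlonglongrightarrow> 0"
  shows "uniform_limit {l. Im l \<ge> 0} (\<lambda>i. half_fourier (s i)) (half_fourier f) sequentially"
proof (rule uniform_limitI)
  fix e :: real assume e: "e > 0"
  from order_tendstoD(2)[OF lim e]
  show "\<forall>\<^sub>F n in sequentially. \<forall>l\<in>{l. Im l \<ge> 0}. dist (half_fourier (s n) l) (half_fourier f l) < e"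
  proof eventually_elim
    case (elim n)
    have "dist (half_fourier (s n) l) (half_fourier f l) < e" if "Im l \<ge> 0" for l
      using half_fourier_bound[of "\<lambda>x. s n x - f x" l] half_fourier_diff[OF s f that] elim s f that
      by (simp add: dist_norm)
    then show ?case by blast
  qed
qed

lemma half_fourier_holomorphic:
  assumes "integrable lborel k"
  shows "half_fourier k holomorphic_on {l. Im l > 0}"
  using assms
proof (induction rule: integrable_interval_induct)
  case (interval a b)
  have "(\<lambda>l. if max a 0 \<le> b then (exp (\<i> * l * of_real b) - exp (\<i> * l * of_real (max a 0))) / (\<i> * l) else 0)
      holomorphic_on {l. Im l > 0}"
    by (cases "max a 0 \<le> b") (auto intro!: holomorphic_intros)
  then show ?case
    by (rule holomorphic_transform) (subst half_fourier_interval, auto)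
next
  case (add f g)
  have "(\<lambda>l. half_fourier f l + half_fourier g l) holomorphic_on {l. Im l > 0}"
    using add by (intro holomorphic_intros)
  then show ?case
    by (rule holomorphic_transform) (use add in \<open>auto simp: half_fourier_add\<close>)
next
  case (scale f c)
  then show ?case by (auto simp: half_fourier_scale[abs_def] intro!: holomorphic_intros)
next
  case (lim s f)
  show ?case
  proof (rule holomorphic_uniform_sequence[OF open_halfspace_Im_gt lim.IH])
    fix x :: complex assume "x \<in> {l. Im l > 0}"
    then obtain d where d: "d > 0" "cball x d \<subseteq> {l. Im l > 0}"
      using open_halfspace_Im_gt[of 0] open_contains_cball by blast
    then show "\<exists>d>0. cball x d \<subseteq> {z. 0 < Im z} \<and> uniform_limit (cball x d) (\<lambda>n. half_fourier (s n)) (half_fourier f) sequentially"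
      by (intro exI[of _ d] conjI uniform_limit_on_subset[OF half_fourier_uniform_limit[OF lim.hyps]]) force+
  qed
qed

lemma half_fourier_continuous:
  assumes k: "integrable lborel k"
  shows "continuous_on {l. Im l \<ge> 0} (half_fourier k)"
  unfolding continuous_on_sequentially
proof (intro ballI allI impI, elim conjE)
  fix l and f :: "nat \<Rightarrow> complex"
  assume l: "l \<in> {l. Im l \<ge> 0}" and f: "\<forall>n. f n \<in> {l. Im l \<ge> 0}" "f \<longlonglongrightarrow> l"
  show "(half_fourier k \<circ> f) \<longlonglongrightarrow> half_fourier k l"
    unfolding half_fourier_def set_lebesgue_integral_def comp_def
  proof (rule integral_dominated_convergence[where w = "\<lambda>x. norm (k x)"])
    show "AE x in lborel. (\<lambda>i. indicator {0..} x *\<^sub>R (exp (\<i> * f i * of_real x) * k x)) \<longlonglongrightarrow>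
        indicator {0..} x *\<^sub>R (exp (\<i> * l * of_real x) * k x)"
      using f(2) by (intro AE_I2 tendsto_intros)
    show "AE x in lborel. norm (indicator {0..} x *\<^sub>R (exp (\<i> * f i * of_real x) * k x)) \<le> norm (k x)" for i
      using f(1) by (intro AE_I2 norm_half_fourier_integrand_le) auto
  qed (use k in \<open>auto intro!: borel_measurable_integrable\<close>)
qed

text \<open>The Riemann-Lebesgue lemma in all directions of the closed half-plane, as the lower
  bound on \<open>a\<close> requires. The transform of an interval is at most 2 / |l|; the threshold
  \<open>3 / e\<close> makes the estimate strict.\<close>

lemma half_fourier_at_infinity:
  assumes "integrable lborel k"
  shows "\<And>e. e > 0 \<Longrightarrow> \<exists>B. \<forall>l. Im l \<ge> 0 \<longrightarrow> norm l \<ge> B \<longrightarrow> norm (half_fourier k l) < e"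
  using assms
proof (induction rule: integrable_interval_induct)
  case (interval a b e)
  have "norm (half_fourier (indicator {a..b}) l) < e" if l: "Im l \<ge> 0" "norm l \<ge> 3 / e" for l
  proof -
    have l0: "l \<noteq> 0" using l(2) interval by auto
    have *: "norm (exp (\<i> * l * of_real b) - exp (\<i> * l * of_real (max a 0))) / norm l < e" if "max a 0 \<le> b"
    proof -
      have "norm (exp (\<i> * l * of_real b) - exp (\<i> * l * of_real (max a 0))) \<le> 1 + 1"
        by (intro order_trans[OF norm_triangle_ineq4] add_mono norm_exp_half_plane_le_1) (use l that in auto)
      also have "\<dots> < 3" by simp
      also have "3 \<le> e * norm l" using l(2) interval by (simp add: field_simps)
      finally show ?thesis using l0 by (simp add: field_simps)
    qed
    then show ?thesis
      unfolding half_fourier_interval[OF l0] using interval by (simp add: norm_divide norm_mult)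
  qed
  then show ?case by blast
next
  case (add f g)
  have "e / 2 > 0" using add by simp
  from add.IH(1)[OF this] add.IH(2)[OF this] obtain A B where
    AB: "\<forall>l. Im l \<ge> 0 \<longrightarrow> norm l \<ge> A \<longrightarrow> norm (half_fourier f l) < e / 2"
        "\<forall>l. Im l \<ge> 0 \<longrightarrow> norm l \<ge> B \<longrightarrow> norm (half_fourier g l) < e / 2" by blast
  have "norm (half_fourier (\<lambda>x. f x + g x) l) < e" if "Im l \<ge> 0" "norm l \<ge> max A B" for l
  proof -
    have "norm (half_fourier f l) < e / 2" "norm (half_fourier g l) < e / 2" using AB that by auto
    then show ?thesis
      using norm_triangle_ineq[of "half_fourier f l" "half_fourier g l"]
      unfolding half_fourier_add[OF add.hyps that(1)] by linarith
  qed
  then show ?case by blast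
next
  case (scale f c)
  have "e / (norm c + 1) > 0" using scale by (simp add: add_nonneg_pos)
  from scale.IH[OF this] obtain B where
    B: "\<And>l. Im l \<ge> 0 \<Longrightarrow> norm l \<ge> B \<Longrightarrow> norm (half_fourier f l) < e / (norm c + 1)" by blast
  have "norm (half_fourier (\<lambda>x. c * f x) l) < e" if "Im l \<ge> 0" "norm l \<ge> B" for l
  proof -
    have "norm c * norm (half_fourier f l) \<le> (norm c + 1) * norm (half_fourier f l)"
      by (intro mult_right_mono) auto
    also have "\<dots> < (norm c + 1) * (e / (norm c + 1))"
      using B[OF that] by (intro mult_strict_left_mono) (auto simp: add_nonneg_pos)
    also have "\<dots> = e" using norm_ge_zero[of c] by (simp add: field_simps add_nonneg_eq_0_iff)
    finally show ?thesis by (simp add: half_fourier_scale norm_mult)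
  qed
  then show ?case by blast
next
  case (lim s f)
  have e2: "e / 2 > 0" using lim by simp
  from uniform_limitD[OF half_fourier_uniform_limit[OF lim.hyps] e2]
  obtain n where n: "\<And>l. Im l \<ge> 0 \<Longrightarrow> dist (half_fourier (s n) l) (half_fourier f l) < e / 2"
    unfolding eventually_sequentially by blast
  from lim.IH[OF e2, of n] obtain B where
    B: "\<And>l. Im l \<ge> 0 \<Longrightarrow> norm l \<ge> B \<Longrightarrow> norm (half_fourier (s n) l) < e / 2" by blast
  have "norm (half_fourier f l) < e" if "Im l \<ge> 0" "norm l \<ge> B" for l
  proof -
    have "norm (half_fourier f l) \<le> norm (half_fourier (s n) l) + dist (half_fourier (s n) l) (half_fourier f l)"
      using norm_triangle_ineq4[of "half_fourier (s n) l" "half_fourier (s n) l - half_fourier f l"]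
      by (simp add: dist_norm)
    then show ?thesis using n[OF that(1)] B[OF that] by linarith
  qed
  then show ?case by blast
qed

section \<open>Fourier uniqueness and holomorphic functions on the upper half-plane\<close>

text \<open>The positive and negative parts of \<open>g\<close> have equal transforms, in particular
  equal mass \<open>c\<close> (take l = 0). If \<open>c > 0\<close>, dividing by \<open>c\<close>
  gives probability densities with the same characteristic function, and Levy's uniqueness theorem
  applies.\<close>

lemma real_fourier_zero_imp_AE_zero:
  fixes g :: "real \<Rightarrow> real"
  assumes g: "integrable lborel g"
    and zero: "\<And>l::real. (\<integral>t. exp (\<i> * of_real (l * t)) * of_real (g t) \<partial>lborel) = 0"
  shows "AE t in lborel. g t = 0"
proof -
  define p where "p = (\<lambda>t. max (g t) 0)"
  define n where "n = (\<lambda>t. max (- g t) 0)"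
  have pi: "integrable lborel p" and ni: "integrable lborel n" unfolding p_def n_def using g by auto
  have pn: "g t = p t - n t" "p t \<ge> 0" "n t \<ge> 0" for t by (auto simp: p_def n_def)
  have expi: "integrable lborel (\<lambda>t. exp (\<i> * of_real (l * t)) * of_real (f t))"
    if "integrable lborel f" for f :: "real \<Rightarrow> real" and l :: real
    by (rule Bochner_Integration.integrable_bound[OF that]) (use that in \<open>auto simp: norm_mult\<close>)
  have eq: "(\<integral>t. exp (\<i> * of_real (l * t)) * of_real (p t) \<partial>lborel) = (\<integral>t. exp (\<i> * of_real (l * t)) * of_real (n t) \<partial>lborel)" for l
    using zero[of l] Bochner_Integration.integral_diff[OF expi[OF pi] expi[OF ni], of l l]
    by (simp add: pn(1) algebra_simps)
  define c where "c = (\<integral>t. p t \<partial>lborel)"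
  have cn: "c = (\<integral>t. n t \<partial>lborel)"
    using eq[of 0] by (simp add: c_def)
  have c0: "c \<ge> 0" unfolding c_def using pn(2) by (intro Bochner_Integration.integral_nonneg) auto
  have meas[measurable]: "p \<in> borel_measurable borel" "n \<in> borel_measurable borel" using pi ni by auto
  have "AE t in lborel. p t = n t"
  proof (cases "c = 0")
    case True
    have "AE t in lborel. p t = 0" "AE t in lborel. n t = 0"
      using integral_nonneg_eq_0_iff_AE[OF pi] integral_nonneg_eq_0_iff_AE[OF ni] True cn c_def pn by auto
    then show ?thesis by eventually_elim simp
  next
    case False
    then have cp: "c > 0" using c0 by simp
    have dist: "real_distribution (density lborel (\<lambda>t. ennreal (f t / c)))"
      if f: "integrable lborel f" "\<And>t. f t \<ge> 0" "(\<integral>t. f t \<partial>lborel) = c" for f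
    proof -
      have "emeasure (density lborel (\<lambda>t. ennreal (f t / c))) UNIV = (\<integral>\<^sup>+ t. ennreal (f t / c) \<partial>lborel)"
        using f(1) by (subst emeasure_density) auto
      also have "\<dots> = ennreal (\<integral>t. f t / c \<partial>lborel)"
        using f cp by (intro nn_integral_eq_integral) auto
      also have "\<dots> = 1" using f(3) cp by simp
      finally have "prob_space (density lborel (\<lambda>t. ennreal (f t / c)))"
        by (intro prob_spaceI) simp
      then show ?thesis unfolding real_distribution_def real_distribution_axioms_def by simp
    qed
    have char: "char (density lborel (\<lambda>t. ennreal (f t / c))) l = (\<integral>t. exp (\<i> * of_real (l * t)) * of_real (f t) \<partial>lborel) / c"
      if f: "integrable lborel f" "\<And>t. f t \<ge> 0" for f l
    proof -
      have "char (density lborel (\<lambda>t. ennreal (f t / c))) l = (\<integral>t. (f t / c) *\<^sub>R exp (\<i> * of_real (l * t)) \<partial>lborel)"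
        unfolding char_def using f cp by (subst integral_density) auto
      also have "\<dots> = (\<integral>t. (exp (\<i> * of_real (l * t)) * of_real (f t)) / c \<partial>lborel)"
        by (rule Bochner_Integration.integral_cong) (auto simp: scaleR_conv_of_real)
      finally show ?thesis by simp
    qed
    have "density lborel (\<lambda>t. ennreal (p t / c)) = density lborel (\<lambda>t. ennreal (n t / c))"
      using eq by (intro Levy_uniqueness dist pi ni pn cn[symmetric] c_def[symmetric]) (simp add: fun_eq_iff char pi ni pn)
    then have "AE t in lborel. ennreal (p t / c) = ennreal (n t / c)"
      by (subst (asm) sigma_finite_measure.density_unique_iff[OF sigma_finite_lborel]) auto
    then show ?thesis by eventually_elim (use cp pn(2,3) in auto)
  qed
  then show ?thesis by eventually_elim (simp add: pn)
qed

text \<open>The transform of the conjugate at l is the conjugate of the transform at -l, so it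
  vanishes as well; hence so do the transforms of the real and imaginary parts.\<close>

lemma fourier_zero_imp_AE_zero:
  fixes k :: "real \<Rightarrow> complex"
  assumes k: "integrable lborel k"
    and zero: "\<And>l::real. (\<integral>t. exp (\<i> * of_real (l * t)) * k t \<partial>lborel) = 0"
  shows "AE t in lborel. k t = 0"
proof -
  have expi: "integrable lborel (\<lambda>t. exp (\<i> * of_real (l * t)) * f t)"
    if "integrable lborel f" for f :: "real \<Rightarrow> complex" and l :: real
    by (rule Bochner_Integration.integrable_bound[OF that]) (use that in \<open>auto simp: norm_mult\<close>)
  have zero': "(\<integral>t. exp (\<i> * of_real (l * t)) * cnj (k t) \<partial>lborel) = 0" for l
  proof -
    have "(\<integral>t. exp (\<i> * of_real (l * t)) * cnj (k t) \<partial>lborel) = (\<integral>t. cnj (exp (\<i> * of_real (- l * t)) * k t) \<partial>lborel)"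
      by (simp add: exp_cnj)
    also have "\<dots> = cnj (\<integral>t. exp (\<i> * of_real (- l * t)) * k t \<partial>lborel)"
      by (rule Bochner_Integration.integral_cnj)
    also have "\<dots> = 0" using zero[of "- l"] by simp
    finally show ?thesis .
  qed
  have kc: "integrable lborel (\<lambda>t. cnj (k t))" using k by simp
  have "AE t in lborel. Re (k t) = 0"
  proof (rule real_fourier_zero_imp_AE_zero)
    show "(\<integral>t. exp (\<i> * of_real (l * t)) * of_real (Re (k t)) \<partial>lborel) = 0" for l
    proof -
      have "(\<integral>t. exp (\<i> * of_real (l * t)) * of_real (Re (k t)) \<partial>lborel)
          = (\<integral>t. (exp (\<i> * of_real (l * t)) * k t + exp (\<i> * of_real (l * t)) * cnj (k t)) / 2 \<partial>lborel)"
        by (rule Bochner_Integration.integral_cong) (auto simp: complex_eq_iff)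
      also have "\<dots> = 0"
        using zero[of l] zero'[of l] Bochner_Integration.integral_add[OF expi[OF k] expi[OF kc], of l l] by simp
      finally show ?thesis .
    qed
  qed (use k in simp)
  moreover have "AE t in lborel. Im (k t) = 0"
  proof (rule real_fourier_zero_imp_AE_zero)
    show "(\<integral>t. exp (\<i> * of_real (l * t)) * of_real (Im (k t)) \<partial>lborel) = 0" for l
    proof -
      have "(\<integral>t. exp (\<i> * of_real (l * t)) * of_real (Im (k t)) \<partial>lborel)
          = (\<integral>t. (exp (\<i> * of_real (l * t)) * k t - exp (\<i> * of_real (l * t)) * cnj (k t)) / (2 * \<i>) \<partial>lborel)"
        by (rule Bochner_Integration.integral_cong) (auto simp: complex_eq_iff Re_divide Im_divide power2_eq_square)
      also have "\<dots> = 0"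
        using zero[of l] zero'[of l] Bochner_Integration.integral_diff[OF expi[OF k] expi[OF kc], of l l] by simp
      finally show ?thesis .
    qed
  qed (use k in simp)
  ultimately show ?thesis by eventually_elim (simp add: complex_eq_iff)
qed

lemma half_fourier_zero_imp_AE_zero:
  assumes k: "integrable lborel k" and zero: "\<And>l::real. half_fourier k (of_real l) = 0"
  shows "AE t in lborel. t \<ge> 0 \<longrightarrow> k t = 0"
proof -
  have "AE t in lborel. indicator {0..} t *\<^sub>R k t = 0"
  proof (rule fourier_zero_imp_AE_zero)
    show "integrable lborel (\<lambda>t. indicator {0..} t *\<^sub>R k t)"
      using k by (intro integrable_mult_indicator) auto
    show "(\<integral>t. exp (\<i> * of_real (l * t)) * (indicator {0..} t *\<^sub>R k t) \<partial>lborel) = 0" for l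
      using zero[of l] unfolding half_fourier_def set_lebesgue_integral_def
      by (simp add: algebra_simps)
  qed
  then show ?thesis by eventually_elim (auto simp: indicator_def)
qed

section \<open>Gluing, uniqueness and the maximum principle on the half-plane\<close>

lemma half_plane_paste:
  assumes f: "f holomorphic_on {l. Im l > 0}" "continuous_on {l. Im l \<ge> 0} f"
    and g: "g holomorphic_on {l. Im l < 0}" "continuous_on {l. Im l \<le> 0} g"
    and eq: "\<And>x::real. f (of_real x) = g (of_real x)"
  shows "(\<lambda>l. if Im l > 0 then f l else g l) holomorphic_on UNIV"
proof (rule holomorphic_on_paste_across_line[where d = \<i> and k = 0])
  show "(\<lambda>l. if 0 < Im l then f l else g l) holomorphic_on UNIV \<inter> {z. \<i> \<bullet> z < 0}"
    using g(1) by (rule holomorphic_transform[OF holomorphic_on_subset]) (auto simp: inner_complex_def)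
  show "(\<lambda>l. if 0 < Im l then f l else g l) holomorphic_on UNIV \<inter> {z. 0 < \<i> \<bullet> z}"
    using f(1) by (rule holomorphic_transform[OF holomorphic_on_subset]) (auto simp: inner_complex_def)
  have feq: "f l = g l" if "Im l = 0" for l
    using eq[of "Re l"] that by (metis complex_eq_iff Re_complex_of_real Im_complex_of_real)
  have U: "UNIV = {l. Im l \<ge> 0} \<union> {l. Im l \<le> 0}" by auto
  have *: "(\<lambda>l. if 0 < Im l then f l else g l) = (\<lambda>l. if Im l \<ge> 0 then f l else g l)"
    by (auto simp: fun_eq_iff feq)
  show "continuous_on UNIV (\<lambda>l. if 0 < Im l then f l else g l)"
    unfolding * U
    by (rule continuous_on_cases) (use f(2) g(2) feq in \<open>auto simp: closed_halfspace_Im_ge closed_halfspace_Im_le\<close>)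
qed auto

text \<open>Extended by 0 to the lower half-plane, \<open>f\<close> becomes entire and vanishes on a
  nonempty open set.\<close>

lemma half_plane_eq_zero:
  assumes f: "f holomorphic_on {l. Im l > 0}" "continuous_on {l. Im l \<ge> 0} f"
    and zero: "\<And>x::real. f (of_real x) = 0" and l: "Im l \<ge> 0"
  shows "f l = 0"
proof (cases "Im l > 0")
  case True
  have "(\<lambda>l. if Im l > 0 then f l else 0) holomorphic_on UNIV"
    by (rule half_plane_paste) (use assms in auto)
  from analytic_continuation_open[OF open_halfspace_Im_lt[of 0] open_UNIV _ connected_UNIV _ this, of "\<lambda>_. 0" l]
  show ?thesis using True by (force dest: spec[of "\<lambda>x. \<not> Im x < 0" "- \<i>"])
next
  case False
  then have "l = of_real (Re l)" using l by (simp add: complex_eq_iff)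
  then show ?thesis using zero by metis
qed

lemma half_plane_eq:
  assumes f: "f holomorphic_on {l. Im l > 0}" "continuous_on {l. Im l \<ge> 0} f"
    and g: "g holomorphic_on {l. Im l > 0}" "continuous_on {l. Im l \<ge> 0} g"
    and eq: "\<And>x::real. f (of_real x) = g (of_real x)" and l: "Im l \<ge> 0"
  shows "f l = g l"
  using half_plane_eq_zero[of "\<lambda>l. f l - g l" l] assms by (auto intro!: holomorphic_intros continuous_intros)

text \<open>A Phragmen-Lindelof argument. The divisor \<open>1 - \<i> * of_real e * w\<close> has
  modulus at least 1 and at least \<open>e * norm w\<close> on the half-plane, so the quotient is
  small on large arcs and the principle for bounded half-discs applies. Then e tends to 0.\<close>

lemma half_plane_maximum_modulus:
  assumes f: "f holomorphic_on {l. Im l > 0}" "continuous_on {l. Im l \<ge> 0} f"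
    and bdd: "\<And>l. Im l \<ge> 0 \<Longrightarrow> norm (f l) \<le> C"
    and le: "\<And>x::real. norm (f (of_real x)) \<le> M" and l: "Im l \<ge> 0"
  shows "norm (f l) \<le> M"
proof -
  have C0: "C \<ge> 0" using order_trans[OF norm_ge_zero bdd[of 0]] by simp
  have M0: "M \<ge> 0" using order_trans[OF norm_ge_zero le[of 0]] by simp
  have main: "norm (f l) \<le> (M + e) * norm (1 - \<i> * of_real e * l)" if e: "e > 0" for e :: real
  proof -
    define d where "d = (\<lambda>w. 1 - \<i> * of_real e * w)"
    have Re_d: "Re (d w) = 1 + e * Im w" for w by (simp add: d_def)
    have d1: "norm (d w) \<ge> 1" if "Im w \<ge> 0" for w
      using complex_Re_le_cmod[of "d w"] that e by (auto simp: Re_d intro: order_trans[rotated])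
    have d2: "norm (d w) \<ge> e * norm w" if "Im w \<ge> 0" for w
    proof -
      have "(e * norm w)\<^sup>2 \<le> (1 + e * Im w)\<^sup>2 + (e * Re w)\<^sup>2"
        using that e by (simp add: power_mult_distrib cmod_power2 power2_sum algebra_simps)
      also have "\<dots> = (norm (d w))\<^sup>2"
        by (simp add: cmod_power2 d_def)
      finally show ?thesis by (rule power2_le_imp_le) simp
    qed
    have dnz: "d w \<noteq> 0" if "Im w \<ge> 0" for w using d1[OF that] by auto
    \<comment> \<open>On the arc of radius \<open>R\<close> the quotient is at most
      \<open>C / (e * R)\<close>, and this \<open>R\<close> brings that below \<open>M + e\<close>.
      Adding \<open>e\<close> keeps the denominator positive when \<open>M = 0\<close>.\<close>
    define R where "R = norm l + 1 + C / (e * (M + e))"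
    define S where "S = cball 0 R \<inter> {w. Im w \<ge> 0}"
    have "C / (e * (M + e)) \<ge> 0" using C0 M0 e by simp
    then have Rp: "R > 0" and lR: "norm l \<le> R" unfolding R_def using norm_ge_zero[of l] by linarith+
    have clS: "closed S" unfolding S_def by (intro closed_Int closed_halfspace_Im_ge) auto
    have "norm (f l / d l) \<le> M + e"
    proof (rule maximum_modulus_frontier[where S = S and f = "\<lambda>w. f w / d w"])
      have "interior S \<subseteq> interior {w. Im w \<ge> 0}" unfolding S_def by (intro interior_mono) auto
      also have "\<dots> = {w. Im w > 0}" using interior_halfspace_ge[of \<i> 0] by (simp add: inner_complex_def)
      finally have "interior S \<subseteq> {w. Im w > 0}" .
      then show "(\<lambda>w. f w / d w) holomorphic_on interior S"
        using dnz by (intro holomorphic_on_divide holomorphic_on_subset[OF f(1)]) (auto simp: d_def intro!: holomorphic_intros)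
      show "continuous_on (closure S) (\<lambda>w. f w / d w)"
        unfolding closure_closed[OF clS]
        using dnz by (intro continuous_intros continuous_on_subset[OF f(2)]) (auto simp: d_def S_def intro!: continuous_intros)
      show "bounded S" unfolding S_def by (intro bounded_Int disjI1 bounded_cball)
      show "l \<in> S" unfolding S_def using l lR by simp
      fix w assume w: "w \<in> frontier S"
      then have wS: "w \<in> S" using clS frontier_subset_closed by blast
      have "Im w = 0 \<or> norm w = R"
      proof (rule ccontr)
        assume "\<not> ?thesis"
        then have "w \<in> ball 0 R \<inter> {w. Im w > 0}" using wS by (auto simp: S_def)
        moreover have "ball 0 R \<inter> {w. Im w > 0} \<subseteq> interior S"
          by (rule interior_maximal) (auto simp: S_def open_halfspace_Im_gt)
        ultimately show False using w by (auto simp: frontier_def)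
      qed
      then show "norm (f w / d w) \<le> M + e"
      proof
        assume "Im w = 0"
        then have "of_real (Re w) = w" by (simp add: complex_eq_iff)
        then have "norm (f w) \<le> M" using le[of "Re w"] by simp
        moreover have "norm (f w / d w) \<le> norm (f w)"
          using d1[of w] dnz[of w] wS by (auto simp: S_def norm_divide divide_le_eq mult_le_cancel_left1)
        ultimately show ?thesis using e by simp
      next
        assume wR: "norm w = R"
        have "norm (f w / d w) \<le> C / (e * R)"
          unfolding norm_divide using bdd[of w] d2[of w] wS wR e Rp C0
          by (intro frac_le) (auto simp: S_def)
        also have "\<dots> \<le> M + e"
        proof -
          have "C / (e * (M + e)) \<le> R" unfolding R_def by simp
          moreover have "e * (M + e) > 0" using e M0 by simp
          ultimately have "C \<le> R * (e * (M + e))" by (simp only: pos_divide_le_eq)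
          then show ?thesis using e Rp by (simp add: pos_divide_le_eq ac_simps)
        qed
        finally show ?thesis .
      qed
    qed
    then show ?thesis using dnz[OF l] by (simp add: norm_divide divide_le_eq d_def)
  qed
  have "((\<lambda>e. (M + e) * norm (1 - \<i> * of_real e * l)) \<longlongrightarrow> (M + 0) * norm (1 - \<i> * of_real 0 * l)) (at_right 0)"
    by (intro tendsto_intros)
  moreover have "\<forall>\<^sub>F e in at_right 0. norm (f l) \<le> (M + e) * norm (1 - \<i> * of_real e * l)"
    using main by (auto simp: eventually_at_filter intro!: always_eventually)
  ultimately have "norm (f l) \<le> (M + 0) * norm (1 - \<i> * of_real 0 * l)"
    by (intro tendsto_lowerbound) auto
  then show ?thesis by simp
qed

text \<open>The singularities are removed one at a time. An extension across p agrees with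
  \<open>f\<close> near every other point of \<open>Z\<close>, so the limit conditions there
  survive.\<close>

lemma holomorphic_on_extend_finite:
  assumes "finite Z" "open S" "Z \<subseteq> S" "f holomorphic_on (S - Z)"
    and "\<And>p. p \<in> Z \<Longrightarrow> ((\<lambda>z. (z - p) * f z) \<longlongrightarrow> 0) (at p)"
  shows "\<exists>g. g holomorphic_on S \<and> (\<forall>z\<in>S - Z. g z = f z)"
  using assms
proof (induction Z arbitrary: f rule: finite_induct)
  case (insert p Z)
  have op: "open (S - Z)" using insert.prems(1) insert.hyps(1) by (intro open_Diff finite_imp_closed) auto
  have "f holomorphic_on (S - Z) - {p}" using insert.prems(3) by (subst (asm) Diff_insert)
  moreover have "p \<in> interior (S - Z)" using op insert.prems(2) insert.hyps(2) by (simp add: interior_open)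
  ultimately obtain g where g: "g holomorphic_on S - Z" "\<forall>z\<in>S - Z - {p}. g z = f z"
    using holomorphic_on_extend_lim[of f "S - Z" p] insert.prems(4)[of p] by auto
  have "((\<lambda>z. (z - q) * g z) \<longlongrightarrow> 0) (at q)" if q: "q \<in> Z" for q
  proof (rule Lim_transform_eventually)
    show "((\<lambda>z. (z - q) * f z) \<longlongrightarrow> 0) (at q)" using insert.prems(4)[of q] q by auto
    have "open (S - (insert p Z - {q}))" using insert.prems(1) insert.hyps(1) by (intro open_Diff finite_imp_closed) auto
    moreover have "q \<in> S - (insert p Z - {q})" using q insert.prems(2) by auto
    ultimately have "\<forall>\<^sub>F z in at q. z \<in> S - (insert p Z - {q}) - {q}"
      by (rule eventually_at_in_open)
    then show "\<forall>\<^sub>F z in at q. (z - q) * f z = (z - q) * g z"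
      by eventually_elim (use g(2) q in auto)
  qed
  then obtain h where "h holomorphic_on S" "\<forall>z\<in>S - Z. h z = g z"
    using insert.IH[OF insert.prems(1) _ g(1)] insert.prems(2) by auto
  then show ?case using g(2) by (intro exI[of _ h]) auto
qed auto

section \<open>The scalar Marchenko equation\<close>

lemma integrable_exp_mult:
  assumes "integrable lborel f"
  shows "integrable lborel (\<lambda>t. exp (- \<i> * of_real (l * t)) * (f t :: complex))"
  by (rule Bochner_Integration.integrable_bound[OF assms]) (use assms in \<open>auto simp: norm_mult\<close>)

text \<open>By translation invariance the inner integral of the modulus is \<open>norm (k s)\<close>
  times the integral of \<open>norm (r t)\<close>.\<close>

lemma correlation_integrable_pair:
  fixes k r :: "real \<Rightarrow> complex"
  assumes k: "integrable lborel k" and r: "integrable lborel r"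
  shows "integrable (lborel \<Otimes>\<^sub>M lborel) (\<lambda>(s, t). indicator {0..} s *\<^sub>R (k s * r (s + t)))"
proof -
  have [measurable]: "k \<in> borel_measurable borel" "r \<in> borel_measurable borel"
    using k r by auto
  have ri: "integrable lborel (\<lambda>t. r (s + t))" for s
    using lborel_integrable_real_affine[OF r, of 1 s] by simp
  show ?thesis
  proof (rule lborel_pair.Fubini_integrable)
    show "(\<lambda>(s, t). indicator {0..} s *\<^sub>R (k s * r (s + t))) \<in> borel_measurable (lborel \<Otimes>\<^sub>M lborel)"
      by measurable
    have "(\<integral>t. norm (r (s + t)) \<partial>lborel) = (\<integral>t. norm (r t) \<partial>lborel)" for s
      using lborel_integral_real_affine[of 1 "\<lambda>t. norm (r t)" s] by simp
    then have "(\<lambda>s. \<integral>t. norm (case (s, t) of (s, t) \<Rightarrow> indicator {0..} s *\<^sub>R (k s * r (s + t))) \<partial>lborel)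
        = (\<lambda>s. indicator {0..} s *\<^sub>R (norm (k s) * (\<integral>t. norm (r t) \<partial>lborel)))"
      by (auto simp: norm_mult fun_eq_iff)
    moreover have "integrable lborel (\<lambda>s. indicator {0..} s *\<^sub>R (norm (k s) * (\<integral>t. norm (r t) \<partial>lborel)))"
      using k by (intro integrable_mult_indicator integrable_mult_left integrable_norm) auto
    ultimately show "integrable lborel (\<lambda>s. \<integral>t. norm (case (s, t) of (s, t) \<Rightarrow> indicator {0..} s *\<^sub>R (k s * r (s + t))) \<partial>lborel)" by simp
    show "AE s in lborel. integrable lborel (\<lambda>t. case (s, t) of (s, t) \<Rightarrow> indicator {0..} s *\<^sub>R (k s * r (s + t)))"
      using ri by (intro AE_I2) simp
  qed
qed

text \<open>With y = z + t and u = z + s this is the part of the Marchenko integral that comes from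
  \<open>rho\<close>. For integrable functions its convergence is guaranteed only for almost every
  \<open>t\<close>.\<close>

definition correlation :: "(real \<Rightarrow> complex) \<Rightarrow> (real \<Rightarrow> complex) \<Rightarrow> real \<Rightarrow> complex" where
  "correlation k r t = (LINT s:{0..}|lborel. k s * r (s + t))"

lemma correlation_AE_integrable:
  fixes k r :: "real \<Rightarrow> complex"
  assumes "integrable lborel k" "integrable lborel r"
  shows "AE t in lborel. set_integrable lborel {0..} (\<lambda>s. k s * r (s + t))"
  using lborel_pair.AE_integrable_snd[OF correlation_integrable_pair[OF assms]]
  by (simp add: set_integrable_def)

lemma correlation_integrable:
  assumes "integrable lborel k" "integrable lborel r"
  shows "integrable lborel (correlation k r)"
  using lborel_pair.integrable_snd[OF correlation_integrable_pair[OF assms]]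
  by (simp add: correlation_def[abs_def] set_lebesgue_integral_def)

text \<open>Splitting exp(-i l t) into exp(i l s) and exp(-i l (s + t)) separates the variables.
  This is why the two factors carry opposite signs in the exponent.\<close>

lemma fourier_correlation:
  fixes l :: real
  assumes k: "integrable lborel k" and r: "integrable lborel r"
  shows "(\<integral>t. exp (- \<i> * of_real (l * t)) * correlation k r t \<partial>lborel)
    = half_fourier k (of_real l) * (\<integral>t. exp (- \<i> * of_real (l * t)) * r t \<partial>lborel)"
proof -
  define F where "F = (\<lambda>(s, t). exp (- \<i> * of_real (l * t)) * (indicator {0..} s *\<^sub>R (k s * r (s + t))))"
  have F: "integrable (lborel \<Otimes>\<^sub>M lborel) F"
  proof (rule Bochner_Integration.integrable_bound[OF correlation_integrable_pair[OF k r]])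
    have [measurable]: "k \<in> borel_measurable borel" "r \<in> borel_measurable borel" using k r by auto
    show "F \<in> borel_measurable (lborel \<Otimes>\<^sub>M lborel)" unfolding F_def by measurable
  qed (auto simp: F_def norm_mult)
  have "(\<integral>t. exp (- \<i> * of_real (l * t)) * correlation k r t \<partial>lborel) = (\<integral>t. (\<integral>s. F (s, t) \<partial>lborel) \<partial>lborel)"
    by (simp only: F_def correlation_def set_lebesgue_integral_def prod.case integral_mult_right_zero)
  also have "\<dots> = (\<integral>s. (\<integral>t. F (s, t) \<partial>lborel) \<partial>lborel)"
    using lborel_pair.Fubini_integral[of "\<lambda>s t. F (s, t)"] F by simp
  also have "\<dots> = (\<integral>s. indicator {0..} s *\<^sub>R (exp (\<i> * of_real l * of_real s) * k s) * (\<integral>t. exp (- \<i> * of_real (l * t)) * r t \<partial>lborel) \<partial>lborel)"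
  proof (rule Bochner_Integration.integral_cong[OF refl])
    fix s :: real
    have "(\<integral>t. exp (- \<i> * of_real (l * t)) * r t \<partial>lborel) = (\<integral>t. exp (- \<i> * of_real (l * (s + t))) * r (s + t) \<partial>lborel)"
      using lborel_integral_real_affine[of 1 "\<lambda>t. exp (- \<i> * of_real (l * t)) * r t" s] by simp
    then have "indicator {0..} s *\<^sub>R (exp (\<i> * of_real l * of_real s) * k s) * (\<integral>t. exp (- \<i> * of_real (l * t)) * r t \<partial>lborel)
        = (\<integral>t. indicator {0..} s *\<^sub>R (exp (\<i> * of_real l * of_real s) * k s) * (exp (- \<i> * of_real (l * (s + t))) * r (s + t)) \<partial>lborel)"
      by (simp only: integral_mult_right_zero)
    also have "\<dots> = (\<integral>t. F (s, t) \<partial>lborel)"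
    proof (rule Bochner_Integration.integral_cong[OF refl])
      fix t
      have "exp (\<i> * of_real l * of_real s) * exp (- \<i> * of_real (l * (s + t))) = exp (- \<i> * of_real (l * t))"
        unfolding exp_add[symmetric] by (simp add: algebra_simps)
      then have "exp (\<i> * of_real l * of_real s) * (exp (- \<i> * of_real (l * (s + t))) * x) = exp (- \<i> * of_real (l * t)) * x" for x
        by (simp only: mult.assoc[symmetric])
      then show "indicator {0..} s *\<^sub>R (exp (\<i> * of_real l * of_real s) * k s) * (exp (- \<i> * of_real (l * (s + t))) * r (s + t)) = F (s, t)"
        unfolding F_def by (simp add: mult.left_commute[of "k s"] mult.assoc del: of_real_mult of_real_add)
    qed
    finally show "(\<integral>t. F (s, t) \<partial>lborel) = indicator {0..} s *\<^sub>R (exp (\<i> * of_real l * of_real s) * k s) * (\<integral>t. exp (- \<i> * of_real (l * t)) * r t \<partial>lborel)" ..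
  qed
  also have "\<dots> = half_fourier k (of_real l) * (\<integral>t. exp (- \<i> * of_real (l * t)) * r t \<partial>lborel)"
    by (simp only: half_fourier_def set_lebesgue_integral_def integral_mult_left_zero)
  finally show ?thesis .
qed

lemma half_fourier_eq_integral:
  "half_fourier (\<lambda>t. indicator {0..} t *\<^sub>R f t) l = half_fourier f l"
  unfolding half_fourier_def set_lebesgue_integral_def
  by (rule Bochner_Integration.integral_cong) (auto simp: indicator_def)

text \<open>The first summand continues to the lower half-plane, the second to the upper
  one.\<close>

lemma fourier_split_half_fourier:
  fixes l :: real
  assumes f: "integrable lborel f"
  shows "(\<integral>t. exp (- \<i> * of_real (l * t)) * f t \<partial>lborel)
    = half_fourier f (- of_real l) + half_fourier (\<lambda>t. f (- t)) (of_real l)"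
proof -
  define g where "g = (\<lambda>t. exp (- \<i> * of_real (l * t)) * f t)"
  have g: "integrable lborel g" unfolding g_def by (rule integrable_exp_mult[OF f])
  have ind: "integrable lborel (\<lambda>t. indicator {0..} t *\<^sub>R g t)" "integrable lborel (\<lambda>t. indicator {..0} t *\<^sub>R g t)"
    using g by (auto intro!: integrable_mult_indicator)
  have "(\<integral>t. g t \<partial>lborel) = (\<integral>t. indicator {0..} t *\<^sub>R g t + indicator {..0} t *\<^sub>R g t \<partial>lborel)"
  proof (rule integral_cong_AE)
    have "AE t in lborel. t \<noteq> (0::real)" by (rule AE_lborel_singleton)
    then show "AE t in lborel. g t = indicator {0..} t *\<^sub>R g t + indicator {..0} t *\<^sub>R g t"
      by eventually_elim (auto simp: indicator_def)
  qed (use g in auto)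
  also have "\<dots> = (\<integral>t. indicator {0..} t *\<^sub>R g t \<partial>lborel) + (\<integral>t. indicator {..0} t *\<^sub>R g t \<partial>lborel)"
    by (rule Bochner_Integration.integral_add[OF ind])
  also have "(\<integral>t. indicator {..0} t *\<^sub>R g t \<partial>lborel) = (\<integral>t. indicator {..0} (- t) *\<^sub>R g (- t) \<partial>lborel)"
    using lborel_integral_real_affine[of "-1" "\<lambda>t. indicator {..0} t *\<^sub>R g t" 0] by simp
  also have "\<dots> = half_fourier (\<lambda>t. f (- t)) (of_real l)"
    unfolding half_fourier_def set_lebesgue_integral_def g_def
    by (rule Bochner_Integration.integral_cong) (auto simp: indicator_def mult.assoc)
  also have "(\<integral>t. indicator {0..} t *\<^sub>R g t \<partial>lborel) = half_fourier f (- of_real l)"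
    unfolding half_fourier_def set_lebesgue_integral_def g_def
    by (rule Bochner_Integration.integral_cong) (auto simp: indicator_def mult.assoc)
  finally show ?thesis unfolding g_def .
qed

lemma decaying_exp_integrable:
  assumes "Im p > 0"
  shows "integrable lborel (\<lambda>t::real. indicator {0..} t *\<^sub>R exp (\<i> * p * of_real t))"
proof -
  have "set_integrable lborel {0<..} (\<lambda>t. exp (- (t * Im p)))"
    by (rule integrable_I0i_exp_mscale[OF assms])
  moreover have "AE t in lborel. indicator {0<..} t *\<^sub>R exp (- (t * Im p)) = indicator {0..} t *\<^sub>R exp (- (t * Im p))"
    using AE_lborel_singleton[of "0::real"] by eventually_elim (auto simp: indicator_def)
  ultimately have "integrable lborel (\<lambda>t::real. indicator {0..} t *\<^sub>R exp (- (t * Im p)))"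
    unfolding set_integrable_def by (subst (asm) integrable_cong_AE) auto
  then show ?thesis
    by (rule Bochner_Integration.integrable_bound) (auto simp: indicator_def norm_exp_eq_Re mult.commute)
qed

text \<open>Read at \<open>- l\<close>, the value is -i / (l - p). A simple pole in the upper
  half-plane is thus the transform of an exponential supported on t \<ge> 0, and this is how the
  discrete sum enters the Marchenko kernel.\<close>

lemma half_fourier_decaying_exp:
  assumes p: "Im p > 0" and l: "Im l \<ge> 0"
  shows "half_fourier (\<lambda>t. indicator {0..} t *\<^sub>R exp (\<i> * p * of_real t)) l = \<i> / (p + l)"
proof -
  define q where "q = p + l"
  have q: "Im q > 0" using assms by (simp add: q_def)
  then have q0: "q \<noteq> 0" by auto
  have eq: "half_fourier (\<lambda>t. indicator {0..} t *\<^sub>R exp (\<i> * p * of_real t)) l = (\<integral>t. indicator {0..} t *\<^sub>R exp (\<i> * q * of_real t) \<partial>lborel)"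
    unfolding half_fourier_eq_integral half_fourier_def set_lebesgue_integral_def
    by (simp add: exp_add[symmetric] q_def algebra_simps)
  have "(\<lambda>n. \<integral>t. indicator {0..} t *\<^sub>R (exp (\<i> * q * of_real t) * indicator {0..real n} t) \<partial>lborel)
      \<longlonglongrightarrow> (\<integral>t. indicator {0..} t *\<^sub>R exp (\<i> * q * of_real t) \<partial>lborel)"
  proof (rule integral_dominated_convergence[where w = "\<lambda>t. norm (indicator {0..} t *\<^sub>R exp (\<i> * q * of_real t))"])
    show "integrable lborel (\<lambda>t. norm (indicator {0..} t *\<^sub>R exp (\<i> * q * of_real t)))"
      by (intro integrable_norm decaying_exp_integrable q)
    show "AE t in lborel. (\<lambda>n. indicator {0..} t *\<^sub>R (exp (\<i> * q * of_real t) * indicator {0..real n} t)) \<longlonglongrightarrow> indicator {0..} t *\<^sub>R exp (\<i> * q * of_real t)"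
    proof (rule AE_I2, rule tendsto_eventually)
      fix t :: real
      obtain N :: nat where "t \<le> real N" using real_arch_simple by blast
      then show "\<forall>\<^sub>F n in sequentially. indicator {0..} t *\<^sub>R (exp (\<i> * q * of_real t) * indicator {0..real n} t) = indicator {0..} t *\<^sub>R exp (\<i> * q * of_real t)"
        unfolding eventually_sequentially by (intro exI[of _ N]) (auto simp: indicator_def)
    qed
  qed (auto simp: indicator_def)
  moreover have "(\<integral>t. indicator {0..} t *\<^sub>R (exp (\<i> * q * of_real t) * indicator {0..real n} t) \<partial>lborel) = (exp (\<i> * q * of_real (real n)) - 1) / (\<i> * q)" for n
    using half_fourier_interval[OF q0, of 0 "real n"] unfolding half_fourier_def set_lebesgue_integral_def by simp
  moreover have "(\<lambda>n. (exp (\<i> * q * of_real (real n)) - 1) / (\<i> * q)) \<longlonglongrightarrow> (0 - 1) / (\<i> * q)"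
  proof (intro tendsto_intros)
    have "(\<lambda>n. exp (- Im q * real n)) \<longlonglongrightarrow> 0" using q by real_asymp
    then show "(\<lambda>n. exp (\<i> * q * of_real (real n))) \<longlonglongrightarrow> 0"
      by (subst tendsto_norm_zero_iff[symmetric]) (simp add: norm_exp_eq_Re)
  qed (use q0 in auto)
  ultimately have "(\<integral>t. indicator {0..} t *\<^sub>R exp (\<i> * q * of_real t) \<partial>lborel) = (0 - 1) / (\<i> * q)"
    using LIMSEQ_unique by auto
  also have "\<dots> = \<i> / q" using q0 by (simp add: field_simps)
  finally show ?thesis by (simp add: eq q_def)
qed

text \<open>At a simple zero p of \<open>a\<close> the residue of the quotient is
  \<open>n p / deriv a p\<close>, so only removable singularities are left.\<close>

lemma holomorphic_quotient_minus_simple_poles: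
  assumes n: "n holomorphic_on S" and a: "a holomorphic_on S" and S: "open S"
    and Z: "finite Z" "Z = {l\<in>S. a l = 0}" and simple: "\<And>p. p \<in> Z \<Longrightarrow> deriv a p \<noteq> 0"
  obtains g where "g holomorphic_on S"
    "\<And>l. l \<in> S - Z \<Longrightarrow> g l = n l / a l - (\<Sum>p\<in>Z. (n p / deriv a p) / (l - p))"
proof -
  define f where "f = (\<lambda>l. n l / a l - (\<Sum>p\<in>Z. (n p / deriv a p) / (l - p)))"
  have ZS: "Z \<subseteq> S" using Z by auto
  have "\<exists>g. g holomorphic_on S \<and> (\<forall>z\<in>S - Z. g z = f z)"
  proof (rule holomorphic_on_extend_finite[OF Z(1) S ZS])
    show "f holomorphic_on S - Z" unfolding f_def
      using Z by (intro holomorphic_intros holomorphic_on_subset[OF n] holomorphic_on_subset[OF a]) auto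
    fix p assume p: "p \<in> Z"
    have pS: "p \<in> S" and ap: "a p = 0" using p Z by auto
    have der: "((\<lambda>z. a z / (z - p)) \<longlongrightarrow> deriv a p) (at p)"
      using holomorphic_derivI[OF a S pS] by (simp add: has_field_derivative_iff ap)
    have nl: "(n \<longlongrightarrow> n p) (at p)"
      using holomorphic_on_imp_continuous_on[OF n] S pS by (simp add: continuous_on_eq_continuous_at isCont_def)
    \<comment> \<open>For \<open>q = p\<close> the factor \<open>(z - p) / (z - q)\<close> is 1 near
      p but takes the default value 0 at p itself. The conditional replaces this term by its
      constant value, so that every term converges to its value at p.\<close>
    have "((\<lambda>z. n z / (a z / (z - p)) - (\<Sum>q\<in>Z. if q = p then n p / deriv a p else (z - p) * ((n q / deriv a q) / (z - q))))
       \<longlongrightarrow> n p / deriv a p - (\<Sum>q\<in>Z. if q = p then n p / deriv a p else (p - p) * ((n q / deriv a q) / (p - q)))) (at p)"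
    proof (intro tendsto_diff tendsto_divide nl der simple p tendsto_sum)
      fix q assume "q \<in> Z"
      show "((\<lambda>z. if q = p then n p / deriv a p else (z - p) * (n q / deriv a q / (z - q))) \<longlongrightarrow>
          (if q = p then n p / deriv a p else (p - p) * (n q / deriv a q / (p - q)))) (at p)"
        using simple[OF \<open>q \<in> Z\<close>] by (cases "q = p") (auto intro!: tendsto_eq_intros)
    qed
    moreover have "(\<Sum>q\<in>Z. if q = p then n p / deriv a p else (p - p) * ((n q / deriv a q) / (p - q))) = (\<Sum>q\<in>Z. if q = p then n p / deriv a p else 0)"
      by (intro sum.cong) auto
    moreover have "\<dots> = n p / deriv a p" using p Z(1) by simp
    ultimately have "((\<lambda>z. n z / (a z / (z - p)) - (\<Sum>q\<in>Z. if q = p then n p / deriv a p else (z - p) * ((n q / deriv a q) / (z - q)))) \<longlongrightarrow> 0) (at p)"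
      by (simp only: diff_self)
    moreover have "\<forall>\<^sub>F z in at p. n z / (a z / (z - p)) - (\<Sum>q\<in>Z. if q = p then n p / deriv a p else (z - p) * ((n q / deriv a q) / (z - q))) = (z - p) * f z"
    proof -
      have "\<forall>\<^sub>F z in at p. z \<noteq> p" by (simp add: eventually_at_filter)
      then show ?thesis
      proof eventually_elim
        case (elim z)
        have "(\<Sum>q\<in>Z. if q = p then n p / deriv a p else (z - p) * ((n q / deriv a q) / (z - q))) = (\<Sum>q\<in>Z. (z - p) * ((n q / deriv a q) / (z - q)))"
          using elim by (intro sum.cong) auto
        then show ?case by (simp only: f_def right_diff_distrib[of "z - p" "n z / a z"] sum_distrib_left) (simp add: mult.commute)
      qed
    qed
    ultimately show "((\<lambda>z. (z - p) * f z) \<longlongrightarrow> 0) (at p)"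
      by (rule Lim_transform_eventually)
  qed
  then show ?thesis using that unfolding f_def by blast
qed

text \<open>One row of the second column of the equation, in the variable t = y - z. Here
  \<open>n\<close> is an entry of exp(i l z) \<phi>, and \<open>H1 + half_fourier k1\<close> is the
  same entry of exp(-i l z) \<psi>. The hypothesis \<open>real\<close> is the scattering relation
  divided by \<open>a\<close>, and \<open>res\<close> is the norming relation at the poles.\<close>

lemma marchenko_scalar:
  fixes k1 k2 r :: "real \<Rightarrow> complex" and n a c :: "complex \<Rightarrow> complex" and H1 H2 :: complex
  assumes k1: "integrable lborel k1" and k2: "integrable lborel k2" and r: "integrable lborel r"
    and n: "n holomorphic_on {l. Im l > 0}" "continuous_on {l. Im l \<ge> 0} n"
    and a: "a holomorphic_on {l. Im l > 0}" "continuous_on {l. Im l \<ge> 0} a"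
    and n_bdd: "\<And>l. Im l \<ge> 0 \<Longrightarrow> norm (n l) \<le> C"
    and a_low: "d > 0" "\<And>l. Im l \<ge> 0 \<Longrightarrow> norm l \<ge> B \<Longrightarrow> norm (a l) \<ge> d"
    and a_real: "\<And>x::real. a (of_real x) \<noteq> 0"
    and Z: "finite Z" "Z = {l. Im l > 0 \<and> a l = 0}" and simple: "\<And>p. p \<in> Z \<Longrightarrow> deriv a p \<noteq> 0"
    and res: "\<And>p. p \<in> Z \<Longrightarrow> n p / deriv a p = \<i> * c p * (H1 + half_fourier k1 p)"
    and real: "\<And>x::real. n (of_real x) / a (of_real x) = H2 + half_fourier k2 (- of_real x)
        + (\<integral>w. exp (- \<i> * of_real (x * w)) * r w \<partial>lborel) * (H1 + half_fourier k1 (of_real x))"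
  shows "AE t in lborel. t \<ge> 0 \<longrightarrow>
     k2 t + H1 * (r t + (\<Sum>p\<in>Z. c p * exp (\<i> * p * of_real t)))
     + (LINT s:{0..}|lborel. k1 s * (r (s + t) + (\<Sum>p\<in>Z. c p * exp (\<i> * p * of_real (s + t))))) = 0"
proof -
  \<comment> \<open>Integrating \<open>k1 s\<close> against exp(i p (s + t)) returns exp(i p t)
    times \<open>half_fourier k1 p\<close>. Hence \<open>D p\<close> is the total coefficient of
    exp(i p t) on the left-hand side of the equation.\<close>
  define D where "D = (\<lambda>p. c p * (H1 + half_fourier k1 p))"
  define E where "E = (\<lambda>p (t::real). indicator {0..} t *\<^sub>R exp (\<i> * p * of_real t))"
  define kk where "kk = (\<lambda>t. indicator {0..} t *\<^sub>R k2 t)"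
  \<comment> \<open>The transform of \<open>r\<close> involves the whole line, so \<open>h\<close>
    must be defined there too. The terms in \<open>k2\<close> and in the exponentials are cut off at
    0; for negative t only integrability of \<open>h\<close> matters.\<close>
  define h where "h = (\<lambda>t. kk t + (\<Sum>p\<in>Z. D p * E p t) + r t * H1 + correlation k1 r t)"
  define hm where "hm = (\<lambda>t. h (- t))"
  have Zp: "Im p > 0" if "p \<in> Z" for p using that Z by auto
  have kk: "integrable lborel kk" unfolding kk_def using k2 by (intro integrable_mult_indicator) auto
  have E: "integrable lborel (E p)" if "p \<in> Z" for p
    unfolding E_def by (rule decaying_exp_integrable[OF Zp[OF that]])
  have hi: "integrable lborel h"
    unfolding h_def using kk E r correlation_integrable[OF k1 r] by auto
  have hmi: "integrable lborel hm"
    unfolding hm_def using lborel_integrable_real_affine[OF hi, of "-1" 0] by simp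
  define T where "T = (\<lambda>l. n l / a l - (\<Sum>p\<in>Z. (n p / deriv a p) / (l - p)))"
  have FT_pos: "(\<integral>t. exp (- \<i> * of_real (x * t)) * (indicator {0..} t *\<^sub>R f t) \<partial>lborel) = half_fourier f (- of_real x)" for x f
    unfolding half_fourier_def set_lebesgue_integral_def
    by (rule Bochner_Integration.integral_cong) (auto simp: indicator_def mult.assoc)
  have FT_h: "half_fourier h (- of_real x) + half_fourier hm (of_real x) = T (of_real x) - H2" for x :: real
  proof -
    let ?e = "\<lambda>t. exp (- \<i> * of_real (x * t)) :: complex"
    have Ei: "integrable lborel (\<lambda>t. D p * E p t)" if "p \<in> Z" for p using E[OF that] by simp
    have "half_fourier h (- of_real x) + half_fourier hm (of_real x) = (\<integral>t. ?e t * h t \<partial>lborel)"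
      unfolding hm_def by (rule fourier_split_half_fourier[OF hi, symmetric])
    also have "\<dots> = (\<integral>t. ?e t * kk t + (\<Sum>p\<in>Z. ?e t * (D p * E p t)) + ?e t * r t * H1 + ?e t * correlation k1 r t \<partial>lborel)"
      unfolding h_def by (simp add: distrib_left sum_distrib_left mult.assoc)
    also have "\<dots> = (\<integral>t. ?e t * kk t \<partial>lborel) + (\<Sum>p\<in>Z. \<integral>t. ?e t * (D p * E p t) \<partial>lborel) + (\<integral>t. ?e t * r t \<partial>lborel) * H1 + (\<integral>t. ?e t * correlation k1 r t \<partial>lborel)"
      using integrable_exp_mult[OF kk, of x] integrable_exp_mult[OF r, of x] integrable_exp_mult[OF correlation_integrable[OF k1 r], of x]
        integrable_exp_mult[OF Ei, of _ x]
      by (subst Bochner_Integration.integral_add Bochner_Integration.integral_sum, (auto simp del: of_real_mult)[2])+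
    also have "(\<integral>t. ?e t * kk t \<partial>lborel) = half_fourier k2 (- of_real x)"
      unfolding kk_def by (rule FT_pos)
    also have "(\<Sum>p\<in>Z. \<integral>t. ?e t * (D p * E p t) \<partial>lborel) = - (\<Sum>p\<in>Z. (n p / deriv a p) / (of_real x - p))"
      unfolding sum_negf[symmetric]
    proof (rule sum.cong[OF refl])
      fix p assume p: "p \<in> Z"
      have px: "p - of_real x \<noteq> 0" "of_real x - p \<noteq> 0" using Zp[OF p] by auto
      have "(\<integral>t. ?e t * (D p * E p t) \<partial>lborel) = D p * (\<integral>t. ?e t * E p t \<partial>lborel)"
        by (simp only: mult.left_commute[of _ "D p"] integral_mult_right_zero)
      also have "(\<integral>t. ?e t * E p t \<partial>lborel) = half_fourier (E p) (- of_real x)"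
        unfolding E_def FT_pos half_fourier_eq_integral ..
      also have "\<dots> = \<i> / (p + - of_real x)"
        unfolding E_def by (rule half_fourier_decaying_exp) (use Zp[OF p] in auto)
      also have "D p * \<dots> = - ((n p / deriv a p) / (of_real x - p))"
        using px unfolding res[OF p] D_def by (simp add: field_simps)
      finally show "(\<integral>t. ?e t * (D p * E p t) \<partial>lborel) = - ((n p / deriv a p) / (of_real x - p))" .
    qed
    also have "(\<integral>t. ?e t * correlation k1 r t \<partial>lborel) = half_fourier k1 (of_real x) * (\<integral>t. ?e t * r t \<partial>lborel)"
      by (rule fourier_correlation[OF k1 r])
    finally show ?thesis unfolding T_def real by (simp add: algebra_simps)
  qed
  obtain g where g: "g holomorphic_on {l. Im l > 0}" "\<And>l. l \<in> {l. Im l > 0} - Z \<Longrightarrow> g l = T l"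
    using holomorphic_quotient_minus_simple_poles[OF n(1) a(1) open_halfspace_Im_gt Z(1) _ simple] Z(2)
    unfolding T_def by auto
  \<comment> \<open>At the poles \<open>T\<close> contains quotients by zero. \<open>G\<close> takes
    the holomorphic extension there and stays equal to \<open>T\<close> on the real line, where
    \<open>a\<close> has no zeros.\<close>
  define G where "G = (\<lambda>l. if Im l > 0 then g l else T l)"
  have GT: "G l = T l" if "l \<notin> Z" for l using that g(2)[of l] by (auto simp: G_def)
  have Gh: "G holomorphic_on {l. Im l > 0}"
    using g(1) by (rule holomorphic_transform) (auto simp: G_def)
  have a_nz: "a l \<noteq> 0" if "Im l \<ge> 0" "l \<notin> Z" for l
  proof (cases "Im l = 0")
    case True
    then have "of_real (Re l) = l" by (simp add: complex_eq_iff)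
    then show ?thesis using a_real[of "Re l"] by simp
  qed (use that Z in auto)
  have Tc: "continuous_on ({l. Im l \<ge> 0} - Z) T"
    unfolding T_def using a_nz by (intro continuous_intros continuous_on_subset[OF n(2)] continuous_on_subset[OF a(2)]) auto
  have Gc: "continuous_on {l. Im l \<ge> 0} G"
    unfolding continuous_on_eq_continuous_within
  proof
    fix l assume l: "l \<in> {l. Im l \<ge> 0}"
    show "continuous (at l within {l. Im l \<ge> 0}) G"
    proof (cases "Im l > 0")
      case True
      then have "continuous (at l) G"
        using holomorphic_on_imp_continuous_on[OF Gh] open_halfspace_Im_gt[of 0]
        by (simp add: continuous_on_eq_continuous_at)
      then show ?thesis by (rule continuous_at_imp_continuous_at_within)
    next
      case False
      then have lZ: "l \<in> - Z" using Zp by auto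
      have op: "open (- Z)" using Z(1) by (intro open_Compl finite_imp_closed)
      have "continuous (at l within {l. Im l \<ge> 0} \<inter> - Z) T"
        using Tc l lZ by (simp add: continuous_on_eq_continuous_within Diff_eq)
      moreover have "at l within {l. Im l \<ge> 0} \<inter> - Z = at l within {l. Im l \<ge> 0}"
        by (rule at_within_nhd[OF lZ op]) auto
      ultimately have "(T \<longlongrightarrow> T l) (at l within {l. Im l \<ge> 0})"
        unfolding continuous_within by simp
      moreover have "\<forall>\<^sub>F w in at l within {l. Im l \<ge> 0}. T w = G w"
        using eventually_nhds_in_open[OF op lZ] unfolding eventually_at_filter
        by (auto elim!: eventually_mono simp: GT)
      ultimately show ?thesis unfolding continuous_within using GT[of l] lZ
        by (auto intro: Lim_transform_eventually)
    qed
  qed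
  \<comment> \<open>The identity \<open>FT_h\<close>, rearranged so that each side continues to one
    of the two half-planes.\<close>
  define Y where "Y = (\<lambda>l. if Im l > 0 then G l - H2 - half_fourier hm l else half_fourier h (- l))"
  have Yh: "Y holomorphic_on UNIV"
    unfolding Y_def
  proof (rule half_plane_paste)
    show "(\<lambda>l. G l - H2 - half_fourier hm l) holomorphic_on {l. Im l > 0}"
      using Gh half_fourier_holomorphic[OF hmi] by (intro holomorphic_intros)
    show "continuous_on {l. Im l \<ge> 0} (\<lambda>l. G l - H2 - half_fourier hm l)"
      using Gc half_fourier_continuous[OF hmi] by (intro continuous_intros)
    have "(half_fourier h \<circ> uminus) holomorphic_on {l. Im l < 0}"
      by (rule holomorphic_on_compose) (auto intro!: holomorphic_intros holomorphic_on_subset[OF half_fourier_holomorphic[OF hi]])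
    then show "(\<lambda>l. half_fourier h (- l)) holomorphic_on {l. Im l < 0}" by (simp add: comp_def)
    show "continuous_on {l. Im l \<le> 0} (\<lambda>l. half_fourier h (- l))"
      by (rule continuous_on_compose2[OF half_fourier_continuous[OF hi]]) (auto intro!: continuous_intros)
    show "G (of_real x) - H2 - half_fourier hm (of_real x) = half_fourier h (- of_real x)" for x
      using FT_h[of x] by (simp add: G_def algebra_simps)
  qed
  \<comment> \<open>Beyond this radius \<open>a\<close> is bounded below by \<open>d\<close>, and
    every pole is at distance at least 1, so each principal part is bounded by its residue.\<close>
  define R where "R = max B (1 + (\<Sum>p\<in>Z. norm p))"
  have "compact (cball 0 R \<inter> {l. Im l \<ge> 0})"
    by (intro compact_Int_closed closed_halfspace_Im_ge) auto
  then have "bounded (G ` (cball 0 R \<inter> {l. Im l \<ge> 0}))"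
    by (intro compact_imp_bounded compact_continuous_image continuous_on_subset[OF Gc]) auto
  then obtain M where "\<forall>x\<in>G ` (cball 0 R \<inter> {l. Im l \<ge> 0}). norm x \<le> M"
    unfolding bounded_iff by blast
  then have M: "\<And>l. norm l \<le> R \<Longrightarrow> Im l \<ge> 0 \<Longrightarrow> norm (G l) \<le> M" by simp
  define M' where "M' = C / d + (\<Sum>p\<in>Z. norm (n p / deriv a p))"
  have M': "norm (G l) \<le> M'" if l: "norm l > R" "Im l \<ge> 0" for l
  proof -
    have far: "norm (l - p) \<ge> 1" if "p \<in> Z" for p
    proof -
      have "norm p \<le> (\<Sum>p\<in>Z. norm p)" using that Z(1) by (intro member_le_sum) auto
      then show ?thesis using l(1) norm_triangle_ineq2[of l p] unfolding R_def by linarith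
    qed
    then have "l \<notin> Z" by fastforce
    then have "norm (G l) \<le> norm (n l / a l) + norm (\<Sum>p\<in>Z. (n p / deriv a p) / (l - p))"
      unfolding GT[OF \<open>l \<notin> Z\<close>] T_def by (intro norm_triangle_ineq4)
    also have "\<dots> \<le> C / d + (\<Sum>p\<in>Z. norm (n p / deriv a p))"
    proof (intro add_mono sum_norm_le)
      show "norm (n l / a l) \<le> C / d"
        unfolding norm_divide using n_bdd[OF l(2)] a_low(1) a_low(2)[OF l(2)] l(1) order_trans[OF norm_ge_zero n_bdd[OF l(2)]]
        by (intro frac_le) (auto simp: R_def)
      fix p assume "p \<in> Z"
      show "norm ((n p / deriv a p) / (l - p)) \<le> norm (n p / deriv a p)"
        using far[OF \<open>p \<in> Z\<close>] unfolding norm_divide[of _ "l - p"]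
        by (intro divide_le_eq[THEN iffD2]) (auto simp: mult_le_cancel_left1)
    qed
    finally show ?thesis unfolding M'_def .
  qed
  have "bounded (range Y)"
    unfolding bounded_iff
  proof (intro exI ballI)
    fix y assume "y \<in> range Y"
    then obtain l where y: "y = Y l" by blast
    show "norm y \<le> max M M' + norm H2 + (\<integral>t. norm (hm t) \<partial>lborel) + (\<integral>t. norm (h t) \<partial>lborel)"
    proof (cases "Im l > 0")
      case True
      have "norm (G l) \<le> max M M'" using M[of l] M'[of l] True by (cases "norm l \<le> R") auto
      moreover have "norm (half_fourier hm l) \<le> (\<integral>t. norm (hm t) \<partial>lborel)"
        using True by (intro half_fourier_bound hmi) auto
      moreover have "norm y \<le> norm (G l) + norm H2 + norm (half_fourier hm l)"
        unfolding y Y_def using True norm_triangle_ineq4[of "G l - H2" "half_fourier hm l"] norm_triangle_ineq4[of "G l" H2] by auto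
      moreover have "(\<integral>t. norm (h t) \<partial>lborel) \<ge> 0" by simp
      ultimately show ?thesis by linarith
    next
      case False
      have "norm y \<le> (\<integral>t. norm (h t) \<partial>lborel)"
        unfolding y Y_def using False half_fourier_bound[OF hi, of "- l"] by simp
      moreover have "M \<ge> 0 \<or> M' \<ge> 0" using M[of 0] M'[of 0] order_trans[OF norm_ge_zero, of "G 0"] by (cases "norm (0::complex) \<le> R") auto
      moreover have "(\<integral>t. norm (hm t) \<partial>lborel) \<ge> 0" by simp
      ultimately show ?thesis using norm_ge_zero[of H2] by linarith
    qed
  qed
  then obtain y where y: "\<And>l. Y l = y" using Liouville_theorem[OF Yh] unfolding constant_on_def by blast
  \<comment> \<open>Real arguments fall into the lower branch of \<open>Y\<close>, so the constant
    is the transform of \<open>h\<close> restricted to t \<ge> 0.\<close>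
  have hy: "half_fourier h (of_real x) = y" for x :: real
    using y[of "- of_real x"] by (simp add: Y_def)
  have "y = 0"
  proof (rule ccontr)
    assume "y \<noteq> 0"
    then obtain A where "\<forall>l. Im l \<ge> 0 \<longrightarrow> norm l \<ge> A \<longrightarrow> norm (half_fourier h l) < norm y"
      using half_fourier_at_infinity[OF hi, of "norm y"] by auto
    then have "norm (half_fourier h (of_real \<bar>A\<bar>)) < norm y" by simp
    then show False by (simp only: hy)
  qed
  then have "AE t in lborel. t \<ge> 0 \<longrightarrow> h t = 0"
    using hy by (intro half_fourier_zero_imp_AE_zero hi) simp
  \<comment> \<open>The integral may be split into its \<open>r\<close> part and its exponential
    part only where the former converges.\<close>
  then show ?thesis using correlation_AE_integrable[OF k1 r]
  proof eventually_elim
    case (elim t)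
    have "(LINT s:{0..}|lborel. k1 s * (r (s + t) + (\<Sum>p\<in>Z. c p * exp (\<i> * p * of_real (s + t)))))
        = (\<integral>s. indicator {0..} s *\<^sub>R (k1 s * r (s + t)) + (\<Sum>p\<in>Z. (c p * exp (\<i> * p * of_real t)) * (indicator {0..} s *\<^sub>R (exp (\<i> * p * of_real s) * k1 s))) \<partial>lborel)"
      unfolding set_lebesgue_integral_def
      by (rule Bochner_Integration.integral_cong)
        (auto simp: distrib_left sum_distrib_left exp_add indicator_def algebra_simps)
    also have "\<dots> = correlation k1 r t + (\<Sum>p\<in>Z. (c p * exp (\<i> * p * of_real t)) * half_fourier k1 p)"
    proof -
      have pi: "integrable lborel (\<lambda>s. (c p * exp (\<i> * p * of_real t)) * (indicator {0..} s *\<^sub>R (exp (\<i> * p * of_real s) * k1 s)))" if "p \<in> Z" for p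
        using half_fourier_integrable[OF k1, of p] Zp[OF that]
        unfolding set_integrable_def by (intro integrable_mult_right) auto
      have k1i: "integrable lborel (\<lambda>s. indicator {0..} s *\<^sub>R (k1 s * r (s + t)))"
        using elim(2) unfolding set_integrable_def .
      define q where "q = (\<lambda>p s. (c p * exp (\<i> * p * of_real t)) * (indicator {0..} s *\<^sub>R (exp (\<i> * p * of_real s) * k1 s)))"
      have qi: "integrable lborel (q p)" if "p \<in> Z" for p using pi[OF that] by (simp add: q_def)
      have "(\<integral>s. indicator {0..} s *\<^sub>R (k1 s * r (s + t)) + (\<Sum>p\<in>Z. q p s) \<partial>lborel)
          = (\<integral>s. indicator {0..} s *\<^sub>R (k1 s * r (s + t)) \<partial>lborel) + (\<integral>s. (\<Sum>p\<in>Z. q p s) \<partial>lborel)"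
        by (rule Bochner_Integration.integral_add[OF k1i Bochner_Integration.integrable_sum[OF qi]])
      also have "(\<integral>s. (\<Sum>p\<in>Z. q p s) \<partial>lborel) = (\<Sum>p\<in>Z. \<integral>s. q p s \<partial>lborel)"
        by (rule Bochner_Integration.integral_sum[OF qi])
      finally show ?thesis
        unfolding correlation_def half_fourier_def set_lebesgue_integral_def q_def integral_mult_right_zero .
    qed
    finally show ?case
      using elim(1) by (auto simp: h_def kk_def E_def D_def algebra_simps sum_distrib_left sum.distrib)
  qed
qed

section \<open>Absolute continuity and tail variation\<close>

text \<open>The gauge integral gives a direct proof. Intervals tagged outside \<open>N\<close> are
  handled by differentiability at the tag. Those tagged in \<open>N\<close> lie in an open set of
  small measure, where absolute continuity makes the sum of the increments small.\<close>

lemma abs_continuous_has_integral: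
  fixes f f' :: "real \<Rightarrow> real"
  assumes ac: "abs_continuous_on UNIV f" and N: "negligible N"
    and der: "\<And>x. x \<notin> N \<Longrightarrow> (f has_vector_derivative f' x) (at x)" and ab: "a \<le> b"
  shows "((\<lambda>x. if x \<in> N then 0 else f' x) has_integral (f b - f a)) {a..b}"
proof -
  define g where "g = (\<lambda>x. if x \<in> N then 0 else f' x)"
  have "(g has_integral (f b - f a)) (cbox a b)"
    unfolding has_integral
  proof (intro allI impI)
    fix e :: real assume e: "e > 0"
    \<comment> \<open>The derivative errors add up to at most \<open>e1 * (b - a)\<close>, which
      must stay below \<open>e / 2\<close>; the summand 2 covers \<open>a = b\<close>.\<close>
    define e1 where "e1 = e / (2 * (b - a) + 2)"
    have e1: "e1 > 0" "e1 * (b - a) < e / 2"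
      unfolding e1_def using e ab by (simp_all add: field_simps)
    have "e / 2 > 0" using e by simp
    with ac obtain d where d: "d > 0" and "\<forall>(n::nat) (l::nat \<Rightarrow> real) u. (\<forall>k<n. l k \<le> u k \<and> {l k..u k} \<subseteq> UNIV) \<and>
        (\<forall>j<n. \<forall>k<n. j \<noteq> k \<longrightarrow> {l j<..<u j} \<inter> {l k<..<u k} = {}) \<and>
        (\<Sum>k<n. u k - l k) < d \<longrightarrow> (\<Sum>k<n. norm (f (u k) - f (l k))) < e / 2"
      unfolding abs_continuous_on_def by blast
    then have acd: "\<And>(n::nat) (l::nat \<Rightarrow> real) u. (\<forall>k<n. l k \<le> u k) \<Longrightarrow>
        (\<forall>j<n. \<forall>k<n. j \<noteq> k \<longrightarrow> {l j<..<u j} \<inter> {l k<..<u k} = {}) \<Longrightarrow>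
        (\<Sum>k<n. u k - l k) < d \<Longrightarrow> (\<Sum>k<n. norm (f (u k) - f (l k))) < e / 2"
      by simp
    have Nn: "N \<in> null_sets lebesgue" using N negligible_iff_null_sets by blast
    then obtain G where G: "open G" "N \<subseteq> G" "(G - N) \<in> lmeasurable" "emeasure lebesgue (G - N) < ennreal d"
      using sets_lebesgue_outer_open[of N d] d by blast
    have "emeasure lebesgue G = emeasure lebesgue (G - N)"
      using emeasure_Diff_null_set[OF Nn, of G] G(1) by (simp add: lmeasurable_iff_integrable)
    then have Gm: "emeasure lborel G < ennreal d" using G by simp
    have "\<exists>r>0. \<forall>y. \<bar>y - x\<bar> < r \<longrightarrow> \<bar>f y - f x - (y - x) * f' x\<bar> \<le> e1 * \<bar>y - x\<bar>" if "x \<notin> N" for x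
      using der[OF that] e1(1) unfolding has_vector_derivative_def has_derivative_at_alt
      by (auto simp: real_norm_def)
    then obtain r where r: "\<And>x. x \<notin> N \<Longrightarrow> r x > 0"
      "\<And>x y. x \<notin> N \<Longrightarrow> \<bar>y - x\<bar> < r x \<Longrightarrow> \<bar>f y - f x - (y - x) * f' x\<bar> \<le> e1 * \<bar>y - x\<bar>"
      by metis
    \<comment> \<open>At a tag in \<open>N\<close> the gauge is the open set \<open>G\<close>
      itself. All intervals with such tags are disjoint up to end points and lie in
      \<open>G\<close>, so their total length is below \<open>d\<close>.\<close>
    define \<gamma> where "\<gamma> = (\<lambda>x. if x \<in> N then G else ball x (r x))"
    have "gauge \<gamma>" unfolding gauge_def \<gamma>_def using G r by auto
    moreover have "norm ((\<Sum>(x, k)\<in>\<D>. measure lborel k *\<^sub>R g x) - (f b - f a)) < e"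
      if D: "\<D> tagged_division_of cbox a b" and fine: "\<gamma> fine \<D>" for \<D>
    proof -
      note D' = tagged_division_ofD[OF D]
      have K: "\<exists>l u. K = {l..u} \<and> l \<le> u \<and> Inf K = l \<and> Sup K = u \<and> measure lborel K = u - l \<and> x \<in> {l..u}" if xK: "(x, K) \<in> \<D>" for x K
      proof -
        obtain l u where lu: "K = {l..u}" using D'(4)[OF xK] by auto
        then have "l \<le> u" using D'(2)[OF xK] by auto
        then show ?thesis using lu D'(2)[OF xK] by (intro exI[of _ l] exI[of _ u]) auto
      qed
      define DN where "DN = {p\<in>\<D>. fst p \<in> N}"
      define DC where "DC = {p\<in>\<D>. fst p \<notin> N}"
      have fin: "finite DN" "finite DC" and DU: "\<D> = DN \<union> DC" "DN \<inter> DC = {}"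
        using D'(1) by (auto simp: DN_def DC_def)
      have tel: "(\<Sum>(x, k)\<in>\<D>. f (Sup k) - f (Inf k)) = f b - f a"
        using additive_tagged_division_1[OF ab, of \<D> f] D by simp
      have "(\<Sum>(x, k)\<in>\<D>. measure lborel k *\<^sub>R g x) - (f b - f a) = (\<Sum>(x, k)\<in>\<D>. measure lborel k * g x - (f (Sup k) - f (Inf k)))"
        unfolding tel[symmetric] sum_subtractf[symmetric] by (intro sum.cong) auto
      also have "\<dots> = (\<Sum>(x, k)\<in>DN. measure lborel k * g x - (f (Sup k) - f (Inf k))) + (\<Sum>(x, k)\<in>DC. measure lborel k * g x - (f (Sup k) - f (Inf k)))"
        unfolding DU(1) using fin DU(2) by (rule sum.union_disjoint)
      finally have eq: "norm ((\<Sum>(x, k)\<in>\<D>. measure lborel k *\<^sub>R g x) - (f b - f a)) \<le>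
         norm (\<Sum>(x, k)\<in>DN. measure lborel k * g x - (f (Sup k) - f (Inf k))) + norm (\<Sum>(x, k)\<in>DC. measure lborel k * g x - (f (Sup k) - f (Inf k)))"
        by (simp only: norm_triangle_ineq)
      have "norm (\<Sum>(x, k)\<in>DC. measure lborel k * g x - (f (Sup k) - f (Inf k))) \<le> (\<Sum>(x, k)\<in>DC. e1 * (Sup k - Inf k))"
      proof (rule sum_norm_le, clarify)
        fix x K assume xK: "(x, K) \<in> DC"
        then have xD: "(x, K) \<in> \<D>" and xN: "x \<notin> N" by (auto simp: DC_def)
        obtain l u where lu: "K = {l..u}" "l \<le> u" "Inf K = l" "Sup K = u" "measure lborel K = u - l" "x \<in> {l..u}"
          using K[OF xD] by blast
        have sub: "K \<subseteq> ball x (r x)" using fineD[OF fine xD] xN unfolding \<gamma>_def by simp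
        have "l \<in> K" "u \<in> K" using lu by auto
        then have "l \<in> ball x (r x)" "u \<in> ball x (r x)" using sub by blast+
        then have "\<bar>l - x\<bar> < r x" "\<bar>u - x\<bar> < r x" by (auto simp: dist_real_def)
        from r(2)[OF xN this(1)] r(2)[OF xN this(2)]
        have "\<bar>f l - f x - (l - x) * f' x\<bar> \<le> e1 * (x - l)" "\<bar>f u - f x - (u - x) * f' x\<bar> \<le> e1 * (u - x)"
          using lu by auto
        \<comment> \<open>The tag lies between the end points, so the two one-sided errors are
          proportional to lengths that add up to \<open>u - l\<close>.\<close>
        then have "\<bar>(u - l) * f' x - (f u - f l)\<bar> \<le> e1 * (u - x) + e1 * (x - l)"
          by (simp add: algebra_simps)
        also have "\<dots> = e1 * (u - l)" by (simp add: algebra_simps)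
        finally show "norm (measure lborel K * g x - (f (Sup K) - f (Inf K))) \<le> e1 * (Sup K - Inf K)"
          using lu xN by (simp add: g_def)
      qed
      also have "\<dots> \<le> (\<Sum>(x, k)\<in>\<D>. e1 * (Sup k - Inf k))"
      proof (intro sum_mono2)
        fix p assume "p \<in> \<D> - DC"
        then have "(fst p, snd p) \<in> \<D>" by simp
        from K[OF this] have "Inf (snd p) \<le> Sup (snd p)" by blast
        then show "0 \<le> (case p of (x, k) \<Rightarrow> e1 * (Sup k - Inf k))" using e1(1) by (simp add: case_prod_unfold)
      qed (use D'(1) in \<open>auto simp: DC_def\<close>)
      also have "\<dots> = e1 * (\<Sum>(x, k)\<in>\<D>. (Sup k - Inf k))"
        by (simp add: sum_distrib_left case_prod_unfold)
      also have "(\<Sum>(x, k)\<in>\<D>. (Sup k - Inf k)) = b - a"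
        using additive_tagged_division_1[OF ab, of \<D> "\<lambda>x. x"] D by simp
      finally have C: "norm (\<Sum>(x, k)\<in>DC. measure lborel k * g x - (f (Sup k) - f (Inf k))) < e / 2"
        using e1(2) by linarith
      have "norm (\<Sum>(x, k)\<in>DN. measure lborel k * g x - (f (Sup k) - f (Inf k))) \<le> (\<Sum>(x, k)\<in>DN. norm (f (Sup k) - f (Inf k)))"
        by (rule sum_norm_le) (auto simp: DN_def g_def)
      also have "\<dots> < e / 2"
      proof -
        obtain h where h: "bij_betw h {..<card DN} DN"
          using ex_bij_betw_nat_finite[OF fin(1)] by (auto simp: atLeast0LessThan)
        have sums: "(\<Sum>p\<in>DN. F p) = (\<Sum>k<card DN. F (h k))" for F :: "_ \<Rightarrow> real"
          using sum.reindex_bij_betw[OF h, of F] by simp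
        have hD: "h k \<in> DN" if "k < card DN" for k using h that by (auto simp: bij_betw_def)
        define l where "l = (\<lambda>k. Inf (snd (h k)))"
        define u where "u = (\<lambda>k. Sup (snd (h k)))"
        have lu: "snd (h k) = {l k..u k}" "l k \<le> u k" if "k < card DN" for k
          using K[of "fst (h k)" "snd (h k)"] hD[OF that] by (auto simp: l_def u_def DN_def)
        have disj: "{l j<..<u j} \<inter> {l k<..<u k} = {}" if jk: "j < card DN" "k < card DN" "j \<noteq> k" for j k
        proof -
          have "h j \<noteq> h k" using h jk by (auto simp: bij_betw_def inj_on_def)
          then have "interior (snd (h j)) \<inter> interior (snd (h k)) = {}"
            using D'(5)[of "fst (h j)" "snd (h j)" "fst (h k)" "snd (h k)"] hD[OF jk(1)] hD[OF jk(2)]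
            by (auto simp: DN_def prod_eq_iff)
          then show ?thesis using lu(1)[OF jk(1)] lu(1)[OF jk(2)] by simp
        qed
        have "(\<Sum>k<card DN. u k - l k) = (\<Sum>k<card DN. measure lborel {l k<..<u k})"
          using lu(2) by (intro sum.cong) auto
        also have "\<dots> = measure lborel (\<Union>k<card DN. {l k<..<u k})"
          using disj lu(2) by (intro measure_finite_Union[symmetric]) (auto simp: disjoint_family_on_def emeasure_lborel_Ioo)
        also have "\<dots> < d"
        proof -
          have "(\<Union>k<card DN. {l k<..<u k}) \<subseteq> G"
          proof (clarify)
            fix k y assume k: "k < card DN" and y: "y \<in> {l k<..<u k}"
            have "h k \<in> \<D>" "fst (h k) \<in> N" using hD[OF k] by (auto simp: DN_def)
            then have "snd (h k) \<subseteq> G" using fineD[OF fine, of "fst (h k)" "snd (h k)"] unfolding \<gamma>_def by simp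
            then show "y \<in> G" using lu(1)[OF k] y by auto
          qed
          then have "emeasure lborel (\<Union>k<card DN. {l k<..<u k}) \<le> emeasure lborel G"
            using G(1) by (intro emeasure_mono) auto
          also note Gm
          finally show ?thesis using d by (metis (no_types, lifting) emeasure_eq_ennreal_measure ennreal_less_iff measure_nonneg top.not_eq_extremum less_top order.strict_trans ennreal_less_top)
        qed
        finally have "(\<Sum>k<card DN. norm (f (u k) - f (l k))) < e / 2"
          using acd[of "card DN" l u] lu(2) disj by blast
        then show ?thesis unfolding case_prod_unfold sums l_def u_def .
      qed
      finally show ?thesis using eq C by linarith
    qed
    ultimately show "\<exists>\<gamma>. gauge \<gamma> \<and> (\<forall>\<D>. \<D> tagged_division_of cbox a b \<and> \<gamma> fine \<D> \<longrightarrow>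
        norm ((\<Sum>(x, k)\<in>\<D>. measure lborel k *\<^sub>R g x) - (f b - f a)) < e)"
      by (intro exI[of _ \<gamma>] conjI allI impI) (assumption, elim conjE)
  qed
  then show ?thesis unfolding g_def by simp
qed

section \<open>Integrals over left half-lines and the variation of m\<close>

definition lower_integral :: "(real \<Rightarrow> real) \<Rightarrow> real \<Rightarrow> real" where
  "lower_integral w x = (LINT y:{..x}|lborel. w y)"

lemma lower_integral_at_bot:
  assumes "integrable lborel w"
  shows "(lower_integral w \<longlongrightarrow> 0) at_bot"
proof (rule tendsto_at_botI_sequentially)
  fix X :: "nat \<Rightarrow> real" assume X: "filterlim X at_bot sequentially"
  have "(\<lambda>n. \<integral>y. indicator {..X n} y *\<^sub>R w y \<partial>lborel) \<longlonglongrightarrow> (\<integral>y. 0 \<partial>(lborel::real measure))"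
  proof (rule integral_dominated_convergence[where w = "\<lambda>y. norm (w y)"])
    show "AE y in lborel. (\<lambda>n. indicator {..X n} y *\<^sub>R w y) \<longlonglongrightarrow> 0"
    proof (rule AE_I2, rule tendsto_eventually)
      fix y
      have "\<forall>\<^sub>F n in sequentially. X n < y" using X by (simp add: filterlim_at_bot_dense)
      then show "\<forall>\<^sub>F n in sequentially. indicator {..X n} y *\<^sub>R w y = 0"
        by eventually_elim auto
    qed
  qed (use assms in \<open>auto simp: indicator_def\<close>)
  then show "(\<lambda>n. lower_integral w (X n)) \<longlonglongrightarrow> 0"
    by (simp add: lower_integral_def set_lebesgue_integral_def)
qed

lemma lower_integral_diff:
  assumes w: "integrable lborel w" and st: "s \<le> t"
  shows "lower_integral w t - lower_integral w s = integral {s..t} w" "w integrable_on {s..t}"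
proof -
  have si: "set_integrable lborel A w" if "A \<in> sets borel" for A
    unfolding set_integrable_def using that w by (intro integrable_mult_indicator) auto
  have "lower_integral w t = (LINT y:{..s} \<union> {s<..t}|lborel. w y)"
    using st by (simp add: lower_integral_def ivl_disj_un_one)
  also have "\<dots> = lower_integral w s + (LINT y:{s<..t}|lborel. w y)"
    unfolding lower_integral_def by (rule set_integral_Un) (auto intro!: si)
  also have "(LINT y:{s<..t}|lborel. w y) = (LINT y:{s..t}|lborel. w y)"
    by (rule set_integral_cong_set) (use AE_lborel_singleton[of s] w in \<open>auto simp: set_borel_measurable_def elim!: eventually_mono\<close>)
  also have "\<dots> = integral {s..t} w" by (rule set_borel_integral_eq_integral(2)[OF si]) simp
  finally show "lower_integral w t - lower_integral w s = integral {s..t} w" by simp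
  show "w integrable_on {s..t}" by (rule set_borel_integral_eq_integral(1)[OF si]) simp
qed

lemma lower_integral_nonneg:
  assumes "\<And>x. w x \<ge> 0" shows "lower_integral w x \<ge> 0"
  unfolding lower_integral_def set_lebesgue_integral_def using assms
  by (intro Bochner_Integration.integral_nonneg) auto

lemma norm_has_integral_le_lower_integral:
  fixes g :: "real \<Rightarrow> 'a::euclidean_space"
  assumes w: "integrable lborel w" and st: "s \<le> t" and g: "(g has_integral I) {s..t}"
    and le: "\<And>x. x \<in> {s..t} \<Longrightarrow> norm (g x) \<le> w x"
  shows "norm I \<le> lower_integral w t - lower_integral w s"
  using Henstock_Kurzweil_Integration.integral_norm_bound_integral[OF _ lower_integral_diff(2)[OF w st] le] g
    integral_unique[OF g] by (auto simp: lower_integral_diff(1)[OF w st])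

text \<open>Here \<open>v x\<close> is the sum over the components of the integral of the modulus of
  the derivative over (-\<infinity>, x]. Its differences are additive over adjacent intervals, so
  the costs of successive freezing steps telescope, and its limit 0 at -\<infinity> supplies the
  smallness on which the lower bound for \<open>a\<close> rests.\<close>

lemma abs_continuous_tail_variation:
  fixes m m' :: "real \<Rightarrow> real^3"
  assumes ac: "abs_continuous_on UNIV m"
    and der: "AE x in lborel. (m has_vector_derivative m' x) (at x)"
    and int: "\<And>k. integrable lborel (\<lambda>x. m' x $ k)"
  obtains v where "(v \<longlongrightarrow> 0) at_bot" "\<And>x. v x \<ge> 0" "\<And>s t. s \<le> t \<Longrightarrow> norm (m t - m s) \<le> v t - v s"
proof
  define v where "v = (\<lambda>x. \<Sum>k\<in>UNIV. lower_integral (\<lambda>y. \<bar>m' y $ k\<bar>) x)"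
  have wi: "integrable lborel (\<lambda>y. \<bar>m' y $ k\<bar>)" for k using int by simp
  have "(v \<longlongrightarrow> (\<Sum>k\<in>(UNIV::3 set). 0)) at_bot"
    unfolding v_def by (intro tendsto_sum lower_integral_at_bot wi)
  then show "(v \<longlongrightarrow> 0) at_bot" by simp
  show "v x \<ge> 0" for x unfolding v_def by (intro sum_nonneg lower_integral_nonneg) auto
  fix s t :: real assume st: "s \<le> t"
  obtain N where N: "{x. \<not> (m has_vector_derivative m' x) (at x)} \<subseteq> N" "N \<in> null_sets lborel"
    using der by (auto elim: AE_E simp: null_sets_def)
  have neg: "negligible N"
    using N(2) null_sets_completionI by (auto simp: negligible_iff_null_sets)
  have "\<bar>(m t - m s) $ k\<bar> \<le> lower_integral (\<lambda>y. \<bar>m' y $ k\<bar>) t - lower_integral (\<lambda>y. \<bar>m' y $ k\<bar>) s" for k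
  proof -
    have "((\<lambda>x. if x \<in> N then 0 else m' x $ k) has_integral (m t $ k - m s $ k)) {s..t}"
    proof (rule abs_continuous_has_integral[OF _ neg _ st])
      show "abs_continuous_on UNIV (\<lambda>x. m x $ k)"
        unfolding abs_continuous_on_def
      proof (intro allI impI)
        fix e :: real assume "e > 0"
        with ac obtain d where d: "d > 0" "\<forall>(n::nat) (l::nat \<Rightarrow> real) u. (\<forall>k<n. l k \<le> u k \<and> {l k..u k} \<subseteq> UNIV) \<and>
          (\<forall>j<n. \<forall>k<n. j \<noteq> k \<longrightarrow> {l j<..<u j} \<inter> {l k<..<u k} = {}) \<and>
          (\<Sum>k<n. u k - l k) < d \<longrightarrow> (\<Sum>k<n. norm (m (u k) - m (l k))) < e"
          unfolding abs_continuous_on_def by blast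
        have le: "(\<Sum>i<n. norm (m (u i) $ k - m (l i) $ k)) \<le> (\<Sum>i<n. norm (m (u i) - m (l i)))" for n and l u :: "nat \<Rightarrow> real"
          using component_le_norm_cart[of "m _ - m _" k] by (intro sum_mono) simp
        show "\<exists>d>0. \<forall>(n::nat) (l::nat \<Rightarrow> real) u. (\<forall>k<n. l k \<le> u k \<and> {l k..u k} \<subseteq> UNIV) \<and>
          (\<forall>j<n. \<forall>k<n. j \<noteq> k \<longrightarrow> {l j<..<u j} \<inter> {l k<..<u k} = {}) \<and>
          (\<Sum>k<n. u k - l k) < d \<longrightarrow> (\<Sum>i<n. norm (m (u i) $ k - m (l i) $ k)) < e"
          by (intro exI[of _ d] conjI d(1) allI impI le_less_trans[OF le] d(2)[rule_format]) simp_all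
      qed
      fix x assume "x \<notin> N"
      then have "(m has_vector_derivative m' x) (at x)" using N(1) by auto
      then show "((\<lambda>x. m x $ k) has_vector_derivative m' x $ k) (at x)"
        by (rule bounded_linear.has_vector_derivative[OF bounded_linear_vec_nth])
    qed
    from norm_has_integral_le_lower_integral[OF wi st this] show ?thesis by auto
  qed
  then have "(\<Sum>k\<in>UNIV. \<bar>(m t - m s) $ k\<bar>) \<le> (\<Sum>k\<in>UNIV. lower_integral (\<lambda>y. \<bar>m' y $ k\<bar>) t - lower_integral (\<lambda>y. \<bar>m' y $ k\<bar>) s)"
    by (intro sum_mono) blast
  then show "norm (m t - m s) \<le> v t - v s"
    using norm_le_l1_cart[of "m t - m s"] by (simp add: v_def sum_subtractf)
qed

section \<open>Flows with frozen coefficients\<close>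

text \<open>The matrix \<open>msig v\<close> acting on a column. Columns are encoded as pairs, whose
  norm is the Euclidean one.\<close>

definition pauli :: "real^3 \<Rightarrow> complex \<times> complex \<Rightarrow> complex \<times> complex" where
  "pauli v w = (of_real (v $ 3) * fst w + (of_real (v $ 1) - \<i> * of_real (v $ 2)) * snd w,
                (of_real (v $ 1) + \<i> * of_real (v $ 2)) * fst w - of_real (v $ 3) * snd w)"

definition cmul :: "complex \<Rightarrow> complex \<times> complex \<Rightarrow> complex \<times> complex" where
  "cmul c w = (c * fst w, c * snd w)"

text \<open>For a unit vector \<open>v\<close>, \<open>proj_plus\<close> and
  \<open>proj_minus\<close> are the spectral projections of v \<cdot> \<sigma> for the eigenvalues 1
  and -1.\<close>

definition proj_plus :: "real^3 \<Rightarrow> complex \<times> complex \<Rightarrow> complex \<times> complex" where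
  "proj_plus v w = (1/2) *\<^sub>R (w + pauli v w)"

definition proj_minus :: "real^3 \<Rightarrow> complex \<times> complex \<Rightarrow> complex \<times> complex" where
  "proj_minus v w = (1/2) *\<^sub>R (w - pauli v w)"

text \<open>The flow over time \<open>h\<close> of \<open>w' = i l (1 + v \<cdot> \<sigma>) w\<close> for a constant unit vector \<open>v\<close>.\<close>
definition frozen_flow :: "real \<Rightarrow> real^3 \<Rightarrow> complex \<Rightarrow> complex \<times> complex \<Rightarrow> complex \<times> complex" where
  "frozen_flow h v l w = cmul (exp (2 * \<i> * l * of_real h)) (proj_plus v w) + proj_minus v w"

lemma norm_prod_power2: "(norm w)\<^sup>2 = (norm (fst w))\<^sup>2 + (norm (snd w))\<^sup>2"
  by (simp add: norm_prod_def)

lemma norm_vec3_power2: "(norm (v :: real^3))\<^sup>2 = (v $ 1)\<^sup>2 + (v $ 2)\<^sup>2 + (v $ 3)\<^sup>2"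
  by (simp add: norm_vec_def L2_set_def sum_3)

text \<open>The matrix is Hermitian with square |v|^2. Arbitrary length is allowed because the lemma
  is applied to differences of unit vectors.\<close>

lemma norm_pauli: "norm (pauli v w) = norm v * norm w"
proof -
  have "(norm (pauli v w))\<^sup>2 = (norm v * norm w)\<^sup>2"
    unfolding power_mult_distrib norm_prod_power2 norm_vec3_power2 pauli_def cmod_power2 fst_conv snd_conv
    by (simp add: power2_eq_square algebra_simps)
  then show ?thesis by (rule power2_eq_imp_eq) auto
qed

lemma pauli_add: "pauli v (w + w') = pauli v w + pauli v w'"
  and pauli_diff: "pauli v (w - w') = pauli v w - pauli v w'"
  and pauli_scaleR: "pauli v (r *\<^sub>R w) = r *\<^sub>R pauli v w"
  and pauli_cmul: "pauli v (cmul c w) = cmul c (pauli v w)"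
  and pauli_diff_left: "pauli (v - v') w = pauli v w - pauli v' w"
  by (auto simp: pauli_def cmul_def algebra_simps scaleR_conv_of_real)

lemma pauli_pauli:
  assumes "norm v = 1" shows "pauli v (pauli v w) = w"
proof -
  have "(v $ 1)\<^sup>2 + (v $ 2)\<^sup>2 + (v $ 3)\<^sup>2 = 1" using norm_vec3_power2[of v] assms by simp
  then have "complex_of_real ((v $ 1)\<^sup>2 + (v $ 2)\<^sup>2 + (v $ 3)\<^sup>2) = 1" by simp
  then have 1: "(of_real (v $ 1))\<^sup>2 + (of_real (v $ 2))\<^sup>2 + (of_real (v $ 3))\<^sup>2 = (1::complex)" by simp
  have "of_real (v $ 3) * (of_real (v $ 3) * p + (of_real (v $ 1) - \<i> * of_real (v $ 2)) * q) +
     (of_real (v $ 1) - \<i> * of_real (v $ 2)) * ((of_real (v $ 1) + \<i> * of_real (v $ 2)) * p - of_real (v $ 3) * q)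
     = ((of_real (v $ 1))\<^sup>2 + (of_real (v $ 2))\<^sup>2 + (of_real (v $ 3))\<^sup>2) * p"
    "(of_real (v $ 1) + \<i> * of_real (v $ 2)) * (of_real (v $ 3) * p + (of_real (v $ 1) - \<i> * of_real (v $ 2)) * q) -
     of_real (v $ 3) * ((of_real (v $ 1) + \<i> * of_real (v $ 2)) * p - of_real (v $ 3) * q)
     = ((of_real (v $ 1))\<^sup>2 + (of_real (v $ 2))\<^sup>2 + (of_real (v $ 3))\<^sup>2) * q" for p q :: complex
    by (simp_all add: algebra_simps power2_eq_square)
  then show ?thesis by (simp add: pauli_def 1)
qed

lemma cmul_add: "cmul c (w + w') = cmul c w + cmul c w'"
  and cmul_diff: "cmul c (w - w') = cmul c w - cmul c w'"
  and cmul_scaleR: "cmul c (r *\<^sub>R w) = r *\<^sub>R cmul c w"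
  and cmul_cmul: "cmul c (cmul d w) = cmul (c * d) w"
  and cmul_one: "cmul 1 w = w"
  by (auto simp: cmul_def algebra_simps scaleR_conv_of_real zero_prod_def)

lemma norm_cmul: "norm (cmul c w) = norm c * norm w"
proof -
  have "(norm (cmul c w))\<^sup>2 = (norm c * norm w)\<^sup>2"
    unfolding power_mult_distrib norm_prod_power2 cmul_def
    by (simp add: norm_mult power_mult_distrib algebra_simps)
  then show ?thesis by (rule power2_eq_imp_eq) auto
qed

lemma proj_plus_add: "proj_plus v (w + w') = proj_plus v w + proj_plus v w'"
  and proj_minus_add: "proj_minus v (w + w') = proj_minus v w + proj_minus v w'"
  and proj_plus_diff: "proj_plus v (w - w') = proj_plus v w - proj_plus v w'"
  and proj_minus_diff: "proj_minus v (w - w') = proj_minus v w - proj_minus v w'"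
  and proj_plus_cmul: "proj_plus v (cmul c w) = cmul c (proj_plus v w)"
  and proj_minus_cmul: "proj_minus v (cmul c w) = cmul c (proj_minus v w)"
  by (simp_all add: proj_plus_def proj_minus_def pauli_add pauli_diff pauli_cmul cmul_scaleR cmul_add cmul_diff
      algebra_simps)

lemma proj_sum: "proj_plus v w + proj_minus v w = w"
  by (simp add: proj_plus_def proj_minus_def scaleR_add_right[symmetric] del: scaleR_add_right)

text \<open>The parallelogram law, as \<open>pauli v\<close> is isometric: the two spectral
  components are orthogonal.\<close>

lemma norm_proj_power2:
  assumes "norm v = 1" shows "(norm w)\<^sup>2 = (norm (proj_plus v w))\<^sup>2 + (norm (proj_minus v w))\<^sup>2"
proof -
  have "(norm (w + pauli v w))\<^sup>2 + (norm (w - pauli v w))\<^sup>2 = 4 * (norm w)\<^sup>2"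
    using arg_cong[OF norm_pauli[of v w], of "\<lambda>x. x\<^sup>2"] assms
    by (simp add: power2_norm_eq_inner inner_add inner_diff inner_commute)
  then show ?thesis by (simp add: proj_plus_def proj_minus_def power_divide)
qed

lemma norm_proj_plus_diff_left: "norm (proj_plus v w - proj_plus v' w) = norm (v - v') * norm w / 2"
proof -
  have "proj_plus v w - proj_plus v' w = (1/2) *\<^sub>R pauli (v - v') w"
    by (simp add: proj_plus_def pauli_diff_left algebra_simps)
  then show ?thesis by (simp add: norm_pauli)
qed

lemma norm_proj_minus_diff_left: "norm (proj_minus v w - proj_minus v' w) = norm (v - v') * norm w / 2"
proof -
  have "proj_minus v w - proj_minus v' w = (-1/2) *\<^sub>R pauli (v - v') w"
    by (simp add: proj_minus_def pauli_diff_left algebra_simps)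
  then show ?thesis by (simp add: norm_pauli)
qed

lemma proj_frozen_flow:
  assumes "norm v = 1"
  shows "proj_plus v (frozen_flow h v l w) = cmul (exp (2 * \<i> * l * of_real h)) (proj_plus v w)"
    "proj_minus v (frozen_flow h v l w) = proj_minus v w"
proof -
  have pp: "pauli v (proj_plus v w) = proj_plus v w" and pm: "pauli v (proj_minus v w) = - proj_minus v w"
    using pauli_pauli[OF assms] by (simp_all add: proj_plus_def proj_minus_def pauli_scaleR pauli_add pauli_diff algebra_simps)
  have "x + x = 2 *\<^sub>R x" for x :: "complex \<times> complex" by (simp add: scaleR_2)
  then show "proj_plus v (frozen_flow h v l w) = cmul (exp (2 * \<i> * l * of_real h)) (proj_plus v w)"
    "proj_minus v (frozen_flow h v l w) = proj_minus v w"
    unfolding proj_plus_def[of v "frozen_flow h v l w"] proj_minus_def[of v "frozen_flow h v l w"]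
    by (simp_all add: frozen_flow_def pauli_add pauli_cmul pp pm)
qed

lemma norm_exp_le_1_half_plane:
  "Im l \<ge> 0 \<Longrightarrow> h \<ge> 0 \<Longrightarrow> norm (exp (2 * \<i> * l * of_real h)) \<le> 1"
  by (simp add: norm_exp_eq_Re)

text \<open>The component along \<open>+v\<close> is multiplied by exp(2 i l h), of modulus at most
  1, and the orthogonal one is kept. Without the summand 1 in the generator the latter would
  grow.\<close>

lemma norm_frozen_flow_le:
  assumes "norm v = 1" "Im l \<ge> 0" "h \<ge> 0"
  shows "norm (frozen_flow h v l w) \<le> norm w"
proof -
  have "norm (cmul (exp (2 * \<i> * l * of_real h)) (proj_plus v w)) \<le> norm (proj_plus v w)"
    unfolding norm_cmul using norm_exp_le_1_half_plane[OF assms(2,3)] by (intro mult_left_le_one_le) auto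
  then have "(norm (frozen_flow h v l w))\<^sup>2 \<le> (norm w)\<^sup>2"
    unfolding norm_proj_power2[OF assms(1), of w] norm_proj_power2[OF assms(1), of "frozen_flow h v l w"]
      proj_frozen_flow[OF assms(1)] by (simp add: power_mono)
  then show ?thesis by (rule power2_le_imp_le) simp
qed

text \<open>For real \<open>l\<close> the flow is unitary for either sign of \<open>h\<close>, so
  pulling back costs nothing.\<close>

lemma norm_frozen_flow_real:
  assumes "norm v = 1"
  shows "norm (frozen_flow h v (of_real l) w) = norm w"
proof -
  have "norm (cmul (exp (2 * \<i> * of_real l * of_real h)) (proj_plus v w)) = norm (proj_plus v w)"
    unfolding norm_cmul by (simp add: norm_exp_eq_Re)
  then have "(norm (frozen_flow h v (of_real l) w))\<^sup>2 = (norm w)\<^sup>2"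
    unfolding norm_proj_power2[OF assms(1), of w] norm_proj_power2[OF assms(1), of "frozen_flow h v (of_real l) w"]
      proj_frozen_flow[OF assms(1)] by simp
  then show ?thesis by (rule power2_eq_imp_eq) auto
qed

lemma frozen_flow_diff: "frozen_flow h v l (w - w') = frozen_flow h v l w - frozen_flow h v l w'"
  by (simp add: frozen_flow_def proj_plus_diff proj_minus_diff cmul_diff)

lemma has_vector_derivative_Pair_iff:
  "((\<lambda>t. (f t, g t)) has_vector_derivative (f', g')) (at x) \<longleftrightarrow>
    (f has_vector_derivative f') (at x) \<and> (g has_vector_derivative g') (at x)"
proof safe
  assume *: "((\<lambda>t. (f t, g t)) has_vector_derivative (f', g')) (at x)"
  show "(f has_vector_derivative f') (at x)"
    using bounded_linear.has_vector_derivative[OF bounded_linear_fst *] by simp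
  show "(g has_vector_derivative g') (at x)"
    using bounded_linear.has_vector_derivative[OF bounded_linear_snd *] by simp
next
  assume "(f has_vector_derivative f') (at x)" "(g has_vector_derivative g') (at x)"
  then show "((\<lambda>t. (f t, g t)) has_vector_derivative (f', g')) (at x)"
    unfolding has_vector_derivative_def by (auto dest: has_derivative_Pair)
qed

lemma bounded_linear_proj: "bounded_linear (proj_plus v)" "bounded_linear (proj_minus v)"
proof -
  have s: "proj_plus v (r *\<^sub>R w) = r *\<^sub>R proj_plus v w" "proj_minus v (r *\<^sub>R w) = r *\<^sub>R proj_minus v w" for r w
    by (simp_all add: proj_plus_def proj_minus_def pauli_scaleR algebra_simps)
  show "bounded_linear (proj_plus v)" "bounded_linear (proj_minus v)"
    unfolding linear_conv_bounded_linear[symmetric]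
    by (intro linearI proj_plus_add proj_minus_add s)+
qed

lemma has_vector_derivative_cmul:
  assumes c: "(c has_vector_derivative c') (at x)" and w: "(w has_vector_derivative w') (at x)"
  shows "((\<lambda>t. cmul (c t) (w t)) has_vector_derivative (cmul c' (w x) + cmul (c x) w')) (at x)"
proof -
  have "((\<lambda>t. c t * fst (w t)) has_vector_derivative c x * fst w' + c' * fst (w x)) (at x)"
    "((\<lambda>t. c t * snd (w t)) has_vector_derivative c x * snd w' + c' * snd (w x)) (at x)"
    using bounded_linear.has_vector_derivative[OF bounded_linear_fst w] bounded_linear.has_vector_derivative[OF bounded_linear_snd w]
    by (auto intro!: has_vector_derivative_mult c)
  then show ?thesis
    unfolding cmul_def by (simp add: has_vector_derivative_Pair_iff add.commute)
qed

text \<open>Pulling a solution back along the flow frozen at \<open>v\<close> leaves only the defect \<open>m t - v\<close>.\<close>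
lemma frozen_flow_pullback_derivative:
  fixes l :: real
  assumes v: "norm v = 1" and W: "(W has_vector_derivative cmul (2 * \<i> * of_real l) (proj_plus (m t) (W t))) (at t)"
  defines "G \<equiv> \<lambda>s. frozen_flow (- s) v (of_real l) (W s)"
  obtains G' where "(G has_vector_derivative G') (at t)" "norm G' = \<bar>l\<bar> * norm (m t - v) * norm (W t)"
proof
  define e where "e = (\<lambda>s::real. exp (2 * \<i> * of_real l * of_real (- s)))"
  define W' where "W' = cmul (2 * \<i> * of_real l) (proj_plus (m t) (W t))"
  define D where "D = proj_plus (m t) (W t) - proj_plus v (W t)"
  define G' where "G' = cmul (2 * \<i> * of_real l) (frozen_flow (- t) v (of_real l) D)"
  have W'_eq: "W' = cmul (2 * \<i> * of_real l) (proj_plus v (W t) + D)" by (simp add: W'_def D_def)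
  have e: "(e has_vector_derivative (- 2 * \<i> * of_real l) * e t) (at t)"
  proof -
    have "((\<lambda>w. exp (- 2 * \<i> * of_real l * w)) has_field_derivative (- 2 * \<i> * of_real l) * exp (- 2 * \<i> * of_real l * of_real t)) (at (of_real t))"
      by (rule derivative_eq_intros refl | simp)+
    from has_vector_derivative_real_field[OF this] show ?thesis by (simp add: e_def)
  qed
  have "((\<lambda>s. cmul (e s) (proj_plus v (W s)) + proj_minus v (W s)) has_vector_derivative
     (cmul ((- 2 * \<i> * of_real l) * e t) (proj_plus v (W t)) + cmul (e t) (proj_plus v W')) + proj_minus v W') (at t)"
    using W unfolding W'_def[symmetric]
    by (intro has_vector_derivative_add has_vector_derivative_cmul e bounded_linear.has_vector_derivative[OF bounded_linear_proj(1)] bounded_linear.has_vector_derivative[OF bounded_linear_proj(2)])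
  moreover have "(cmul ((- 2 * \<i> * of_real l) * e t) (proj_plus v (W t)) + cmul (e t) (proj_plus v W')) + proj_minus v W' = G'"
  proof -
    have idem: "proj_plus v (proj_plus v w) = proj_plus v w" "proj_minus v (proj_plus v w) = 0" for w
      using pauli_pauli[OF v, of w]
      by (simp_all add: proj_plus_def proj_minus_def pauli_scaleR pauli_add algebra_simps flip: scaleR_2)
    show ?thesis
      unfolding W'_eq G'_def frozen_flow_def proj_plus_cmul proj_minus_cmul proj_plus_add proj_minus_add idem cmul_add cmul_cmul
      by (simp add: cmul_def algebra_simps e_def)
  qed
  ultimately show "(G has_vector_derivative G') (at t)"
    unfolding G_def frozen_flow_def e_def by simp
  show "norm G' = \<bar>l\<bar> * norm (m t - v) * norm (W t)"
    unfolding G'_def norm_cmul norm_frozen_flow_real[OF v] D_def norm_proj_plus_diff_left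
    by (simp add: norm_mult)
qed

section \<open>Continuation of the Jost solution\<close>

text \<open>The error on the real line grows linearly in |x|. Dividing by \<open>l + \<i>\<close>,
  which has no zero in the closed half-plane, makes the convergence uniform there, and the maximum
  principle turns this into a uniform Cauchy condition on the half-plane. The limit agrees with
  \<open>f\<close> on the real line, hence everywhere.\<close>

lemma half_plane_limit:
  fixes F :: "nat \<Rightarrow> complex \<Rightarrow> complex"
  assumes F: "\<And>n. F n holomorphic_on {l. Im l > 0}" "\<And>n. continuous_on {l. Im l \<ge> 0} (F n)"
    and F1: "\<And>n l. Im l \<ge> 0 \<Longrightarrow> norm (F n l) \<le> 1"
    and f: "f holomorphic_on {l. Im l > 0}" "continuous_on {l. Im l \<ge> 0} f"
    and close: "\<And>n (x::real). norm (F n (of_real x) - f (of_real x)) \<le> e n * \<bar>x\<bar>"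
    and e: "e \<longlonglongrightarrow> 0" and l: "Im l \<ge> 0"
  shows "(\<lambda>n. F n l) \<longlonglongrightarrow> f l"
proof -
  define P where "P = (\<lambda>n l. F n l / (l + \<i>))"
  have nz: "l + \<i> \<noteq> 0" if "Im l \<ge> 0" for l
    using that by (auto simp: complex_eq_iff)
  have ge1: "norm (l + \<i>) \<ge> 1" if "Im l \<ge> 0" for l
    using abs_Im_le_cmod[of "l + \<i>"] that by simp
  have hol: "P n holomorphic_on {l. Im l > 0}" for n
    unfolding P_def using nz by (intro holomorphic_intros F) auto
  have cont: "continuous_on {l. Im l \<ge> 0} (P n)" for n
    unfolding P_def using nz by (intro continuous_intros F) auto
  have bound: "norm (P n l - P k l) \<le> e n + e k" if "Im l \<ge> 0" for n k l
  proof (rule half_plane_maximum_modulus[where f = "\<lambda>l. P n l - P k l", OF _ _ _ _ that])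
    show "(\<lambda>l. P n l - P k l) holomorphic_on {l. Im l > 0}" by (intro holomorphic_intros hol)
    show "continuous_on {l. Im l \<ge> 0} (\<lambda>l. P n l - P k l)" by (intro continuous_intros cont)
    show "norm (P n l - P k l) \<le> 1 + 1" if "Im l \<ge> 0" for l
    proof -
      have "norm (P j l) \<le> 1" for j
        using F1[OF that, of j] ge1[OF that] unfolding P_def norm_divide
        by (subst divide_le_eq_1) auto
      then show ?thesis by (intro order_trans[OF norm_triangle_ineq4] add_mono)
    qed
    show "norm (P n (of_real x) - P k (of_real x)) \<le> e n + e k" for x :: real
    proof -
      have xi: "\<bar>x\<bar> \<le> norm (of_real x + \<i>)" using abs_Re_le_cmod[of "of_real x + \<i>"] by simp
      \<comment> \<open>The bound \<open>close\<close> at the point 1 shows that each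
        \<open>e n\<close> is nonnegative.\<close>
      have nn: "e n + e k \<ge> 0"
        using order_trans[OF norm_ge_zero close[of n 1]] order_trans[OF norm_ge_zero close[of k 1]] by simp
      have "norm (F n (of_real x) - F k (of_real x)) \<le> norm (F n (of_real x) - f (of_real x)) + norm (F k (of_real x) - f (of_real x))"
        using norm_triangle_ineq4[of "F n (of_real x) - f (of_real x)" "F k (of_real x) - f (of_real x)"] by simp
      also have "\<dots> \<le> (e n + e k) * \<bar>x\<bar>" using close[of n x] close[of k x] by (simp add: algebra_simps)
      also have "\<dots> \<le> (e n + e k) * norm (of_real x + \<i>)" by (rule mult_left_mono[OF xi nn])
      finally show ?thesis
        using nz[of "of_real x"] unfolding P_def diff_divide_distrib[symmetric] norm_divide
        by (subst pos_divide_le_eq) auto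
    qed
  qed
  have "uniformly_Cauchy_on {l. Im l \<ge> 0} P"
  proof (rule uniformly_Cauchy_onI)
    fix r :: real assume "r > 0"
    then obtain N where N: "\<And>n. n \<ge> N \<Longrightarrow> \<bar>e n\<bar> < r / 2"
      using LIMSEQ_D[OF e, of "r / 2"] by auto
    show "\<exists>M. \<forall>l\<in>{l. Im l \<ge> 0}. \<forall>m\<ge>M. \<forall>n\<ge>M. dist (P m l) (P n l) < r"
    proof (intro exI[of _ N] ballI allI impI)
      fix l m n assume "l \<in> {l. Im l \<ge> 0}" "m \<ge> N" "n \<ge> N"
      then show "dist (P m l) (P n l) < r"
        using bound[of l m n] N[of m] N[of n] by (simp add: dist_norm)
    qed
  qed
  then obtain Q where Q: "uniform_limit {l. Im l \<ge> 0} P Q sequentially"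
    using Cauchy_uniformly_convergent uniformly_convergent_on_def by blast
  have Qc: "continuous_on {l. Im l \<ge> 0} Q"
    by (rule uniform_limit_theorem[OF _ Q]) (auto intro: cont always_eventually)
  have Qh: "Q holomorphic_on {l. Im l > 0}"
  proof (rule holomorphic_uniform_sequence[OF open_halfspace_Im_gt hol])
    fix x :: complex assume "x \<in> {l. Im l > 0}"
    then obtain d where d: "d > 0" "cball x d \<subseteq> {l. Im l > 0}"
      using open_halfspace_Im_gt[of 0] open_contains_cball by blast
    then show "\<exists>d>0. cball x d \<subseteq> {z. 0 < Im z} \<and> uniform_limit (cball x d) P Q sequentially"
      by (intro exI[of _ d] conjI uniform_limit_on_subset[OF Q]) force+
  qed
  have conv: "(\<lambda>n. F n l) \<longlonglongrightarrow> Q l * (l + \<i>)" if "Im l \<ge> 0" for l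
  proof -
    have "(\<lambda>n. P n l * (l + \<i>)) \<longlonglongrightarrow> Q l * (l + \<i>)"
      using tendsto_uniform_limitI[OF Q, of l] that by (intro tendsto_intros) auto
    then show ?thesis using nz[OF that] by (simp add: P_def)
  qed
  have "(\<lambda>l. Q l * (l + \<i>)) l = f l"
  proof (rule half_plane_eq[OF _ _ f _ l])
    show "(\<lambda>l. Q l * (l + \<i>)) holomorphic_on {l. Im l > 0}" by (intro holomorphic_intros Qh)
    show "continuous_on {l. Im l \<ge> 0} (\<lambda>l. Q l * (l + \<i>))" by (intro continuous_intros Qc)
    show "Q (of_real x) * (of_real x + \<i>) = f (of_real x)" for x :: real
    proof -
      have "(\<lambda>n. e n * \<bar>x\<bar>) \<longlonglongrightarrow> 0" using tendsto_mult_right[OF e, of "\<bar>x\<bar>"] by simp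
      then have "(\<lambda>n. F n (of_real x) - f (of_real x)) \<longlonglongrightarrow> 0"
        by (rule Lim_null_comparison[rotated]) (auto intro!: always_eventually close)
      then have "(\<lambda>n. F n (of_real x)) \<longlonglongrightarrow> f (of_real x)" by (simp add: LIM_zero_iff)
      then show ?thesis using conv[of "of_real x"] LIMSEQ_unique by auto
    qed
  qed
  then show ?thesis using conv[OF l] by simp
qed

section \<open>Approximation by piecewise constant coefficients\<close>

lemma frozen_flow_add:
  assumes "norm v = 1" shows "frozen_flow h v l (frozen_flow h' v l w) = frozen_flow (h + h') v l w"
  unfolding frozen_flow_def[of h] proj_frozen_flow[OF assms] cmul_cmul
  by (simp add: frozen_flow_def exp_add[symmetric] algebra_simps)

lemma frozen_flow_0: "frozen_flow 0 v l w = w"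
  by (simp add: frozen_flow_def cmul_one proj_sum)

lemma norm_e3 [simp]: "norm e3 = 1"
proof -
  have "(norm e3)\<^sup>2 = 1\<^sup>2" unfolding norm_vec3_power2 by (simp add: e3_def)
  then show ?thesis by (rule power2_eq_imp_eq) auto
qed

lemma proj_e3: "proj_plus e3 w = (fst w, 0)" "proj_minus e3 w = (0, snd w)"
  by (simp_all add: proj_plus_def proj_minus_def pauli_def e3_def prod_eq_iff scaleR_conv_of_real)

text \<open>On each step of length \<open>h\<close> the coefficient is frozen at its value at the
  left end. The starting vector at \<open>A\<close> is the limit of exp(i l x) \<phi> as x tends to
  -\<infinity>, for real l.\<close>

fun piecewise_flow :: "(real \<Rightarrow> real^3) \<Rightarrow> real \<Rightarrow> real \<Rightarrow> complex \<Rightarrow> nat \<Rightarrow> complex \<times> complex" where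
  "piecewise_flow m A h l 0 = (0, 1)"
| "piecewise_flow m A h l (Suc k) = frozen_flow h (m (A + real k * h)) l (piecewise_flow m A h l k)"

lemma piecewise_flow_holomorphic:
  "(\<lambda>l. fst (piecewise_flow m A h l k)) holomorphic_on S \<and> (\<lambda>l. snd (piecewise_flow m A h l k)) holomorphic_on S"
proof (induction k)
  case (Suc k)
  then show ?case
    by (auto simp: frozen_flow_def cmul_def proj_plus_def proj_minus_def pauli_def scaleR_conv_of_real
        intro!: holomorphic_intros)
qed auto

lemma norm_piecewise_flow_le_1:
  assumes "\<And>x. norm (m x) = 1" "Im l \<ge> 0" "h \<ge> 0"
  shows "norm (piecewise_flow m A h l k) \<le> 1"
proof (induction k)
  case (Suc k)
  show ?case unfolding piecewise_flow.simps
    by (rule order_trans[OF norm_frozen_flow_le[OF assms(1) assms(2,3)] Suc.IH])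
qed simp

text \<open>Each step shrinks the component along \<open>+m\<close> and fixes the one along \<open>-m\<close>; switching to the next
  frozen value of \<open>m\<close> costs half the variation of \<open>m\<close>, uniformly in \<open>l\<close>.\<close>
lemma piecewise_flow_projections:
  assumes unit: "\<And>x. norm (m x) = 1" and l: "Im l \<ge> 0" and h: "h \<ge> 0"
    and var: "\<And>s t. s \<le> t \<Longrightarrow> norm (m t - m s) \<le> v t - v s" and e3: "\<And>t. norm (m t - e3) \<le> v t"
  shows "norm (proj_plus (m (A + real k * h)) (piecewise_flow m A h l k)) \<le> v (A + real k * h) / 2 \<and>
         norm (proj_minus (m (A + real k * h)) (piecewise_flow m A h l k)) \<ge> 1 - v (A + real k * h) / 2"
proof (induction k)
  case 0
  have "norm (proj_plus (m A) (0, 1) - proj_plus e3 (0, 1)) \<le> v A / 2"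
    "norm (proj_minus (m A) (0, 1) - proj_minus e3 (0, 1)) \<le> v A / 2"
    unfolding norm_proj_plus_diff_left norm_proj_minus_diff_left using e3[of A] by auto
  then have "norm (proj_plus (m A) (0, 1)) \<le> v A / 2" "norm ((0, 1) - proj_minus (m A) (0, 1)) \<le> v A / 2"
    by (simp_all add: proj_e3 norm_minus_commute zero_prod_def[symmetric])
  moreover have "1 \<le> norm (proj_minus (m A) (0, 1)) + norm ((0, 1) - proj_minus (m A) (0, 1))"
    using norm_triangle_sub[of "(0, 1) :: complex \<times> complex" "proj_minus (m A) (0, 1)"] by simp
  ultimately show ?case by auto
next
  case (Suc k)
  let ?x = "A + real k * h" and ?y = "A + real (Suc k) * h"
  let ?w = "piecewise_flow m A h l k" and ?w' = "piecewise_flow m A h l (Suc k)"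
  have w': "norm ?w' \<le> 1" by (rule norm_piecewise_flow_le_1[where m = m, OF unit l h])
  have d: "norm (m ?y - m ?x) * norm ?w' / 2 \<le> (v ?y - v ?x) / 2"
  proof -
    have "norm (m ?y - m ?x) * norm ?w' \<le> norm (m ?y - m ?x) * 1" by (rule mult_left_mono[OF w']) simp
    also have "\<dots> \<le> v ?y - v ?x" using var[of ?x ?y] h by (simp add: algebra_simps)
    finally show ?thesis by simp
  qed
  have "norm (proj_plus (m ?x) ?w') \<le> norm (proj_plus (m ?x) ?w)"
    using norm_exp_le_1_half_plane[OF l h]
    by (simp add: proj_frozen_flow[OF unit] norm_cmul mult_left_le_one_le)
  moreover have "norm (proj_minus (m ?x) ?w') = norm (proj_minus (m ?x) ?w)"
    by (simp add: proj_frozen_flow[OF unit])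
  moreover have "norm (proj_plus (m ?y) ?w') \<le> norm (proj_plus (m ?x) ?w') + norm (m ?y - m ?x) * norm ?w' / 2"
    using norm_triangle_sub[of "proj_plus (m ?y) ?w'" "proj_plus (m ?x) ?w'"] unfolding norm_proj_plus_diff_left .
  moreover have "norm (proj_minus (m ?x) ?w') \<le> norm (proj_minus (m ?y) ?w') + norm (m ?y - m ?x) * norm ?w' / 2"
    using norm_triangle_sub[of "proj_minus (m ?x) ?w'" "proj_minus (m ?y) ?w'"]
    unfolding norm_proj_minus_diff_left norm_minus_commute[of "m ?x"] .
  ultimately show ?case using Suc d by auto
qed

text \<open>Exchanging the axis \<open>m x\<close> for \<open>e3\<close> costs a further
  \<open>v x / 2\<close>, which doubles the bound on the projections.\<close>

lemma piecewise_flow_components: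
  assumes unit: "\<And>x. norm (m x) = 1" and l: "Im l \<ge> 0" and h: "h \<ge> 0"
    and var: "\<And>s t. s \<le> t \<Longrightarrow> norm (m t - m s) \<le> v t - v s" and e3: "\<And>t. norm (m t - e3) \<le> v t"
    and x: "x = A + real k * h"
  shows "norm (fst (piecewise_flow m A h l k)) \<le> v x" "norm (snd (piecewise_flow m A h l k)) \<ge> 1 - v x"
proof -
  let ?w = "piecewise_flow m A h l k"
  have w: "norm ?w \<le> 1" by (rule norm_piecewise_flow_le_1[where m = m, OF unit l h])
  have "norm (e3 - m x) * norm ?w \<le> norm (e3 - m x) * 1" by (rule mult_left_mono[OF w]) simp
  then have d: "norm (e3 - m x) * norm ?w / 2 \<le> v x / 2" using e3[of x] by (simp add: norm_minus_commute)
  have "norm (proj_plus (m x) ?w) \<le> v x / 2" "norm (proj_minus (m x) ?w) \<ge> 1 - v x / 2"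
    using piecewise_flow_projections[where m = m and v = v and A = A and k = k, OF unit l h var e3] unfolding x by auto
  moreover have "norm (proj_plus e3 ?w) \<le> norm (proj_plus (m x) ?w) + norm (e3 - m x) * norm ?w / 2"
    using norm_triangle_sub[of "proj_plus e3 ?w" "proj_plus (m x) ?w"] unfolding norm_proj_plus_diff_left .
  moreover have "norm (proj_minus (m x) ?w) \<le> norm (proj_minus e3 ?w) + norm (e3 - m x) * norm ?w / 2"
    using norm_triangle_sub[of "proj_minus (m x) ?w" "proj_minus e3 ?w"]
    unfolding norm_proj_minus_diff_left norm_minus_commute[of "m x"] .
  moreover have "norm (proj_plus e3 ?w) = norm (fst ?w)" "norm (proj_minus e3 ?w) = norm (snd ?w)"
    by (simp_all add: proj_e3)
  ultimately show "norm (fst ?w) \<le> v x" "norm (snd ?w) \<ge> 1 - v x" using d by auto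
qed

lemma frozen_flow_pullback_has_integral:
  fixes l :: real
  assumes v: "norm v = 1" and st: "s \<le> t"
    and W: "\<And>x. (W has_vector_derivative cmul (2 * \<i> * of_real l) (proj_plus (m x) (W x))) (at x)"
    and W1: "\<And>x. norm (W x) = 1"
  obtains G' where "(G' has_integral frozen_flow (- t) v (of_real l) (W t) - frozen_flow (- s) v (of_real l) (W s)) {s..t}"
    "\<And>x. norm (G' x) = \<bar>l\<bar> * norm (m x - v)"
proof -
  have "\<exists>d. ((\<lambda>s. frozen_flow (- s) v (of_real l) (W s)) has_vector_derivative d) (at x) \<and> norm d = \<bar>l\<bar> * norm (m x - v)" for x
    by (rule frozen_flow_pullback_derivative[where m = m and W = W and t = x, OF v W]) (auto simp: W1)
  then obtain G' where G': "\<And>x. ((\<lambda>s. frozen_flow (- s) v (of_real l) (W s)) has_vector_derivative G' x) (at x)"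
    "\<And>x. norm (G' x) = \<bar>l\<bar> * norm (m x - v)" by metis
  have "(G' has_integral frozen_flow (- t) v (of_real l) (W t) - frozen_flow (- s) v (of_real l) (W s)) {s..t}"
    by (rule fundamental_theorem_of_calculus[OF st]) (auto intro: has_vector_derivative_at_within G'(1))
  with G'(2) show ?thesis using that by blast
qed

lemma frozen_flow_step_error:
  fixes l :: real
  assumes v: "norm v = 1" and st: "s \<le> t"
    and W: "\<And>x. (W has_vector_derivative cmul (2 * \<i> * of_real l) (proj_plus (m x) (W x))) (at x)"
    and W1: "\<And>x. norm (W x) = 1" and close: "\<And>x. x \<in> {s..t} \<Longrightarrow> norm (m x - v) \<le> d" and d: "d \<ge> 0"
  shows "norm (W t - frozen_flow (t - s) v (of_real l) (W s)) \<le> \<bar>l\<bar> * d * (t - s)"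
proof -
  obtain G' where G': "(G' has_integral frozen_flow (- t) v (of_real l) (W t) - frozen_flow (- s) v (of_real l) (W s)) {s..t}"
    "\<And>x. norm (G' x) = \<bar>l\<bar> * norm (m x - v)"
    using frozen_flow_pullback_has_integral[where m = m and W = W, OF v st W W1] by blast
  have "norm (frozen_flow (- t) v (of_real l) (W t) - frozen_flow (- s) v (of_real l) (W s)) \<le> (\<bar>l\<bar> * d) * measure lborel {s..t}"
    using d close by (intro has_integral_bound_real[OF _ _ G'(1), of _ "{}"]) (auto simp: G'(2) mult_left_mono)
  moreover have "W t - frozen_flow (t - s) v (of_real l) (W s) =
      frozen_flow t v (of_real l) (frozen_flow (- t) v (of_real l) (W t) - frozen_flow (- s) v (of_real l) (W s))"
    unfolding frozen_flow_diff frozen_flow_add[OF v] by (simp add: frozen_flow_0)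
  ultimately show ?thesis using st by (simp add: norm_frozen_flow_real[OF v])
qed

text \<open>The same comparison with the vector \<open>e3\<close> on the unbounded interval
  (-\<infinity>, t]: the speed of the pullback is integrable, its limit is (0, 1), and the flow
  frozen at \<open>e3\<close> fixes (0, 1).\<close>

lemma frozen_flow_tail_error:
  fixes l :: real
  assumes W: "\<And>x. (W has_vector_derivative cmul (2 * \<i> * of_real l) (proj_plus (m x) (W x))) (at x)"
    and W1: "\<And>x. norm (W x) = 1"
    and asym: "((\<lambda>t. frozen_flow (- t) e3 (of_real l) (W t)) \<longlongrightarrow> (0, 1)) at_bot"
    and int: "integrable lborel (\<lambda>x. norm (m x - e3))"
  shows "norm (W t - (0, 1)) \<le> \<bar>l\<bar> * lower_integral (\<lambda>x. norm (m x - e3)) t"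
proof -
  let ?G = "\<lambda>t. frozen_flow (- t) e3 (of_real l) (W t)"
  let ?U = "lower_integral (\<lambda>x. norm (m x - e3))"
  have li: "lower_integral (\<lambda>x. \<bar>l\<bar> * norm (m x - e3)) x = \<bar>l\<bar> * ?U x" for x
    unfolding lower_integral_def by (rule set_integral_mult_right)
  have "norm (?G t - ?G s) \<le> \<bar>l\<bar> * ?U t - \<bar>l\<bar> * ?U s" if st: "s \<le> t" for s
  proof -
    obtain G' where G': "(G' has_integral ?G t - ?G s) {s..t}"
      "\<And>x. norm (G' x) = \<bar>l\<bar> * norm (m x - e3)"
      using frozen_flow_pullback_has_integral[where m = m and W = W, OF norm_e3 st W W1] by blast
    show ?thesis
      using norm_has_integral_le_lower_integral[OF _ st G'(1), of "\<lambda>x. \<bar>l\<bar> * norm (m x - e3)"] int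
      by (simp add: G'(2) li)
  qed
  then have "\<forall>\<^sub>F s in at_bot. norm (?G t - ?G s) \<le> \<bar>l\<bar> * ?U t - \<bar>l\<bar> * ?U s"
    by (auto simp: eventually_at_bot_linorder)
  moreover have "((\<lambda>s. norm (?G t - ?G s)) \<longlongrightarrow> norm (?G t - (0, 1))) at_bot"
    by (intro tendsto_intros asym)
  moreover have "((\<lambda>s. \<bar>l\<bar> * ?U t - \<bar>l\<bar> * ?U s) \<longlongrightarrow> \<bar>l\<bar> * ?U t - \<bar>l\<bar> * 0) at_bot"
    by (intro tendsto_intros lower_integral_at_bot int)
  ultimately have "norm (?G t - (0, 1)) \<le> \<bar>l\<bar> * ?U t - \<bar>l\<bar> * 0"
    by (intro tendsto_le[of at_bot]) auto
  moreover have "W t - (0, 1) = frozen_flow t e3 (of_real l) (?G t - (0, 1))"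
    unfolding frozen_flow_diff frozen_flow_add[OF norm_e3]
    by (simp add: frozen_flow_0, simp add: frozen_flow_def proj_e3 cmul_def)
  ultimately show ?thesis by (simp add: norm_frozen_flow_real)
qed

text \<open>For real \<open>l\<close> each step is an isometry, so earlier errors are not amplified
  and the local errors simply add up.\<close>

lemma piecewise_flow_error:
  fixes l :: real
  assumes unit: "\<And>x. norm (m x) = 1" and h: "h \<ge> 0" and d: "d \<ge> 0"
    and W: "\<And>x. (W has_vector_derivative cmul (2 * \<i> * of_real l) (proj_plus (m x) (W x))) (at x)"
    and W1: "\<And>x. norm (W x) = 1"
    and close: "\<And>j x. j < k \<Longrightarrow> x \<in> {A + real j * h..A + real (Suc j) * h} \<Longrightarrow> norm (m x - m (A + real j * h)) \<le> d"
  shows "norm (W (A + real k * h) - piecewise_flow m A h (of_real l) k) \<le> norm (W A - (0, 1)) + \<bar>l\<bar> * d * (real k * h)"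
  using close
proof (induction k)
  case (Suc k)
  let ?x = "A + real k * h" and ?y = "A + real (Suc k) * h"
  have xy: "?x \<le> ?y" "?y - ?x = h" using h by (auto simp: algebra_simps)
  have "norm (W ?y - frozen_flow (?y - ?x) (m ?x) (of_real l) (W ?x)) \<le> \<bar>l\<bar> * d * (?y - ?x)"
    by (rule frozen_flow_step_error[where m = m and W = W, OF unit xy(1) W W1 Suc.prems[of k] d]) auto
  moreover have "norm (frozen_flow h (m ?x) (of_real l) (W ?x) - piecewise_flow m A h (of_real l) (Suc k)) \<le> norm (W A - (0, 1)) + \<bar>l\<bar> * d * (real k * h)"
    unfolding piecewise_flow.simps frozen_flow_diff[symmetric] norm_frozen_flow_real[OF unit] using Suc by auto
  moreover have "norm (W ?y - piecewise_flow m A h (of_real l) (Suc k)) \<le> norm (W ?y - frozen_flow h (m ?x) (of_real l) (W ?x))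
     + norm (frozen_flow h (m ?x) (of_real l) (W ?x) - piecewise_flow m A h (of_real l) (Suc k))"
    using norm_triangle_ineq[of "W ?y - frozen_flow h (m ?x) (of_real l) (W ?x)" "frozen_flow h (m ?x) (of_real l) (W ?x) - piecewise_flow m A h (of_real l) (Suc k)"] by simp
  moreover have "\<bar>l\<bar> * d * (real (Suc k) * h) = \<bar>l\<bar> * d * (real k * h) + \<bar>l\<bar> * d * h" by (simp add: algebra_simps)
  ultimately show ?case unfolding xy(2) by linarith
qed simp

text \<open>Half of the error comes from starting at a finite \<open>A\<close>, half from freezing
  \<open>m\<close> on [A, x]. Both are proportional to |l|, and one choice of \<open>A\<close>,
  \<open>h\<close> and \<open>k\<close> serves all real l.\<close>

lemma piecewise_flow_approximates:
  assumes unit: "\<And>x. norm (m x) = 1" and cont: "continuous_on UNIV m"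
    and int: "integrable lborel (\<lambda>x. norm (m x - e3))"
    and W: "\<And>l x. (W l has_vector_derivative cmul (2 * \<i> * of_real l) (proj_plus (m x) (W l x))) (at x)"
    and W1: "\<And>l x. norm (W l x) = 1"
    and asym: "\<And>l. ((\<lambda>t. frozen_flow (- t) e3 (of_real l) (W l t)) \<longlongrightarrow> (0, 1)) at_bot"
    and e: "e > 0"
  obtains A h k where "h \<ge> 0" "x = A + real k * h"
    "\<And>l::real. norm (piecewise_flow m A h (of_real l) k - W l x) \<le> e * \<bar>l\<bar>"
proof -
  let ?U = "lower_integral (\<lambda>x. norm (m x - e3))"
  have "\<forall>\<^sub>F t in at_bot. ?U t < e / 2"
    using order_tendstoD(2)[OF lower_integral_at_bot[OF int], of "e / 2"] e by simp
  then obtain A where A: "A \<le> x" "?U A < e / 2"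
    unfolding eventually_at_bot_linorder by (metis min.cobounded1 min.cobounded2)
  \<comment> \<open>Freezing errors accumulate to \<open>d * (x - A)\<close> times |l|; the summand
    2 covers \<open>A = x\<close>.\<close>
  define d where "d = e / (2 * (x - A) + 2)"
  have d: "d > 0" "d * (x - A) \<le> e / 2"
    unfolding d_def using e A(1) by (simp_all add: field_simps)
  have "uniformly_continuous_on {A..x} m"
    by (intro compact_uniformly_continuous continuous_on_subset[OF cont]) auto
  then obtain r where r: "r > 0" "\<And>s t. s \<in> {A..x} \<Longrightarrow> t \<in> {A..x} \<Longrightarrow> dist s t < r \<Longrightarrow> dist (m s) (m t) < d"
    unfolding uniformly_continuous_on_def using d(1) by metis
  \<comment> \<open>The strict inequality makes the step shorter than \<open>r\<close> and keeps
    \<open>k\<close> positive when \<open>A = x\<close>.\<close>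
  obtain k :: nat where k: "real k > (x - A) / r" using reals_Archimedean2 by blast
  have k0: "real k > 0" using k A(1) r(1) by (smt (verit) divide_nonneg_pos)
  define h where "h = (x - A) / real k"
  have h: "h \<ge> 0" "h < r" "real k * h = x - A"
    using A(1) k k0 r(1) by (auto simp: h_def field_simps)
  have close: "norm (m y - m (A + real j * h)) \<le> d" if "j < k" "y \<in> {A + real j * h..A + real (Suc j) * h}" for j y
  proof -
    have "real (Suc j) * h \<le> real k * h" using that(1) h(1) by (intro mult_right_mono) auto
    moreover have "0 \<le> real j * h" using h(1) by simp
    moreover have "real (Suc j) * h = real j * h + h" by (simp add: algebra_simps)
    moreover have "A + real j * h \<le> y" "y \<le> A + real (Suc j) * h" using that(2) by simp_all
    ultimately have "y \<in> {A..x}" "A + real j * h \<in> {A..x}" "dist y (A + real j * h) < r"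
      unfolding atLeastAtMost_iff dist_real_def abs_less_iff using h by linarith+
    from r(2)[OF this] show ?thesis by (simp add: dist_norm)
  qed
  show ?thesis
  proof (rule that[of h A k])
    show "x = A + real k * h" using h(3) by simp
    fix l :: real
    have "norm (W l (A + real k * h) - piecewise_flow m A h (of_real l) k) \<le> norm (W l A - (0, 1)) + \<bar>l\<bar> * d * (real k * h)"
      by (rule piecewise_flow_error[where m = m and W = "W l", OF unit h(1) less_imp_le[OF d(1)] W W1 close])
    also have "norm (W l A - (0, 1)) \<le> \<bar>l\<bar> * ?U A"
      by (rule frozen_flow_tail_error[where m = m and W = "W l", OF W W1 asym int])
    also have "\<bar>l\<bar> * ?U A \<le> \<bar>l\<bar> * (e / 2)" using A(2) by (intro mult_left_mono) auto
    also have "\<bar>l\<bar> * d * (real k * h) = \<bar>l\<bar> * (d * (x - A))" using h(3) by simp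
    also have "\<dots> \<le> \<bar>l\<bar> * (e / 2)" using d(2) by (intro mult_left_mono) auto
    finally show "norm (piecewise_flow m A h (of_real l) k - W l x) \<le> e * \<bar>l\<bar>"
      using h(3) by (simp add: norm_minus_commute algebra_simps)
  qed (rule h)
qed

text \<open>The piecewise constant flows are entire in \<open>l\<close>, and they converge on the real line at a rate
  linear in \<open>l\<close>. Hence they converge in the whole closed upper half-plane, to the continuation of
  \<open>W\<close>, which therefore inherits their bounds.\<close>
lemma jost_continuation_bounds:
  fixes f1 f2 :: "complex \<Rightarrow> complex"
  assumes unit: "\<And>x. norm (m x) = 1" and cont: "continuous_on UNIV m"
    and int: "integrable lborel (\<lambda>x. norm (m x - e3))"
    and W: "\<And>l x. (W l has_vector_derivative cmul (2 * \<i> * of_real l) (proj_plus (m x) (W l x))) (at x)"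
    and W1: "\<And>l x. norm (W l x) = 1"
    and asym: "\<And>l. ((\<lambda>t. frozen_flow (- t) e3 (of_real l) (W l t)) \<longlongrightarrow> (0, 1)) at_bot"
    and f1: "f1 holomorphic_on {l. Im l > 0}" "continuous_on {l. Im l \<ge> 0} f1"
    and f2: "f2 holomorphic_on {l. Im l > 0}" "continuous_on {l. Im l \<ge> 0} f2"
    and f_W: "\<And>l::real. W l x = (f1 (of_real l), f2 (of_real l))"
    and var: "\<And>s t. s \<le> t \<Longrightarrow> norm (m t - m s) \<le> v t - v s" and e3: "\<And>t. norm (m t - e3) \<le> v t"
    and l: "Im l \<ge> 0"
  shows "norm (f1 l) \<le> 1" "norm (f2 l) \<le> 1" "norm (f1 l) \<le> v x" "norm (f2 l) \<ge> 1 - v x"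
proof -
  have nf: "norm (fst w) \<le> norm w" and ns: "norm (snd w) \<le> norm w" for w :: "complex \<times> complex"
    by (metis norm_fst_le prod.collapse, metis norm_snd_le prod.collapse)
  define e where "e = (\<lambda>n. inverse (real (Suc n)))"
  have "\<exists>A h k. h \<ge> 0 \<and> x = A + real k * h \<and> (\<forall>l::real. norm (piecewise_flow m A h (of_real l) k - W l x) \<le> e n * \<bar>l\<bar>)" for n
    using piecewise_flow_approximates[where m = m and W = W, OF unit cont int W W1 asym, of "e n" x] by (auto simp: e_def) blast
  then obtain A h k where AHK: "\<And>n. h n \<ge> 0" "\<And>n. x = A n + real (k n) * h n"
    "\<And>n l. norm (piecewise_flow m (A n) (h n) (of_real l) (k n) - W l x) \<le> e n * \<bar>l\<bar>" by metis
  define F where "F = (\<lambda>n l. piecewise_flow m (A n) (h n) l (k n))"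
  have F1: "norm (F n l) \<le> 1" if "Im l \<ge> 0" for n l
    unfolding F_def by (rule norm_piecewise_flow_le_1[where m = m, OF unit that AHK(1)])
  have e0: "e \<longlonglongrightarrow> 0" unfolding e_def by (rule LIMSEQ_inverse_real_of_nat)
  have hol: "(\<lambda>l. fst (F n l)) holomorphic_on S" "(\<lambda>l. snd (F n l)) holomorphic_on S" for n S
    unfolding F_def using piecewise_flow_holomorphic by auto
  have lim1: "(\<lambda>n. fst (F n l)) \<longlonglongrightarrow> f1 l"
  proof (rule half_plane_limit[OF hol(1) _ _ f1 _ e0 l])
    show "norm (fst (F n l)) \<le> 1" if "Im l \<ge> 0" for n l
      by (rule order_trans[OF nf F1[OF that]])
    show "norm (fst (F n (of_real x)) - f1 (of_real x)) \<le> e n * \<bar>x\<bar>" for n x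
      using order_trans[OF nf AHK(3)[of n x]] by (simp add: F_def f_W)
  qed (intro holomorphic_on_imp_continuous_on hol)
  have lim2: "(\<lambda>n. snd (F n l)) \<longlonglongrightarrow> f2 l"
  proof (rule half_plane_limit[OF hol(2) _ _ f2 _ e0 l])
    show "norm (snd (F n l)) \<le> 1" if "Im l \<ge> 0" for n l
      by (rule order_trans[OF ns F1[OF that]])
    show "norm (snd (F n (of_real x)) - f2 (of_real x)) \<le> e n * \<bar>x\<bar>" for n x
      using order_trans[OF ns AHK(3)[of n x]] by (simp add: F_def f_W)
  qed (intro holomorphic_on_imp_continuous_on hol)
  have c: "norm (fst (F n l)) \<le> v x" "norm (snd (F n l)) \<ge> 1 - v x" for n
    unfolding F_def using piecewise_flow_components[where m = m and v = v, OF unit l AHK(1) var e3 AHK(2)] by auto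
  show "norm (f1 l) \<le> 1"
    using order_trans[OF nf F1[OF l]] by (intro LIMSEQ_le_const2[OF tendsto_norm[OF lim1]]) auto
  show "norm (f2 l) \<le> 1"
    using order_trans[OF ns F1[OF l]] by (intro LIMSEQ_le_const2[OF tendsto_norm[OF lim2]]) auto
  show "norm (f1 l) \<le> v x" by (rule LIMSEQ_le_const2[OF tendsto_norm[OF lim1]]) (use c in auto)
  show "norm (f2 l) \<ge> 1 - v x" by (rule LIMSEQ_le_const[OF tendsto_norm[OF lim2]]) (use c in auto)
qed

section \<open>Structure of the Jost matrices\<close>

lemma matrix2_mult_nth: "((A :: complex^2^2) ** B) $ i $ j = A $ i $ 1 * B $ 1 $ j + A $ i $ 2 * B $ 2 $ j"
  by (simp add: matrix_matrix_mult_def sum_2)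

lemma mat2_nth:
  "mat2 p q r s $ 1 $ 1 = p" "mat2 p q r s $ 1 $ 2 = q" "mat2 p q r s $ 2 $ 1 = r" "mat2 p q r s $ 2 $ 2 = s"
  by (simp_all add: mat2_def)

lemma msig_nth:
  "msig v $ 1 $ 1 = of_real (v $ 3)" "msig v $ 1 $ 2 = of_real (v $ 1) - \<i> * of_real (v $ 2)"
  "msig v $ 2 $ 1 = of_real (v $ 1) + \<i> * of_real (v $ 2)" "msig v $ 2 $ 2 = - of_real (v $ 3)"
  by (simp_all add: msig_def sigma1_def sigma2_def sigma3_def mat2_nth complex_eq_iff)

lemma bounded_linear_entry: "bounded_linear (\<lambda>A :: complex^2^2. A $ i $ j)"
  using bounded_linear_compose[OF bounded_linear_vec_nth[of j] bounded_linear_vec_nth[of i]] by simp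

lemma column_ode:
  fixes l :: real and X :: "real \<Rightarrow> complex^2^2"
  assumes "((\<lambda>y. X y) has_vector_derivative (cscale (\<i> * of_real l) (msig v ** X x))) (at x)"
  shows "((\<lambda>y. (X y $ 1 $ j, X y $ 2 $ j)) has_vector_derivative cmul (\<i> * of_real l) (pauli v (X x $ 1 $ j, X x $ 2 $ j))) (at x)"
proof -
  have "cmul (\<i> * of_real l) (pauli v (X x $ 1 $ j, X x $ 2 $ j)) =
     (cscale (\<i> * of_real l) (msig v ** X x) $ 1 $ j, cscale (\<i> * of_real l) (msig v ** X x) $ 2 $ j)"
    by (simp add: cmul_def pauli_def cscale_def matrix2_mult_nth msig_nth)
  then show ?thesis
    using bounded_linear.has_vector_derivative[OF bounded_linear_entry[of 1 j] assms]
      bounded_linear.has_vector_derivative[OF bounded_linear_entry[of 2 j] assms]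
    by (simp only: has_vector_derivative_Pair_iff)
qed

text \<open>For real \<open>l\<close> the generator is skew-Hermitian.\<close>

lemma solution_norm_constant:
  fixes l :: real and w :: "real \<Rightarrow> complex \<times> complex"
  assumes ode: "\<And>x. (w has_vector_derivative cmul (\<i> * of_real l) (pauli (m x) (w x))) (at x)"
  shows "norm (w x) = norm (w y)"
proof -
  have orth: "u \<bullet> cmul (\<i> * of_real l) (pauli v u) = 0" for u v
    by (simp add: inner_prod_def cmul_def pauli_def inner_complex_def algebra_simps)
  have "((\<lambda>x. w x \<bullet> w x) has_vector_derivative 0) (at x)" for x
  proof -
    have "((\<lambda>x. w x \<bullet> w x) has_vector_derivative w x \<bullet> cmul (\<i> * of_real l) (pauli (m x) (w x)) + cmul (\<i> * of_real l) (pauli (m x) (w x)) \<bullet> w x) (at x)"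
      using has_derivative_inner[OF ode[of x, unfolded has_vector_derivative_def] ode[of x, unfolded has_vector_derivative_def]]
      unfolding has_vector_derivative_def by (simp add: algebra_simps)
    then show ?thesis by (simp add: orth inner_commute[of _ "w x"])
  qed
  then have "w x \<bullet> w x = w y \<bullet> w y"
    by (intro DERIV_isconst_all[of "\<lambda>x. w x \<bullet> w x"]) (simp add: has_real_derivative_iff_has_vector_derivative)
  then show ?thesis by (simp add: norm_eq_sqrt_inner)
qed

text \<open>Conservation of the norm replaces a uniqueness theorem: a solution whose norm tends to 0
  at one end vanishes identically.\<close>

lemma jost_matrix_structure:
  fixes l :: real and X :: "real \<Rightarrow> complex^2^2"
  assumes ode: "\<And>x. (X has_vector_derivative (cscale (\<i> * of_real l) (msig (m x) ** X x))) (at x)"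
    and asym: "((\<lambda>y. ediag (- l * y) ** X y) \<longlongrightarrow> mat 1) F" and F: "F \<noteq> bot"
  shows "X x $ 1 $ 2 = - cnj (X x $ 2 $ 1)" "X x $ 2 $ 2 = cnj (X x $ 1 $ 1)"
    "(norm (X x $ 1 $ 1))\<^sup>2 + (norm (X x $ 2 $ 1))\<^sup>2 = 1"
proof -
  let ?e = "\<lambda>y. exp (\<i> * of_real (l * y))"
  have ent: "((\<lambda>y. (ediag (- l * y) ** X y) $ i $ j) \<longlongrightarrow> mat 1 $ i $ j) F" for i j
    by (intro tendsto_vec_nth asym)
  have lim: "((\<lambda>y. ?e (- y) * X y $ 1 $ 1) \<longlongrightarrow> 1) F" "((\<lambda>y. ?e y * X y $ 2 $ 1) \<longlongrightarrow> 0) F"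
     "((\<lambda>y. ?e (- y) * X y $ 1 $ 2) \<longlongrightarrow> 0) F" "((\<lambda>y. ?e y * X y $ 2 $ 2) \<longlongrightarrow> 1) F"
    using ent[of 1 1] ent[of 2 1] ent[of 1 2] ent[of 2 2]
    by (simp_all add: matrix2_mult_nth ediag_def mat2_nth mat_def)
  have ne: "norm (?e y) = 1" for y by simp
  have lim_norm: "((\<lambda>y. norm (p y, q y)) \<longlongrightarrow> norm (c, d)) F"
    if "((\<lambda>y. ?e (- y) * p y) \<longlongrightarrow> c) F" "((\<lambda>y. ?e y * q y) \<longlongrightarrow> d) F" for p q :: "real \<Rightarrow> complex" and c d
  proof -
    have "((\<lambda>y. norm (?e (- y) * p y, ?e y * q y)) \<longlongrightarrow> norm (c, d)) F"
      by (intro tendsto_intros that)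
    moreover have "norm (?e (- y) * p y, ?e y * q y) = norm (p y, q y)" for y
      unfolding norm_Pair norm_mult ne by simp
    ultimately show ?thesis by simp
  qed
  have const: "norm (w x) = L" if "\<And>x. (w has_vector_derivative cmul (\<i> * of_real l) (pauli (m x) (w x))) (at x)"
     and "((\<lambda>y. norm (w y)) \<longlongrightarrow> L) F" for w :: "real \<Rightarrow> complex \<times> complex" and L
  proof -
    have "(\<lambda>y. norm (w y)) = (\<lambda>y. norm (w x))" using solution_norm_constant[of w l m, OF that(1)] by blast
    then have "((\<lambda>y. norm (w x)) \<longlongrightarrow> L) F" using that(2) by simp
    then show ?thesis using tendsto_unique[OF F _ tendsto_const] by metis
  qed
  have col: "((\<lambda>y. (X y $ 1 $ j, X y $ 2 $ j)) has_vector_derivative cmul (\<i> * of_real l) (pauli (m x) (X x $ 1 $ j, X x $ 2 $ j))) (at x)" for j x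
    by (rule column_ode[OF ode])
  have "norm (X x $ 1 $ 1, X x $ 2 $ 1) = norm (1::complex, 0::complex)"
    by (rule const[OF col lim_norm[OF lim(1,2)]])
  then have "(norm (X x $ 1 $ 1, X x $ 2 $ 1))\<^sup>2 = 1" by simp
  then show "(norm (X x $ 1 $ 1))\<^sup>2 + (norm (X x $ 2 $ 1))\<^sup>2 = 1" by (simp add: norm_prod_power2)
  \<comment> \<open>The map (p, q) to (- cnj q, cnj p) commutes with i l (v \<cdot> \<sigma>), so it
    sends solutions to solutions. \<open>D\<close> is the second column minus the image of the
    first, and its norm tends to 0.\<close>
  define D where "D = (\<lambda>y. (X y $ 1 $ 2 + cnj (X y $ 2 $ 1), X y $ 2 $ 2 - cnj (X y $ 1 $ 1)))"
  have "(D has_vector_derivative cmul (\<i> * of_real l) (pauli (m y) (D y))) (at y)" for y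
  proof -
    note c1 = col[where j = 1 and x = y, unfolded cmul_def has_vector_derivative_Pair_iff, THEN conjunct1]
      col[where j = 1 and x = y, unfolded cmul_def has_vector_derivative_Pair_iff, THEN conjunct2]
    note c2 = col[where j = 2 and x = y, unfolded cmul_def has_vector_derivative_Pair_iff, THEN conjunct1]
      col[where j = 2 and x = y, unfolded cmul_def has_vector_derivative_Pair_iff, THEN conjunct2]
    show ?thesis
      unfolding D_def cmul_def has_vector_derivative_Pair_iff
      using has_vector_derivative_add[OF c2(1) bounded_linear.has_vector_derivative[OF bounded_linear_cnj c1(2)]]
        has_vector_derivative_diff[OF c2(2) bounded_linear.has_vector_derivative[OF bounded_linear_cnj c1(1)]]
      by (simp add: pauli_def algebra_simps)
  qed
  moreover have "((\<lambda>y. norm (D y)) \<longlongrightarrow> norm (0 + cnj 0, 1 - cnj (1::complex))) F"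
    unfolding D_def
  proof (rule lim_norm)
    have "((\<lambda>y. ?e (- y) * X y $ 1 $ 2 + cnj (?e y * X y $ 2 $ 1)) \<longlongrightarrow> 0 + cnj 0) F"
      by (intro tendsto_add lim tendsto_cnj)
    then show "((\<lambda>y. ?e (- y) * (X y $ 1 $ 2 + cnj (X y $ 2 $ 1))) \<longlongrightarrow> 0 + cnj 0) F"
      by (simp add: distrib_left exp_cnj)
    have "((\<lambda>y. ?e y * X y $ 2 $ 2 - cnj (?e (- y) * X y $ 1 $ 1)) \<longlongrightarrow> 1 - cnj 1) F"
      by (intro tendsto_diff lim tendsto_cnj)
    then show "((\<lambda>y. ?e y * (X y $ 2 $ 2 - cnj (X y $ 1 $ 1))) \<longlongrightarrow> 1 - cnj 1) F"
      by (simp add: right_diff_distrib exp_cnj)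
  qed
  ultimately have "norm (D x) = norm (0 + cnj 0, 1 - cnj (1::complex))" by (rule const)
  then have "D x = 0" by (simp add: zero_prod_def[symmetric])
  then show "X x $ 1 $ 2 = - cnj (X x $ 2 $ 1)" "X x $ 2 $ 2 = cnj (X x $ 1 $ 1)"
    by (simp_all add: D_def zero_prod_def add_eq_0_iff2)
qed

section \<open>Continuity, translations of the line, and decay of transforms\<close>

lemma abs_continuous_imp_continuous:
  assumes "abs_continuous_on UNIV (f :: real \<Rightarrow> 'a::real_normed_vector)" shows "continuous_on UNIV f"
  unfolding continuous_on_iff
proof (intro ballI allI impI)
  fix x e :: real assume "e > 0"
  with assms obtain d where d: "d > 0" "\<forall>(n::nat) (l::nat \<Rightarrow> real) u. (\<forall>k<n. l k \<le> u k \<and> {l k..u k} \<subseteq> UNIV) \<and>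
        (\<forall>j<n. \<forall>k<n. j \<noteq> k \<longrightarrow> {l j<..<u j} \<inter> {l k<..<u k} = {}) \<and>
        (\<Sum>k<n. u k - l k) < d \<longrightarrow> (\<Sum>k<n. norm (f (u k) - f (l k))) < e"
    unfolding abs_continuous_on_def by blast
  have *: "norm (f t - f s) < e" if "s \<le> t" "t - s < d" for s t
    using d(2)[rule_format, of 1 "\<lambda>_. s" "\<lambda>_. t"] that by simp
  show "\<exists>d>0. \<forall>x'\<in>UNIV. dist x' x < d \<longrightarrow> dist (f x') (f x) < e"
  proof (intro exI[of _ d] conjI d(1) ballI impI)
    fix x' assume "dist x' x < d"
    then show "dist (f x') (f x) < e"
      using *[of x x'] *[of x' x] by (cases "x \<le> x'") (auto simp: dist_norm dist_real_def norm_minus_commute)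
  qed
qed

lemma set_integrable_shift:
  fixes f :: "real \<Rightarrow> 'a::{banach, second_countable_topology}"
  shows "set_integrable lborel {z..} f \<longleftrightarrow> set_integrable lborel {0..} (\<lambda>s. f (z + s))"
proof -
  have "integrable lborel (\<lambda>x. indicator {z..} (z + 1 * x) *\<^sub>R f (z + 1 * x)) \<longleftrightarrow> integrable lborel (\<lambda>x. indicator {z..} x *\<^sub>R f x)"
    by (rule lborel_integrable_real_affine_iff) simp
  then show ?thesis unfolding set_integrable_def by (simp add: indicator_def)
qed

lemma set_integral_shift:
  fixes f :: "real \<Rightarrow> 'a::{banach, second_countable_topology}"
  shows "(LINT u:{z..}|lborel. f u) = (LINT s:{0..}|lborel. f (z + s))"
  using lborel_integral_real_affine[of 1 "\<lambda>u. indicator {z..} u *\<^sub>R f u" z]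
  unfolding set_lebesgue_integral_def by (simp add: indicator_def)

lemma AE_lborel_shift:
  assumes "AE t in lborel. P (z + t)" shows "AE y in lborel. P (y :: real)"
proof -
  obtain N where N: "{t. \<not> P (z + t)} \<subseteq> N" "N \<in> null_sets lborel"
    using assms by (auto elim: AE_E simp: null_sets_def)
  have "AE t in lborel. t \<notin> N" using N(2) by (rule AE_not_in)
  then have "AE y in lborel. - z + 1 * y \<notin> N"
    using N(2) by (intro AE_borel_affine) (auto simp: null_sets_def)
  then show ?thesis by eventually_elim (use N(1) in force)
qed

text \<open>By Riemann-Lebesgue the transform decays and the constant does not, so the two vanish
  separately.\<close>

lemma half_fourier_const_zero:
  assumes k: "integrable lborel k" and zero: "\<And>l::real. c + half_fourier k (of_real l) = 0"
  shows "c = 0" "AE t in lborel. t \<ge> 0 \<longrightarrow> k t = 0"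
proof -
  show c: "c = 0"
  proof (rule ccontr)
    assume "c \<noteq> 0"
    then obtain A where "\<forall>l. Im l \<ge> 0 \<longrightarrow> norm l \<ge> A \<longrightarrow> norm (half_fourier k l) < norm c"
      using half_fourier_at_infinity[OF k, of "norm c"] by auto
    then have "norm (half_fourier k (of_real \<bar>A\<bar>)) < norm c" by simp
    moreover have "half_fourier k (of_real \<bar>A\<bar>) = - c" using zero[of "\<bar>A\<bar>"] by (simp add: add_eq_0_iff)
    ultimately show False by simp
  qed
  show "AE t in lborel. t \<ge> 0 \<longrightarrow> k t = 0"
    by (rule half_fourier_zero_imp_AE_zero[OF k]) (use zero c in simp)
qed

lemma cnj_half_fourier: "cnj (half_fourier k (of_real l)) = half_fourier (\<lambda>t. cnj (k t)) (- of_real l)"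
  unfolding half_fourier_def set_lebesgue_integral_def Bochner_Integration.integral_cnj[symmetric]
  by (rule Bochner_Integration.integral_cong) (auto simp: exp_cnj)

lemma fourier_at_infinity:
  assumes r: "integrable lborel r" and e: "e > 0"
  shows "\<exists>B. \<forall>x\<ge>B. norm (\<integral>w. exp (- \<i> * of_real (x * w)) * r w \<partial>lborel) < e"
proof -
  have rm: "integrable lborel (\<lambda>t. r (- t))" using lborel_integrable_real_affine[OF r, of "-1" 0] by simp
  obtain A where A: "\<forall>l. Im l \<ge> 0 \<longrightarrow> norm l \<ge> A \<longrightarrow> norm (half_fourier r l) < e / 2"
    using half_fourier_at_infinity[OF r, of "e / 2"] e by auto
  obtain B where B: "\<forall>l. Im l \<ge> 0 \<longrightarrow> norm l \<ge> B \<longrightarrow> norm (half_fourier (\<lambda>t. r (- t)) l) < e / 2"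
    using half_fourier_at_infinity[OF rm, of "e / 2"] e by auto
  have "norm (\<integral>w. exp (- \<i> * of_real (x * w)) * r w \<partial>lborel) < e" if "x \<ge> max A B" for x
  proof -
    have "norm (half_fourier r (- of_real x)) < e / 2" "norm (half_fourier (\<lambda>t. r (- t)) (of_real x)) < e / 2"
      using A B that by auto
    then show ?thesis
      using norm_triangle_ineq[of "half_fourier r (- of_real x)" "half_fourier (\<lambda>t. r (- t)) (of_real x)"]
      unfolding fourier_split_half_fourier[OF r] by linarith
  qed
  then show ?thesis by blast
qed

text \<open>The kernel translated so that its support starts at 0. Cutting it off makes it
  integrable on the whole line, whatever values \<open>k\<close> takes to the left of
  \<open>x\<close>.\<close>

definition half_entry :: "real \<Rightarrow> (real \<Rightarrow> complex^2^2) \<Rightarrow> 2 \<Rightarrow> 2 \<Rightarrow> real \<Rightarrow> complex" where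
  "half_entry x k i j t = indicator {0..} t *\<^sub>R (k (x + t) $ i $ j)"

lemma half_entry_integrable:
  assumes "set_integrable lborel {x..} k"
  shows "integrable lborel (half_entry x k i j)"
proof -
  have "set_integrable lborel {0..} (\<lambda>t. k (x + t))" using assms by (simp only: set_integrable_shift[of x])
  then have "integrable lborel (\<lambda>t. (indicator {0..} t *\<^sub>R k (x + t)) $ i $ j)"
    unfolding set_integrable_def by (rule integrable_bounded_linear[OF bounded_linear_entry])
  then show ?thesis by (simp add: half_entry_def[abs_def])
qed

lemma integrable_entries:
  fixes M :: "real \<Rightarrow> complex^2^2"
  assumes "\<And>i j. integrable lborel (\<lambda>t. M t $ i $ j)"
  shows "integrable lborel M"
proof -
  have lin: "bounded_linear (\<lambda>c::complex. axis i (axis j c) :: complex^2^2)" for i j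
    unfolding linear_conv_bounded_linear[symmetric]
    by (rule linearI) (auto simp: vec_eq_iff axis_def)
  have "integrable lborel (\<lambda>t. \<Sum>i\<in>UNIV. \<Sum>j\<in>UNIV. axis i (axis j (M t $ i $ j)))"
    by (intro Bochner_Integration.integrable_sum integrable_bounded_linear[OF lin] assms)
  also have "(\<lambda>t. \<Sum>i\<in>UNIV. \<Sum>j\<in>UNIV. axis i (axis j (M t $ i $ j))) = M"
    by (simp add: fun_eq_iff vec_eq_iff forall_2 sum_2 axis_def)
  finally show ?thesis .
qed

text \<open>Substituting y = x + t extracts the phase exp(i l x) or exp(-i l x). The first column
  then continues to the upper half-plane, the second to the lower one.\<close>

lemma triangular_entries:
  fixes P :: "real \<Rightarrow> complex^2^2" and h :: "complex^2^2" and l :: real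
  assumes k: "set_integrable lborel {x..} k"
    and tri: "\<And>l. P l = h ** ediag (l * x) + (LINT y:{x..}|lborel. k y ** ediag (l * y))"
  shows "exp (- \<i> * of_real (l * x)) * P l $ i $ 1 = h $ i $ 1 + half_fourier (half_entry x k i 1) (of_real l)"
    "exp (\<i> * of_real (l * x)) * P l $ i $ 2 = h $ i $ 2 + half_fourier (half_entry x k i 2) (- of_real l)"
proof -
  define M where "M = (\<lambda>t. indicator {0..} t *\<^sub>R (k (x + t) ** ediag (l * (x + t))))"
  have Mn: "M t $ i $ 1 = exp (\<i> * of_real (l * x)) * (indicator {0..} t *\<^sub>R (exp (\<i> * of_real l * of_real t) * half_entry x k i 1 t))"
    "M t $ i $ 2 = exp (- \<i> * of_real (l * x)) * (indicator {0..} t *\<^sub>R (exp (\<i> * (- of_real l) * of_real t) * half_entry x k i 2 t))" for t i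
    by (auto simp: M_def half_entry_def matrix2_mult_nth ediag_def mat2_nth indicator_def exp_add[symmetric] algebra_simps exp_diff exp_minus divide_inverse)
  have Mint: "integrable lborel (\<lambda>t. M t $ i $ j)" for i j
  proof -
    have "integrable lborel (\<lambda>t. M t $ i $ 1)"
      unfolding Mn using half_fourier_integrable[OF half_entry_integrable[OF k], of "of_real l" i 1]
      by (intro integrable_mult_right) (simp add: set_integrable_def)
    moreover have "integrable lborel (\<lambda>t. M t $ i $ 2)"
      unfolding Mn using half_fourier_integrable[OF half_entry_integrable[OF k], of "- of_real l" i 2]
      by (intro integrable_mult_right) (simp add: set_integrable_def)
    ultimately show ?thesis using exhaust_2[of j] by auto
  qed
  \<comment> \<open>Taking an entry commutes with the integral because the whole matrix function is
    integrable.\<close>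
  have "integrable lborel M" by (rule integrable_entries[OF Mint])
  then have ent: "(\<integral>t. M t \<partial>lborel) $ i $ j = (\<integral>t. M t $ i $ j \<partial>lborel)" for i j
    by (rule integral_bounded_linear[OF bounded_linear_entry, symmetric])
  have int: "(LINT y:{x..}|lborel. k y ** ediag (l * y)) = (\<integral>t. M t \<partial>lborel)"
    by (subst set_integral_shift) (simp add: M_def set_lebesgue_integral_def)
  have i1: "(\<integral>t. M t $ i $ 1 \<partial>lborel) = exp (\<i> * of_real (l * x)) * half_fourier (half_entry x k i 1) (of_real l)"
    unfolding Mn half_fourier_def set_lebesgue_integral_def by (rule integral_mult_right_zero)
  have i2: "(\<integral>t. M t $ i $ 2 \<partial>lborel) = exp (- \<i> * of_real (l * x)) * half_fourier (half_entry x k i 2) (- of_real l)"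
    unfolding Mn half_fourier_def set_lebesgue_integral_def by (rule integral_mult_right_zero)
  have ee: "exp (- \<i> * of_real (l * x)) * exp (\<i> * of_real (l * x)) = 1"
    and ee': "exp (\<i> * of_real (l * x)) * exp (- \<i> * of_real (l * x)) = 1" by (simp_all add: exp_minus)
  have "P l $ i $ 1 = exp (\<i> * of_real (l * x)) * (h $ i $ 1 + half_fourier (half_entry x k i 1) (of_real l))"
    unfolding tri int by (simp add: ent i1 matrix2_mult_nth ediag_def mat2_nth algebra_simps)
  then show "exp (- \<i> * of_real (l * x)) * P l $ i $ 1 = h $ i $ 1 + half_fourier (half_entry x k i 1) (of_real l)"
    by (simp only: mult.assoc[symmetric] ee mult_1)
  have "P l $ i $ 2 = exp (- \<i> * of_real (l * x)) * (h $ i $ 2 + half_fourier (half_entry x k i 2) (- of_real l))"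
    unfolding tri int by (simp add: ent i2 matrix2_mult_nth ediag_def mat2_nth algebra_simps)
  then show "exp (\<i> * of_real (l * x)) * P l $ i $ 2 = h $ i $ 2 + half_fourier (half_entry x k i 2) (- of_real l)"
    by (simp only: mult.assoc[symmetric] ee' mult_1)
qed

text \<open>\<open>S\<close> and \<open>F\<close> represent unit quaternions, hence so does their
  quotient \<open>Tmat a b\<close>. Inverting it expresses the second column of \<open>F\<close> by
  the columns of \<open>S\<close>, and \<open>a\<close> is a determinant of two columns.\<close>

lemma scattering_relations:
  fixes S F :: "complex^2^2"
  assumes S: "S $ 1 $ 2 = - cnj (S $ 2 $ 1)" "S $ 2 $ 2 = cnj (S $ 1 $ 1)" "(norm (S $ 1 $ 1))\<^sup>2 + (norm (S $ 2 $ 1))\<^sup>2 = 1"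
    and F: "F $ 1 $ 2 = - cnj (F $ 2 $ 1)" "F $ 2 $ 2 = cnj (F $ 1 $ 1)" "(norm (F $ 1 $ 1))\<^sup>2 + (norm (F $ 2 $ 1))\<^sup>2 = 1"
    and T: "S = F ** Tmat a b"
  shows "(norm a)\<^sup>2 + (norm b)\<^sup>2 = 1" "a = S $ 1 $ 1 * F $ 2 $ 2 - S $ 2 $ 1 * F $ 1 $ 2"
    "F $ i $ 2 = b * S $ i $ 1 + a * S $ i $ 2"
proof -
  define P Q where "P = F $ 1 $ 1" and "Q = F $ 2 $ 1"
  have p: "S $ 1 $ 1 = a * P - cnj b * cnj Q" and q: "S $ 2 $ 1 = a * Q + cnj b * cnj P"
    unfolding T by (simp_all add: matrix2_mult_nth Tmat_def mat2_nth F P_def Q_def algebra_simps)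
  have PQ: "P * cnj P + Q * cnj Q = 1"
    using arg_cong[OF F(3), of complex_of_real] unfolding P_def Q_def by (simp only: of_real_add complex_norm_square of_real_1)
  have pq: "S $ 1 $ 1 * cnj (S $ 1 $ 1) + S $ 2 $ 1 * cnj (S $ 2 $ 1) = 1"
    using arg_cong[OF S(3), of complex_of_real] by (simp only: of_real_add complex_norm_square of_real_1)
  have "S $ 1 $ 1 * cnj (S $ 1 $ 1) + S $ 2 $ 1 * cnj (S $ 2 $ 1) = (a * cnj a + b * cnj b) * (P * cnj P + Q * cnj Q)"
    unfolding p q by (simp add: algebra_simps)
  then have ab: "a * cnj a + b * cnj b = 1" using PQ pq by simp
  then have "complex_of_real ((norm a)\<^sup>2 + (norm b)\<^sup>2) = 1" by (simp only: of_real_add complex_norm_square)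
  then show "(norm a)\<^sup>2 + (norm b)\<^sup>2 = 1" using of_real_eq_1_iff by blast
  have "S $ 1 $ 1 * F $ 2 $ 2 - S $ 2 $ 1 * F $ 1 $ 2 = a * (P * cnj P + Q * cnj Q)"
    unfolding F p q P_def[symmetric] Q_def[symmetric] by (simp add: algebra_simps)
  then show "a = S $ 1 $ 1 * F $ 2 $ 2 - S $ 2 $ 1 * F $ 1 $ 2" using PQ by simp
  have "b * S $ 1 $ 1 + a * S $ 1 $ 2 = - cnj Q * (a * cnj a + b * cnj b)"
    "b * S $ 2 $ 1 + a * S $ 2 $ 2 = cnj P * (a * cnj a + b * cnj b)"
    unfolding S p q by (simp_all add: algebra_simps)
  then show "F $ i $ 2 = b * S $ i $ 1 + a * S $ i $ 2"
    using ab exhaust_2[of i] by (auto simp: F P_def Q_def)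
qed

text \<open>The symmetry holds for every real l, so Fourier uniqueness transfers it to the kernel,
  and decay separates the kernel from \<open>h\<close>.\<close>

lemma triangular_kernel_structure:
  fixes P k :: "real \<Rightarrow> complex^2^2" and h :: "complex^2^2"
  assumes k: "set_integrable lborel {x..} k"
    and tri: "\<And>l. P l = h ** ediag (l * x) + (LINT y:{x..}|lborel. k y ** ediag (l * y))"
    and P: "\<And>l. P l $ 1 $ 2 = - cnj (P l $ 2 $ 1)" "\<And>l. P l $ 2 $ 2 = cnj (P l $ 1 $ 1)"
  shows "h $ 1 $ 2 = - cnj (h $ 2 $ 1)" "h $ 2 $ 2 = cnj (h $ 1 $ 1)"
    "AE y in lborel. y \<ge> x \<longrightarrow> k y $ 1 $ 2 = - cnj (k y $ 2 $ 1) \<and> k y $ 2 $ 2 = cnj (k y $ 1 $ 1)"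
proof -
  let ?k = "half_entry x k"
  note ki = half_entry_integrable[OF k]
  note e = triangular_entries[OF k tri]
  have c: "cnj (exp (- \<i> * of_real (l * x))) = exp (\<i> * of_real (l * x))" for l by (simp add: exp_cnj)
  have z1: "(h $ 1 $ 2 + cnj (h $ 2 $ 1)) + half_fourier (\<lambda>t. ?k 1 2 t + cnj (?k 2 1 t)) (of_real l) = 0" for l :: real
  proof -
    \<comment> \<open>Both representations are used at -l. The transform in the second column is
      then evaluated at l, and conjugation moves the other one there too.\<close>
    have "(h $ 1 $ 2 + half_fourier (?k 1 2) (of_real l)) + cnj (h $ 2 $ 1 + half_fourier (?k 2 1) (of_real (- l))) = 0"
      using e(2)[of "- l" 1, symmetric] e(1)[of "- l" 2, symmetric] c[of "- l"] by (simp add: P)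
    then show ?thesis
      unfolding complex_cnj_add cnj_half_fourier
      by (subst half_fourier_add) (auto simp: ki algebra_simps)
  qed
  have z2: "(h $ 2 $ 2 - cnj (h $ 1 $ 1)) + half_fourier (\<lambda>t. ?k 2 2 t - cnj (?k 1 1 t)) (of_real l) = 0" for l :: real
  proof -
    have "(h $ 2 $ 2 + half_fourier (?k 2 2) (of_real l)) - cnj (h $ 1 $ 1 + half_fourier (?k 1 1) (of_real (- l))) = 0"
      using e(2)[of "- l" 2, symmetric] e(1)[of "- l" 1, symmetric] c[of "- l"] by (simp add: P)
    then show ?thesis
      unfolding complex_cnj_add cnj_half_fourier
      by (subst half_fourier_diff) (auto simp: ki algebra_simps)
  qed
  have i1: "integrable lborel (\<lambda>t. ?k 1 2 t + cnj (?k 2 1 t))" and i2: "integrable lborel (\<lambda>t. ?k 2 2 t - cnj (?k 1 1 t))"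
    using ki by auto
  show "h $ 1 $ 2 = - cnj (h $ 2 $ 1)"
    using half_fourier_const_zero(1)[OF i1 z1] by (simp add: add_eq_0_iff2)
  show "h $ 2 $ 2 = cnj (h $ 1 $ 1)"
    using half_fourier_const_zero(1)[OF i2 z2] by simp
  have "AE t in lborel. x + t \<ge> x \<longrightarrow> k (x + t) $ 1 $ 2 = - cnj (k (x + t) $ 2 $ 1) \<and> k (x + t) $ 2 $ 2 = cnj (k (x + t) $ 1 $ 1)"
    using half_fourier_const_zero(2)[OF i1 z1] half_fourier_const_zero(2)[OF i2 z2]
    by eventually_elim (auto simp: half_entry_def add_eq_0_iff2)
  then show "AE y in lborel. y \<ge> x \<longrightarrow> k y $ 1 $ 2 = - cnj (k y $ 2 $ 1) \<and> k y $ 2 $ 2 = cnj (k y $ 1 $ 1)"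
    by (rule AE_lborel_shift)
qed

text \<open>By the symmetry of \<open>h\<close> and \<open>k\<close>, the (1,1) entry of the
  left-hand side is the conjugate of the (2,2) entry, and the (2,1) entry is minus the conjugate of
  the (1,2) entry. The second column therefore suffices.\<close>

lemma marchenko_matrix:
  fixes k :: "real \<Rightarrow> complex^2^2" and h :: "complex^2^2" and om :: "real \<Rightarrow> complex"
  assumes int: "\<And>i j. set_integrable lborel {z..} (\<lambda>u. k u $ i $ j * om (u + y))"
      "\<And>i j. set_integrable lborel {z..} (\<lambda>u. k u $ i $ j * cnj (om (u + y)))"
    and row: "\<And>i. k y $ i $ 2 + h $ i $ 1 * om (z + y) + (LINT u:{z..}|lborel. k u $ i $ 1 * om (u + y)) = 0"
    and h: "h $ 1 $ 2 = - cnj (h $ 2 $ 1)" "h $ 2 $ 2 = cnj (h $ 1 $ 1)"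
    and k_AE: "AE u in lborel. u \<ge> z \<longrightarrow> k u $ 1 $ 2 = - cnj (k u $ 2 $ 1) \<and> k u $ 2 $ 2 = cnj (k u $ 1 $ 1)"
    and k_y: "k y $ 1 $ 2 = - cnj (k y $ 2 $ 1)" "k y $ 2 $ 2 = cnj (k y $ 1 $ 1)"
  shows "k y + h ** Omega_of (om (z + y)) + (LINT u:{z..}|lborel. k u ** Omega_of (om (u + y))) = 0"
proof -
  define M where "M = (\<lambda>u. indicator {z..} u *\<^sub>R (k u ** Omega_of (om (u + y))))"
  have M1: "M u $ i $ 1 = - (indicator {z..} u *\<^sub>R (k u $ i $ 2 * cnj (om (u + y))))"
    and M2: "M u $ i $ 2 = indicator {z..} u *\<^sub>R (k u $ i $ 1 * om (u + y))" for u i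
    by (auto simp: M_def matrix2_mult_nth Omega_of_def mat2_nth)
  have "integrable lborel (\<lambda>u. M u $ i $ 1)" "integrable lborel (\<lambda>u. M u $ i $ 2)" for i
    unfolding M1 M2 using int(1)[of i 1] int(2)[of i 2] by (auto simp: set_integrable_def)
  then have "integrable lborel (\<lambda>u. M u $ i $ j)" for i j using exhaust_2[of j] by auto
  then have "integrable lborel M" by (rule integrable_entries)
  then have ent: "(\<integral>u. M u \<partial>lborel) $ i $ j = (\<integral>u. M u $ i $ j \<partial>lborel)" for i j
    by (rule integral_bounded_linear[OF bounded_linear_entry, symmetric])
  have I2: "(\<integral>u. M u $ i $ 2 \<partial>lborel) = (LINT u:{z..}|lborel. k u $ i $ 1 * om (u + y))" for i
    unfolding M2 set_lebesgue_integral_def ..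
  have cong: "(\<integral>u. indicator {z..} u *\<^sub>R (k u $ i $ 2 * cnj (om (u + y))) \<partial>lborel) = c * cnj (LINT u:{z..}|lborel. k u $ j $ 1 * om (u + y))"
    if *: "AE u in lborel. u \<ge> z \<longrightarrow> k u $ i $ 2 = c * cnj (k u $ j $ 1)" for i j c
  proof -
    have "(\<integral>u. indicator {z..} u *\<^sub>R (k u $ i $ 2 * cnj (om (u + y))) \<partial>lborel)
        = (\<integral>u. c * cnj (indicator {z..} u *\<^sub>R (k u $ j $ 1 * om (u + y))) \<partial>lborel)"
    proof (rule integral_cong_AE)
      show "(\<lambda>u. indicator {z..} u *\<^sub>R (k u $ i $ 2 * cnj (om (u + y)))) \<in> borel_measurable lborel"
        using int(2)[of i 2] by (simp add: set_integrable_def borel_measurable_integrable)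
      have "integrable lborel (\<lambda>u. c * cnj (indicator {z..} u *\<^sub>R (k u $ j $ 1 * om (u + y))))"
        using int(1)[of j 1] by (intro integrable_mult_right integrable_cnj) (simp add: set_integrable_def)
      then show "(\<lambda>u. c * cnj (indicator {z..} u *\<^sub>R (k u $ j $ 1 * om (u + y)))) \<in> borel_measurable lborel"
        by (rule borel_measurable_integrable)
      show "AE u in lborel. indicator {z..} u *\<^sub>R (k u $ i $ 2 * cnj (om (u + y))) = c * cnj (indicator {z..} u *\<^sub>R (k u $ j $ 1 * om (u + y)))"
        using * by eventually_elim (auto simp: indicator_def)
    qed
    then show ?thesis by (simp only: set_lebesgue_integral_def integral_mult_right_zero Bochner_Integration.integral_cnj)
  qed
  have c1: "(\<integral>u. indicator {z..} u *\<^sub>R (k u $ 1 $ 2 * cnj (om (u + y))) \<partial>lborel) = - 1 * cnj (LINT u:{z..}|lborel. k u $ 2 $ 1 * om (u + y))"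
    by (rule cong) (use k_AE in \<open>auto elim!: eventually_mono\<close>)
  have c2: "(\<integral>u. indicator {z..} u *\<^sub>R (k u $ 2 $ 2 * cnj (om (u + y))) \<partial>lborel) = 1 * cnj (LINT u:{z..}|lborel. k u $ 1 $ 1 * om (u + y))"
    by (rule cong) (use k_AE in \<open>auto elim!: eventually_mono\<close>)
  have "(LINT u:{z..}|lborel. k u ** Omega_of (om (u + y))) = (\<integral>u. M u \<partial>lborel)"
    by (simp add: M_def set_lebesgue_integral_def)
  moreover have "(k y + h ** Omega_of (om (z + y)) + (\<integral>u. M u \<partial>lborel)) $ i $ j = 0" for i j
  proof -
    have I1: "(\<integral>u. M u $ i $ 1 \<partial>lborel) = - (\<integral>u. indicator {z..} u *\<^sub>R (k u $ i $ 2 * cnj (om (u + y))) \<partial>lborel)" for i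
      unfolding M1 by (rule Bochner_Integration.integral_minus)
    have "(k y + h ** Omega_of (om (z + y)) + (\<integral>u. M u \<partial>lborel)) $ 1 $ 1 =
        cnj (k y $ 2 $ 2 + h $ 2 $ 1 * om (z + y) + (LINT u:{z..}|lborel. k u $ 2 $ 1 * om (u + y)))"
      unfolding vector_add_component ent I1 c1 matrix2_mult_nth Omega_of_def mat2_nth h k_y by simp
    moreover have "(k y + h ** Omega_of (om (z + y)) + (\<integral>u. M u \<partial>lborel)) $ 2 $ 1 =
        - cnj (k y $ 1 $ 2 + h $ 1 $ 1 * om (z + y) + (LINT u:{z..}|lborel. k u $ 1 $ 1 * om (u + y)))"
      unfolding vector_add_component ent I1 c2 matrix2_mult_nth Omega_of_def mat2_nth h k_y by simp
    ultimately have "(k y + h ** Omega_of (om (z + y)) + (\<integral>u. M u \<partial>lborel)) $ 1 $ 1 = 0"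
      "(k y + h ** Omega_of (om (z + y)) + (\<integral>u. M u \<partial>lborel)) $ 2 $ 1 = 0"
      unfolding row by simp_all
    moreover have "(k y + h ** Omega_of (om (z + y)) + (\<integral>u. M u \<partial>lborel)) $ i $ 2 = 0" for i
      using row[of i] by (simp add: ent I2 matrix2_mult_nth Omega_of_def mat2_nth)
    ultimately show ?thesis using exhaust_2[of i] exhaust_2[of j] by auto
  qed
  ultimately show ?thesis by (simp add: vec_eq_iff)
qed

section \<open>The Marchenko equation\<close>

text \<open>Splitting the matrix integral into entries needs genuine integrability, since a
  divergent integral has a default value. The \<open>r\<close> part is a correlation; the
  exponentials are bounded on the half-line because \<open>\<i> * a s\<close> lies in the upper
  half-plane.\<close>

lemma AE_integrable_kernel:
  fixes kk :: "real \<Rightarrow> complex"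
  assumes kk: "set_integrable lborel {z..} kk" and r: "integrable lborel r"
    and a: "\<And>s. s \<in> I \<Longrightarrow> Re (a s) > 0"
  shows "AE y in lborel. set_integrable lborel {z..} (\<lambda>u. kk u * (r (u + y) + (\<Sum>s\<in>I. exp (- a s * of_real (u + y)) * c s)))"
proof -
  define k where "k = (\<lambda>s. indicator {0..} s *\<^sub>R kk (z + s))"
  have k: "integrable lborel k"
    using kk unfolding set_integrable_shift[of z] k_def by (simp add: set_integrable_def)
  have "integrable lborel (\<lambda>w. r (z + w))" using lborel_integrable_real_affine[OF r, of 1 z] by simp
  from correlation_AE_integrable[OF k this] show ?thesis
  proof eventually_elim
    case (elim y)
    have "set_integrable lborel {0..} (\<lambda>t. k t * r (z + (t + y)) + (\<Sum>s\<in>I. (exp (- a s * of_real (z + y)) * c s) * (exp (\<i> * (\<i> * a s) * of_real t) * k t)))"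
      unfolding set_integrable_def scaleR_add_right scaleR_sum_right
    proof (intro Bochner_Integration.integrable_add Bochner_Integration.integrable_sum)
      show "integrable lborel (\<lambda>t. indicator {0..} t *\<^sub>R (k t * r (z + (t + y))))"
        using elim by (simp add: set_integrable_def)
      fix s assume "s \<in> I"
      have "integrable lborel (\<lambda>t. (exp (- a s * of_real (z + y)) * c s) * (indicator {0..} t *\<^sub>R (exp (\<i> * (\<i> * a s) * of_real t) * k t)))"
        using half_fourier_integrable[OF k, of "\<i> * a s"] a[OF \<open>s \<in> I\<close>]
        by (intro integrable_mult_right) (simp add: set_integrable_def)
      then show "integrable lborel (\<lambda>t. indicator {0..} t *\<^sub>R ((exp (- a s * of_real (z + y)) * c s) * (exp (\<i> * (\<i> * a s) * of_real t) * k t)))"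
        by (simp only: mult_scaleR_right)
    qed
    also have "(\<lambda>t. k t * r (z + (t + y)) + (\<Sum>s\<in>I. (exp (- a s * of_real (z + y)) * c s) * (exp (\<i> * (\<i> * a s) * of_real t) * k t)))
       = (\<lambda>t. k t * (r ((z + t) + y) + (\<Sum>s\<in>I. exp (- a s * of_real ((z + t) + y)) * c s)))"
    proof (rule ext)
      fix t
      have "exp (- a s * of_real (z + y)) * exp (\<i> * (\<i> * a s) * of_real t) = exp (- a s * of_real ((z + t) + y))" for s
        unfolding exp_add[symmetric] by (rule arg_cong[of _ _ exp]) (simp add: algebra_simps mult.assoc[symmetric])
      then have "(exp (- a s * of_real (z + y)) * c s) * (exp (\<i> * (\<i> * a s) * of_real t) * k t) = k t * (exp (- a s * of_real ((z + t) + y)) * c s)" for s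
        by (metis (no_types, lifting) mult.assoc mult.commute)
      then show "k t * r (z + (t + y)) + (\<Sum>s\<in>I. (exp (- a s * of_real (z + y)) * c s) * (exp (\<i> * (\<i> * a s) * of_real t) * k t))
          = k t * (r ((z + t) + y) + (\<Sum>s\<in>I. exp (- a s * of_real ((z + t) + y)) * c s))"
        by (simp only: distrib_left[of "k t"] sum_distrib_left add.assoc)
    qed
    finally have "set_integrable lborel {0..} (\<lambda>t. kk (z + t) * (r ((z + t) + y) + (\<Sum>s\<in>I. exp (- a s * of_real ((z + t) + y)) * c s)))"
      unfolding set_integrable_def k_def
      by (rule Bochner_Integration.integrable_cong[THEN iffD1, rotated -1]) (auto simp: indicator_def)
    then show ?case by (subst set_integrable_shift)
  qed
qed

theorem theorem2:
  fixes m :: "real \<Rightarrow> real^3"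
    and Psi Phi :: "real \<Rightarrow> real \<Rightarrow> complex^2^2"
    and psi phi :: "real \<Rightarrow> complex \<Rightarrow> complex^2"
    and a :: "complex \<Rightarrow> complex" and b :: "real \<Rightarrow> complex"
    and N :: nat and as :: "nat \<Rightarrow> complex" and Ns :: "nat \<Rightarrow> complex"
    and rho :: "real \<Rightarrow> complex"
    and H :: "real \<Rightarrow> complex^2^2" and K :: "real \<Rightarrow> real \<Rightarrow> complex^2^2"
    and z :: real
  assumes unit: "\<And>x. norm (m x) = 1"
    and lim_top: "(m \<longlongrightarrow> e3) at_top" and lim_bot: "(m \<longlongrightarrow> e3) at_bot"
    (* (H1) *)
    and H1: "\<And>k. integrable lborel (\<lambda>x. m x $ k - e3 $ k)"
    (* (H2) *)
    and H2_ac: "abs_continuous_on UNIV m"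
    and H2_deriv: "\<exists>m'. (AE x in lborel. (m has_vector_derivative m' x) (at x))
                       \<and> (\<forall>k. integrable lborel (\<lambda>x. m' x $ k))"
    (* (H3) *)
    and H3: "\<And>x. m x $ 3 > -1"
    (* Jost matrices for real lambda *)
    and Psi_ode: "\<And>l x. ((\<lambda>y. Psi y l) has_vector_derivative
                          (cscale (\<i> * of_real l) (msig (m x) ** Psi x l))) (at x)"
    and Psi_asym: "\<And>l. ((\<lambda>y. ediag (- l * y) ** Psi y l) \<longlongrightarrow> mat 1) at_top"
    and Phi_ode: "\<And>l x. ((\<lambda>y. Phi y l) has_vector_derivative
                          (cscale (\<i> * of_real l) (msig (m x) ** Phi x l))) (at x)"
    and Phi_asym: "\<And>l. ((\<lambda>y. ediag (- l * y) ** Phi y l) \<longlongrightarrow> mat 1) at_bot"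
    (* analytic continuation of the columns psi (first of Psi), phi (second of Phi) *)
    and psi_hol: "\<And>x k. (\<lambda>l. psi x l $ k) holomorphic_on {l. Im l > 0}"
    and psi_cont: "\<And>x. continuous_on {l. Im l \<ge> 0} (psi x)"
    and psi_bd: "\<And>x l. psi x (of_real l) = column 1 (Psi x l)"
    and phi_hol: "\<And>x k. (\<lambda>l. phi x l $ k) holomorphic_on {l. Im l > 0}"
    and phi_cont: "\<And>x. continuous_on {l. Im l \<ge> 0} (phi x)"
    and phi_bd: "\<And>x l. phi x (of_real l) = column 2 (Phi x l)"
    (* transition matrix, a analytic in C^+ *)
    and T_rel: "\<And>x l. Psi x l = Phi x l ** Tmat (a (of_real l)) (b l)"
    and a_hol: "a holomorphic_on {l. Im l > 0}"
    and a_cont: "continuous_on {l. Im l \<ge> 0} a"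
    (* a has no real zeros *)
    and a_real_nz: "\<And>l::real. a (of_real l) \<noteq> 0"
    (* 1/a has exactly the poles i a_1, ..., i a_N in C^+, all simple *)
    and as_pos: "\<And>s. s \<in> {1..N} \<Longrightarrow> Im (\<i> * as s) > 0"
    and as_inj: "inj_on as {1..N}"
    and poles: "{l. Im l > 0 \<and> a l = 0} = (\<lambda>s. \<i> * as s) ` {1..N}"
    and simple: "\<And>s. s \<in> {1..N} \<Longrightarrow> deriv a (\<i> * as s) \<noteq> 0"
    (* norming constants: tau_s phi(x, i a_s) = i N_s psi(x, i a_s), tau_s = 1/a'(i a_s) *)
    and norming: "\<And>s x. s \<in> {1..N} \<Longrightarrow>
        (1 / deriv a (\<i> * as s)) *s phi x (\<i> * as s) = (\<i> * Ns s) *s psi x (\<i> * as s)"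
    (* rho *)
    and rho_int: "integrable lborel rho"
    and rho_ft: "\<And>l::real. b l / a (of_real l) = (\<integral>w. exp (- \<i> * of_real (l * w)) * rho w \<partial>lborel)"
    (* triangular representation *)
    and H_lim: "(H \<longlongrightarrow> mat 1) at_top"
    and K_int: "\<And>x. set_integrable lborel {x..} (K x)"
    and K_unif: "\<And>x0 e. e > 0 \<Longrightarrow> \<exists>R. \<forall>x\<ge>x0.
                   (LINT y:{max x R..}|lborel. norm (K x y)) < e"
    and tri: "\<And>x l. Psi x l = H x ** ediag (l * x) + (LINT y:{x..}|lborel. K x y ** ediag (l * y))"
  shows "AE y in lborel. y > z \<longrightarrow>
           K z y + H z ** Omega_of (rho (z + y) + (\<Sum>s=1..N. exp (- as s * of_real (z + y)) * Ns s))
           + (LINT u:{z..}|lborel. K z u ** Omega_of (rho (u + y) + (\<Sum>s=1..N. exp (- as s * of_real (u + y)) * Ns s)))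
           = 0"
proof -
  define om where "om = (\<lambda>w. rho w + (\<Sum>s=1..N. exp (- as s * of_real w) * Ns s))"
  have Psi_str: "Psi x l $ 1 $ 2 = - cnj (Psi x l $ 2 $ 1)" "Psi x l $ 2 $ 2 = cnj (Psi x l $ 1 $ 1)"
      "(norm (Psi x l $ 1 $ 1))\<^sup>2 + (norm (Psi x l $ 2 $ 1))\<^sup>2 = 1" for x l
    by (rule jost_matrix_structure[where X = "\<lambda>y. Psi y l" and F = at_top, OF Psi_ode Psi_asym]; simp)+
  have Phi_str: "Phi x l $ 1 $ 2 = - cnj (Phi x l $ 2 $ 1)" "Phi x l $ 2 $ 2 = cnj (Phi x l $ 1 $ 1)"
      "(norm (Phi x l $ 1 $ 1))\<^sup>2 + (norm (Phi x l $ 2 $ 1))\<^sup>2 = 1" for x l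
    by (rule jost_matrix_structure[where X = "\<lambda>y. Phi y l" and F = at_bot, OF Phi_ode Phi_asym]; simp)+
  have ab: "(norm (a (of_real l)))\<^sup>2 + (norm (b l))\<^sup>2 = 1"
    and a_det: "a (of_real l) = Psi x l $ 1 $ 1 * Phi x l $ 2 $ 2 - Psi x l $ 2 $ 1 * Phi x l $ 1 $ 2"
    and phi_psi: "Phi x l $ i $ 2 = b l * Psi x l $ i $ 1 + a (of_real l) * Psi x l $ i $ 2" for x l i
    using scattering_relations[OF Psi_str Phi_str T_rel] by blast+

  have m_cont: "continuous_on UNIV m" by (rule abs_continuous_imp_continuous[OF H2_ac])
  obtain m' :: "real \<Rightarrow> real^3" where m': "AE x in lborel. (m has_vector_derivative m' x) (at x)" "\<And>k. integrable lborel (\<lambda>x. m' x $ k)"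
    using H2_deriv by blast
  obtain v where v: "(v \<longlongrightarrow> 0) at_bot" "\<And>x. v x \<ge> 0" "\<And>s t. s \<le> t \<Longrightarrow> norm (m t - m s) \<le> v t - v s"
    using abs_continuous_tail_variation[OF H2_ac m'] by blast
  \<comment> \<open>Let s tend to -\<infinity> in the variation bound.\<close>
  have v_e3: "norm (m t - e3) \<le> v t" for t
  proof (rule tendsto_upperbound)
    show "((\<lambda>s. norm (m t - m s)) \<longlongrightarrow> norm (m t - e3)) at_bot" by (intro tendsto_intros lim_bot)
    show "\<forall>\<^sub>F s in at_bot. norm (m t - m s) \<le> v t"
      unfolding eventually_at_bot_linorder
    proof (intro exI[of _ t] allI impI)
      fix s assume "s \<le> t"
      then show "norm (m t - m s) \<le> v t" using v(2)[of s] v(3)[of s t] by linarith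
    qed
  qed simp
  have m_int: "integrable lborel (\<lambda>x. norm (m x - e3))"
  proof (rule Bochner_Integration.integrable_bound)
    show "integrable lborel (\<lambda>x. \<Sum>k\<in>UNIV. \<bar>m x $ k - e3 $ k\<bar>)"
      using H1 by (intro Bochner_Integration.integrable_sum integrable_abs) auto
    show "(\<lambda>x. norm (m x - e3)) \<in> borel_measurable lborel"
      using m_cont by (auto intro!: borel_measurable_continuous_onI continuous_intros)
    show "AE x in lborel. norm (norm (m x - e3)) \<le> norm (\<Sum>k\<in>UNIV. \<bar>m x $ k - e3 $ k\<bar>)"
      using norm_le_l1_cart[of "m _ - e3"] by (intro AE_I2) (simp add: sum_nonneg)
  qed

  \<comment> \<open>On the real line the weight cancels the phase exp(-i l x) that \<phi> has at
    -\<infinity>.\<close>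
  define f where "f = (\<lambda>x i l. exp (\<i> * l * of_real x) * phi x l $ i)"
  have f_hol: "f x i holomorphic_on {l. Im l > 0}" and f_cont: "continuous_on {l. Im l \<ge> 0} (f x i)" for x i
    unfolding f_def by (auto intro!: holomorphic_intros phi_hol continuous_intros bounded_linear.continuous_on[OF bounded_linear_vec_nth phi_cont])
  have phi_re: "phi x (of_real l) $ i = Phi x l $ i $ 2" for x l i
    by (simp add: phi_bd column_def)
  have f_bounds: "norm (f x 1 l) \<le> 1" "norm (f x 2 l) \<le> 1" "norm (f x 1 l) \<le> v x" "norm (f x 2 l) \<ge> 1 - v x"
    if l: "Im l \<ge> 0" for x l
  proof -
    \<comment> \<open>The weighted column solves w' = i l (1 + m \<cdot> \<sigma>) w, and 1 + m
      \<cdot> \<sigma> is twice the projection \<open>proj_plus\<close>.\<close>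
    define W where "W = (\<lambda>l t. cmul (exp (\<i> * of_real l * of_real t)) (Phi t l $ 1 $ 2, Phi t l $ 2 $ 2))"
    have W_ode: "(W l has_vector_derivative cmul (2 * \<i> * of_real l) (proj_plus (m t) (W l t))) (at t)" for l t
    proof -
      have "((\<lambda>w. exp (\<i> * of_real l * w)) has_field_derivative (\<i> * of_real l) * exp (\<i> * of_real l * of_real t)) (at (of_real t))"
        by (rule derivative_eq_intros refl | simp)+
      from has_vector_derivative_cmul[OF has_vector_derivative_real_field[OF this] column_ode[OF Phi_ode]]
      have "(W l has_vector_derivative cmul ((\<i> * of_real l) * exp (\<i> * of_real l * of_real t)) (Phi t l $ 1 $ 2, Phi t l $ 2 $ 2)
          + cmul (exp (\<i> * of_real l * of_real t)) (cmul (\<i> * of_real l) (pauli (m t) (Phi t l $ 1 $ 2, Phi t l $ 2 $ 2)))) (at t)"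
        unfolding W_def .
      moreover have "cmul (\<i> * of_real l) (W l t) + cmul (\<i> * of_real l) (pauli (m t) (W l t)) = cmul (2 * \<i> * of_real l) (proj_plus (m t) (W l t))"
        by (simp add: proj_plus_def cmul_def scaleR_conv_of_real algebra_simps)
      ultimately show ?thesis by (simp add: W_def pauli_cmul cmul_cmul mult.commute)
    qed
    have W_norm: "norm (W l t) = 1" for l t
    proof -
      have "(norm (W l t))\<^sup>2 = 1\<^sup>2"
        using Phi_str(3)[of t l] by (simp add: W_def norm_cmul norm_prod_power2 Phi_str norm_exp_eq_Re power_mult_distrib add.commute)
      then show ?thesis by (rule power2_eq_imp_eq) auto
    qed
    have W_asym: "((\<lambda>t. frozen_flow (- t) e3 (of_real l) (W l t)) \<longlongrightarrow> (0, 1)) at_bot" for l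
    proof -
      have ent: "((\<lambda>y. (ediag (- l * y) ** Phi y l) $ i $ 2) \<longlongrightarrow> mat 1 $ i $ 2) at_bot" for i
        by (intro tendsto_vec_nth Phi_asym)
      have "((\<lambda>t. ((ediag (- l * t) ** Phi t l) $ 1 $ 2, (ediag (- l * t) ** Phi t l) $ 2 $ 2)) \<longlongrightarrow> (0, 1)) at_bot"
        using tendsto_Pair[OF ent[of 1] ent[of 2]] by (simp add: mat_def)
      moreover have "frozen_flow (- t) e3 (of_real l) (W l t) = ((ediag (- l * t) ** Phi t l) $ 1 $ 2, (ediag (- l * t) ** Phi t l) $ 2 $ 2)" for t
      proof -
        \<comment> \<open>Pulling back along \<open>e3\<close> changes the weight of the first
          component to exp(-i l t) and leaves the second at exp(i l t), which gives exactly the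
          second column of \<open>ediag (- l * t) ** Phi t l\<close>.\<close>
        have "exp (2 * \<i> * of_real l * of_real (- t)) * exp (\<i> * of_real l * of_real t) = exp (\<i> * of_real (- l * t))"
          unfolding exp_add[symmetric] by (simp add: algebra_simps)
        then show ?thesis
          by (simp add: frozen_flow_def proj_e3 W_def cmul_def matrix2_mult_nth ediag_def mat2_nth mult.assoc[symmetric] del: of_real_minus of_real_mult)
             (simp add: mult.assoc)
      qed
      ultimately show ?thesis by simp
    qed
    have W_f: "W l x = (f x 1 (of_real l), f x 2 (of_real l))" for l
      by (simp add: W_def f_def cmul_def phi_re)
    show "norm (f x 1 l) \<le> 1" "norm (f x 2 l) \<le> 1" "norm (f x 1 l) \<le> v x" "norm (f x 2 l) \<ge> 1 - v x"
      using jost_continuation_bounds[where m = m and W = W and v = v and x = x and ?f1.0 = "f x 1" and ?f2.0 = "f x 2",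
          OF unit m_cont m_int W_ode W_norm W_asym f_hol f_cont f_hol f_cont W_f v(3) v_e3 l] by blast+
  qed

  define kf where "kf = (\<lambda>x. half_entry x (K x))"
  have kf: "integrable lborel (kf x i j)" for x i j
    unfolding kf_def by (rule half_entry_integrable[OF K_int])
  have Psi1: "exp (- \<i> * of_real (l * x)) * Psi x l $ i $ 1 = H x $ i $ 1 + half_fourier (kf x i 1) (of_real l)"
    and Psi2: "exp (\<i> * of_real (l * x)) * Psi x l $ i $ 2 = H x $ i $ 2 + half_fourier (kf x i 2) (- of_real l)" for x i l
    unfolding kf_def by (rule triangular_entries[OF K_int tri])+
  \<comment> \<open>The triangular representation itself continues exp(-i l x) \<psi> and shows its
    limit at infinity, the first column of \<open>H x\<close>.\<close>
  define u where "u = (\<lambda>x i l. H x $ i $ 1 + half_fourier (kf x i 1) l)"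
  have u_hol: "u x i holomorphic_on {l. Im l > 0}" and u_cont: "continuous_on {l. Im l \<ge> 0} (u x i)" for x i
    unfolding u_def by (intro holomorphic_intros half_fourier_holomorphic kf, intro continuous_intros half_fourier_continuous kf)
  have u_re: "u x i (of_real l) = exp (- \<i> * of_real (l * x)) * Psi x l $ i $ 1" for x i l
    using Psi1[of l x i] by (simp add: u_def)
  have psi_u: "exp (- (\<i> * l * of_real x)) * psi x l $ i = u x i l" if "Im l \<ge> 0" for x i l
  proof (rule half_plane_eq[OF _ _ u_hol u_cont _ that])
    show "(\<lambda>l. exp (- (\<i> * l * of_real x)) * psi x l $ i) holomorphic_on {l. Im l > 0}"
      by (intro holomorphic_intros psi_hol)
    show "continuous_on {l. Im l \<ge> 0} (\<lambda>l. exp (- (\<i> * l * of_real x)) * psi x l $ i)"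
      by (intro continuous_intros bounded_linear.continuous_on[OF bounded_linear_vec_nth psi_cont])
    show "exp (- (\<i> * of_real l * of_real x)) * psi x (of_real l) $ i = u x i (of_real l)" for l
      by (simp add: u_re psi_bd column_def mult.assoc)
  qed
  \<comment> \<open>The weights of \<psi> and \<phi> are inverse to each other and cancel in the
    determinant.\<close>
  have a_uf: "a l = u x 1 l * f x 2 l - u x 2 l * f x 1 l" if "Im l \<ge> 0" for x l
  proof (rule half_plane_eq[OF a_hol a_cont _ _ _ that])
    show "(\<lambda>l. u x 1 l * f x 2 l - u x 2 l * f x 1 l) holomorphic_on {l. Im l > 0}"
      by (intro holomorphic_intros u_hol f_hol)
    show "continuous_on {l. Im l \<ge> 0} (\<lambda>l. u x 1 l * f x 2 l - u x 2 l * f x 1 l)"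
      by (intro continuous_intros u_cont f_cont)
    show "a (of_real l) = u x 1 (of_real l) * f x 2 (of_real l) - u x 2 (of_real l) * f x 1 (of_real l)" for l
    proof -
      have "exp (- \<i> * of_real (l * x)) * exp (\<i> * of_real l * of_real x) = 1"
        unfolding exp_add[symmetric] by simp
      then have "(exp (- \<i> * of_real (l * x)) * p) * (exp (\<i> * of_real l * of_real x) * q) = p * q" for p q
        by (metis (no_types, lifting) mult.assoc mult.commute mult_1)
      then show ?thesis by (simp only: u_re f_def phi_re a_det[of l x])
    qed
  qed

  \<comment> \<open>Far to the left \<open>f\<close> is nearly \<open>(0, 1)\<close> up to a phase, so \<open>|u\<^sub>1|\<close> is nearly \<open>|a|\<close>. As \<open>|a|\<close> tends to 1 on the real
    line, the limit \<open>H\<^sub>1\<^sub>1\<close> of \<open>u\<^sub>1\<close> is nearly unimodular, and this bounds \<open>a\<close> below in the half-plane.\<close>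
  obtain B where B: "\<And>l. Im l \<ge> 0 \<Longrightarrow> norm l \<ge> B \<Longrightarrow> norm (a l) \<ge> 1/2"
  proof -
    obtain x where x: "v x < 1/10"
      using order_tendstoD(2)[OF v(1), of "1/10"] by (auto simp: eventually_at_bot_linorder)
    have RL: "\<exists>B. \<forall>l. Im l \<ge> 0 \<longrightarrow> norm l \<ge> B \<longrightarrow> norm (half_fourier (kf x i 1) l) < 1/100" for i
      by (rule half_fourier_at_infinity[OF kf]) simp
    obtain B1 where B1: "\<And>l. Im l \<ge> 0 \<Longrightarrow> norm l \<ge> B1 \<Longrightarrow> norm (half_fourier (kf x 1 1) l) < 1/100"
      using RL[of 1] by blast
    obtain B2 where B2: "\<And>l. Im l \<ge> 0 \<Longrightarrow> norm l \<ge> B2 \<Longrightarrow> norm (half_fourier (kf x 2 1) l) < 1/100"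
      using RL[of 2] by blast
    obtain B3 where B3: "\<And>t. t \<ge> B3 \<Longrightarrow> norm (b t / a (of_real t)) < 1/3"
      using fourier_at_infinity[OF rho_int, of "1/3"] unfolding rho_ft by auto
    define t where "t = max \<bar>B1\<bar> (max \<bar>B2\<bar> \<bar>B3\<bar>)"
    have t: "t \<ge> B1" "t \<ge> B2" "t \<ge> B3" "t \<ge> 0" by (auto simp: t_def)
    have "norm (b t) \<le> norm (a (of_real t)) / 3"
      using B3[OF t(3)] a_real_nz[of t] by (simp add: norm_divide divide_less_eq)
    then have "(norm (b t))\<^sup>2 \<le> (norm (a (of_real t)) / 3)\<^sup>2" by (rule power_mono) simp
    \<comment> \<open>From |b| \<le> |a| / 3 and |a|^2 + |b|^2 = 1 one gets |a|^2 \<ge> 9/10, which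
      exceeds 81/100.\<close>
    then have "(9/10)\<^sup>2 \<le> (norm (a (of_real t)))\<^sup>2"
      using ab[of t] by (simp add: power2_eq_square)
    then have a_t: "9/10 \<le> norm (a (of_real t))" by (rule power2_le_imp_le) simp
    have u_t: "(norm (u x 1 (of_real t)))\<^sup>2 + (norm (u x 2 (of_real t)))\<^sup>2 = 1"
      using Psi_str(3)[of x t] by (simp add: u_re norm_mult power_mult_distrib)
    have "(norm (u x 2 (of_real t)))\<^sup>2 \<le> 1\<^sup>2"
      using u_t zero_le_power2[of "norm (u x 1 (of_real t))"] unfolding one_power2 by linarith
    then have u2_t: "norm (u x 2 (of_real t)) \<le> 1" by (rule power2_le_imp_le) simp
    have "norm (a (of_real t)) \<le> norm (u x 1 (of_real t)) * norm (f x 2 (of_real t)) + norm (u x 2 (of_real t)) * norm (f x 1 (of_real t))"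
      unfolding a_uf[of "of_real t" x, simplified] norm_mult[symmetric] by (rule norm_triangle_ineq4)
    also have "\<dots> \<le> norm (u x 1 (of_real t)) * 1 + 1 * (1/10)"
      using f_bounds[of "of_real t" x] u2_t x by (intro add_mono mult_mono) auto
    finally have u1_t: "norm (u x 1 (of_real t)) \<ge> 8/10" using a_t by simp
    have h1: "norm (H x $ 1 $ 1) \<ge> 79/100"
      using u1_t B1[of "of_real t"] t norm_triangle_ineq[of "H x $ 1 $ 1" "half_fourier (kf x 1 1) (of_real t)"]
      by (simp add: u_def)
    have h2: "norm (H x $ 2 $ 1) \<le> 101/100"
      using u2_t B2[of "of_real t"] t norm_triangle_ineq4[of "u x 2 (of_real t)" "half_fourier (kf x 2 1) (of_real t)"]
      by (simp add: u_def)
    have "norm (a l) \<ge> 1/2" if l: "Im l \<ge> 0" "norm l \<ge> max B1 B2" for l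
    proof -
      have u1: "norm (u x 1 l) \<ge> 78/100"
        using h1 B1[of l] l norm_triangle_ineq4[of "u x 1 l" "half_fourier (kf x 1 1) l"] by (simp add: u_def)
      have u2: "norm (u x 2 l) \<le> 102/100"
        using h2 B2[of l] l norm_triangle_ineq[of "H x $ 2 $ 1" "half_fourier (kf x 2 1) l"] by (simp add: u_def)
      \<comment> \<open>The two products leave 0.702 - 0.102 = 0.6 as a lower bound for |a|.\<close>
      have "(78/100) * (9/10) \<le> norm (u x 1 l * f x 2 l)"
        unfolding norm_mult using u1 f_bounds(4)[OF l(1), of x] x by (intro mult_mono) auto
      moreover have "norm (u x 2 l * f x 1 l) \<le> (102/100) * (1/10)"
        unfolding norm_mult using u2 f_bounds(3)[OF l(1), of x] x by (intro mult_mono) auto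
      ultimately show ?thesis
        using norm_triangle_ineq2[of "u x 1 l * f x 2 l" "u x 2 l * f x 1 l"] unfolding a_uf[OF l(1), of x] by simp
    qed
    then show ?thesis using that by blast
  qed

  define g where "g = (\<lambda>s. \<i> * as s)"
  define Z where "Z = g ` {1..N}"
  \<comment> \<open>With p = i a_s and t = y - z, the discrete term at z + y = 2 z + t is N_s exp(2
    i p z) exp(i p t). The inverse of \<open>g\<close> recovers the index from the pole.\<close>
  define c where "c = (\<lambda>p. Ns (inv_into {1..N} g p) * exp (2 * \<i> * p * of_real z))"
  have g_inj: "inj_on g {1..N}"
    unfolding g_def by (intro inj_onI inj_onD[OF as_inj]) simp_all
  have c_g: "c (g s) = Ns s * exp (2 * \<i> * g s * of_real z)" if "s \<in> {1..N}" for s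
    unfolding c_def inv_into_f_f[OF g_inj that] ..
  have om_eq: "rho (2 * z + w) + (\<Sum>p\<in>Z. c p * exp (\<i> * p * of_real w)) = om (2 * z + w)" for w
  proof -
    have "(\<Sum>p\<in>Z. c p * exp (\<i> * p * of_real w)) = (\<Sum>s=1..N. c (g s) * exp (\<i> * g s * of_real w))"
      unfolding Z_def sum.reindex[OF g_inj] comp_def ..
    also have "\<dots> = (\<Sum>s=1..N. exp (- as s * of_real (2 * z + w)) * Ns s)"
    proof (rule sum.cong[OF refl])
      fix s assume s: "s \<in> {1..N}"
      have "exp (2 * \<i> * g s * of_real z) * exp (\<i> * g s * of_real w) = exp (- as s * of_real (2 * z + w))"
        unfolding exp_add[symmetric] by (rule arg_cong[of _ _ exp]) (simp add: g_def algebra_simps)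
      then have "c (g s) * exp (\<i> * g s * of_real w) = Ns s * exp (- as s * of_real (2 * z + w))"
        unfolding c_g[OF s] mult.assoc[of "Ns s"] by (rule arg_cong)
      then show "c (g s) * exp (\<i> * g s * of_real w) = exp (- as s * of_real (2 * z + w)) * Ns s"
        by (simp only: mult.commute)
    qed
    finally show ?thesis by (simp add: om_def)
  qed
  have Zeq: "Z = {l. Im l > 0 \<and> a l = 0}" unfolding Z_def g_def by (rule poles[symmetric])
  have r_int: "integrable lborel (\<lambda>w. rho (2 * z + w))"
    using lborel_integrable_real_affine[OF rho_int, of 1 "2 * z"] by simp
  have row_t: "AE t in lborel. t \<ge> 0 \<longrightarrow>
      kf z i 2 t + H z $ i $ 1 * (rho (2 * z + t) + (\<Sum>p\<in>Z. c p * exp (\<i> * p * of_real t)))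
      + (LINT s:{0..}|lborel. kf z i 1 s * (rho (2 * z + (s + t)) + (\<Sum>p\<in>Z. c p * exp (\<i> * p * of_real (s + t))))) = 0" for i
  proof (rule marchenko_scalar[where n = "f z i" and a = a and C = 1 and d = "1/2" and B = B
        and ?k1.0 = "kf z i 1" and ?k2.0 = "kf z i 2" and r = "\<lambda>w. rho (2 * z + w)"
        and ?H1.0 = "H z $ i $ 1" and ?H2.0 = "H z $ i $ 2" and Z = Z and c = c,
        OF kf kf r_int f_hol f_cont a_hol a_cont _ _ B a_real_nz _ Zeq])
    show "norm (f z i l) \<le> 1" if "Im l \<ge> 0" for l
      using f_bounds(1,2)[OF that, of z] exhaust_2[of i] by auto
    show "finite Z" by (simp add: Z_def)
    show "deriv a p \<noteq> 0" if "p \<in> Z" for p using that simple by (auto simp: Z_def g_def)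
    show "f z i p / deriv a p = \<i> * c p * (H z $ i $ 1 + half_fourier (kf z i 1) p)" if pZ: "p \<in> Z" for p
    proof -
      obtain s where s: "s \<in> {1..N}" "p = g s" using pZ by (auto simp: Z_def)
      have p0: "Im p \<ge> 0" using pZ Zeq by auto
      have h1: "phi z p $ i / deriv a p = \<i> * Ns s * psi z p $ i"
        using arg_cong[OF norming[OF s(1), of z], of "\<lambda>w. w $ i"] by (simp add: s(2) g_def)
      \<comment> \<open>One factor exp(i p z) is the weight in \<open>f\<close>, a second one comes
        from \<psi>; together they give the factor exp(2 i p z) in \<open>c\<close>.\<close>
      have h2: "psi z p $ i = exp (\<i> * p * of_real z) * u z i p"
        unfolding psi_u[OF p0, symmetric] by (simp add: exp_minus)
      have h3: "exp (\<i> * p * of_real z) * exp (\<i> * p * of_real z) = exp (2 * \<i> * p * of_real z)"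
        unfolding exp_add[symmetric] by (rule arg_cong[of _ _ exp]) simp
      have "f z i p / deriv a p = exp (\<i> * p * of_real z) * (phi z p $ i / deriv a p)"
        by (simp add: f_def)
      also have "\<dots> = \<i> * (Ns s * (exp (\<i> * p * of_real z) * exp (\<i> * p * of_real z))) * u z i p"
        unfolding h1 h2 by (simp only: mult_ac)
      also have "\<dots> = \<i> * c p * (H z $ i $ 1 + half_fourier (kf z i 1) p)"
        unfolding h3 by (simp only: s(2) c_g[OF s(1)] u_def)
      finally show ?thesis .
    qed
    show "f z i (of_real x) / a (of_real x) = H z $ i $ 2 + half_fourier (kf z i 2) (- of_real x)
        + (\<integral>w. exp (- \<i> * of_real (x * w)) * rho (2 * z + w) \<partial>lborel) * (H z $ i $ 1 + half_fourier (kf z i 1) (of_real x))" for x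
    proof -
      let ?e = "exp (\<i> * of_real (x * z))"
      have "b x / a (of_real x) = (\<integral>w. exp (- \<i> * of_real (x * (2 * z + w))) * rho (2 * z + w) \<partial>lborel)"
        unfolding rho_ft using lborel_integral_real_affine[of 1 "\<lambda>w. exp (- \<i> * of_real (x * w)) * rho w" "2 * z"] by simp
      also have "\<dots> = (\<integral>w. exp (- \<i> * of_real (x * (2 * z))) * (exp (- \<i> * of_real (x * w)) * rho (2 * z + w)) \<partial>lborel)"
        unfolding mult.assoc[symmetric] exp_add[symmetric]
        by (rule Bochner_Integration.integral_cong) (auto simp: algebra_simps)
      also have "\<dots> = exp (- \<i> * of_real (x * (2 * z))) * (\<integral>w. exp (- \<i> * of_real (x * w)) * rho (2 * z + w) \<partial>lborel)"
        by (rule integral_mult_right_zero)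
      finally have r: "b x / a (of_real x) = exp (- \<i> * of_real (x * (2 * z))) * (\<integral>w. exp (- \<i> * of_real (x * w)) * rho (2 * z + w) \<partial>lborel)" .
      have ee: "?e * exp (- \<i> * of_real (x * z)) = 1" "?e * ?e * exp (- \<i> * of_real (x * (2 * z))) = 1"
        unfolding exp_add[symmetric] by (simp_all add: algebra_simps)
      have p1: "Psi z x $ i $ 1 = ?e * u z i (of_real x)"
        unfolding u_re mult.assoc[symmetric] ee by simp
      have "f z i (of_real x) / a (of_real x) = (b x / a (of_real x)) * ?e * Psi z x $ i $ 1 + ?e * Psi z x $ i $ 2"
        using a_real_nz[of x] unfolding f_def phi_re phi_psi by (simp add: field_simps)
      \<comment> \<open>The weights from \<open>f\<close> and \<psi> cancel the phase caused by
        translating \<open>rho\<close> by 2 z.\<close>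
      also have "(b x / a (of_real x)) * ?e * Psi z x $ i $ 1 = (?e * ?e * exp (- \<i> * of_real (x * (2 * z)))) * (\<integral>w. exp (- \<i> * of_real (x * w)) * rho (2 * z + w) \<partial>lborel) * u z i (of_real x)"
        unfolding r p1 by (simp only: mult_ac)
      finally show ?thesis unfolding ee Psi2 by (simp add: u_def)
    qed
  qed simp
  have row: "AE y in lborel. y \<ge> z \<longrightarrow>
      K z y $ i $ 2 + H z $ i $ 1 * om (z + y) + (LINT u:{z..}|lborel. K z u $ i $ 1 * om (u + y)) = 0" for i
  proof (rule AE_lborel_shift[where z = z])
    show "AE t in lborel. z + t \<ge> z \<longrightarrow>
      K z (z + t) $ i $ 2 + H z $ i $ 1 * om (z + (z + t)) + (LINT u:{z..}|lborel. K z u $ i $ 1 * om (u + (z + t))) = 0"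
      using row_t[of i]
    proof eventually_elim
      case (elim t)
      have "(LINT u:{z..}|lborel. K z u $ i $ 1 * om (u + (z + t))) = (LINT s:{0..}|lborel. kf z i 1 s * om (2 * z + (s + t)))"
        by (subst set_integral_shift, unfold set_lebesgue_integral_def, rule Bochner_Integration.integral_cong)
           (auto simp: kf_def half_entry_def indicator_def algebra_simps)
      moreover have "z + (z + t) = 2 * z + t" by simp
      ultimately show ?case using elim unfolding om_eq by (auto simp: kf_def half_entry_def)
    qed
  qed
  have as_Re: "Re (as s) > 0" if "s \<in> {1..N}" for s using as_pos[OF that] by simp
  have K_ent: "set_integrable lborel {z..} (\<lambda>u. K z u $ i $ j)" for i j
    using integrable_bounded_linear[OF bounded_linear_entry[of i j] K_int[of z, unfolded set_integrable_def]]
    by (simp add: set_integrable_def)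
  have int1: "AE y in lborel. set_integrable lborel {z..} (\<lambda>u. K z u $ i $ j * om (u + y))" for i j
    unfolding om_def by (rule AE_integrable_kernel[OF K_ent rho_int as_Re])
  have int2: "AE y in lborel. set_integrable lborel {z..} (\<lambda>u. K z u $ i $ j * cnj (om (u + y)))" for i j
    using AE_integrable_kernel[OF K_ent[of i j] integrable_cnj[OF rho_int], of "{1..N}" "\<lambda>s. cnj (as s)" "\<lambda>s. cnj (Ns s)"] as_Re
    by (simp add: om_def exp_cnj)
  note str = triangular_kernel_structure[OF K_int tri Psi_str(1,2), of z]
  have "AE y in lborel. \<forall>i\<in>UNIV. \<forall>j\<in>UNIV. set_integrable lborel {z..} (\<lambda>u. K z u $ i $ j * om (u + y)) \<and>
      set_integrable lborel {z..} (\<lambda>u. K z u $ i $ j * cnj (om (u + y)))"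
    using int1 int2 by (intro eventually_ball_finite ballI eventually_conj) auto
  moreover have "AE y in lborel. \<forall>i\<in>UNIV. y \<ge> z \<longrightarrow>
      K z y $ i $ 2 + H z $ i $ 1 * om (z + y) + (LINT u:{z..}|lborel. K z u $ i $ 1 * om (u + y)) = 0"
    using row by (intro eventually_ball_finite ballI) auto
  ultimately have "AE y in lborel. y > z \<longrightarrow>
      K z y + H z ** Omega_of (om (z + y)) + (LINT u:{z..}|lborel. K z u ** Omega_of (om (u + y))) = 0"
    using str(3)
  proof eventually_elim
    case (elim y)
    show ?case
    proof
      assume y: "y > z"
      show "K z y + H z ** Omega_of (om (z + y)) + (LINT u:{z..}|lborel. K z u ** Omega_of (om (u + y))) = 0"
        by (rule marchenko_matrix[OF _ _ _ str]) (use elim y in auto)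
    qed
  qed
  then show ?thesis unfolding om_def .
qed

end
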